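(* Suppose Assumptions 1 and 2 hold. Let $\bar\xi_0\in\Xi_0$, $\bar w_{-1}\in\mathbb R^{n_x}\times\mathbb R^{n_u}$, and $W\in\mathbb Z_{\ge0}$ with $W\ge\bar W:=\frac{\log\left((\alpha^{1/2}-\alpha)/(4c_1^2L^3)\right)}{2\log\rho}$. Then $$J^{(W)}(\bar\xi_0;\bar w_{-1})-J^\star(\bar\xi_0;\bar w_{-1})\le\big[c_5D^2T+c_6D\|\bar w_{-1}\|+c_7\|\bar w_{-1}\|^2\big]\rho^W,$$ where $D:=\max_{t\in\mathcal T}\{\mathbb E[\|p(\xi_t)\|^2\mid\xi_0=\bar\xi_0]\}^{1/2}$, $c_2:=\frac{2c_1^2L}{\rho(1-\rho^{3/2})}$, $c_3:=4c_1^2L\big(\frac{2c_2L}{1-\rho^{1/2}}+\frac1{1-\rho}\big)$, $c_4:=8c_1^2c_2L^3$, $c_5:=c_3\big(\frac{2c_2L}{1-\rho^{1/2}}+\frac{c_3L}2+1\big)+\frac{2c_1^2c_3L^2}{1-\rho^2}\big(-1+2c_3L+\frac4{1-\rho}+\frac{8c_2L}{1-\rho^{1/2}}\big)$, $c_6:=\frac1{1-\rho^{1/2}}\Big(\frac{2c_2c_4L}{1-\rho^{1/2}}+c_3c_4L+c_4+2c_2c_3L^2+\frac{2c_1^2L^2}{1-\rho^2}\big(-c_4+2c_3c_4L+\frac{4c_4}{1-\rho}+\frac{8c_2c_4L}{1-\rho^{1/2}}+2c_3L(4c_2L+c_4)\big)\Big)$, $c_7:=\frac1{1-\rho}\Bi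g(c_4\big(2c_2L^2+\frac{c_4L}2\big)+\frac{4c_1^2c_4L^3(4c_2L+c_4)}{1-\rho^2}\Big)$.
   Context: Setting. $T\in\mathbb Z_{>0}$, $\mathcal T=\{0,\dots,T\}$, $\mathcal T_{a:b}=\mathcal T\cap\{a,\dots,b\}$ (so $\mathcal T_{a:b}=\mathcal T_{a:T}$ if $b>T$). $\boldsymbol\xi=(\xi_0,\dots,\xi_T)$ is a stochastic process with values in a measurable set $\Xi$ with known distribution; $\boldsymbol\xi_{a:b}=(\xi_a,\dots,\xi_b)$; $\Xi_0$ is the support of $\xi_0$, $\boldsymbol\Xi_{0:t}$ the support of $\boldsymbol\xi_{0:t}$, and for $\tau\le t$, $\boldsymbol\Xi_{0:t}(\bar{\boldsymbol\xi}_{0:\tau})=\{\boldsymbol\zeta_{0:t}\in\boldsymbol\Xi_{0:t}:\boldsymbol\zeta_{0:\tau}=\bar{\boldsymbol\xi}_{0:\tau}\}$. Data: functions $A,B,d,Q,R,q,r$ on $\Xi$ with values in $\mathbb R^{n_x\times n_x},\mathbb R^{n_x\times n_u},\mathbb R^{n_x},\mathbb S_{n_x},\mathbb S_{n_u},\mathbb R^{n_x},\mathbb R^{n_u}$; for $w=[x;u]$: $f(w;\xi)=A(\xi)x+B(\xi)u+d(\xi)$, $\ell(w;\xi)=\tfrac12x^\top Q(\xi)x+\tfrac12u^\top R(\xi)u-q(\xi)^\top x-r(\xi)^\top u$, $p(\xi)=[q(\xi);r(\xi);d(\xi)]$. Optimal value: $J^\star(\bar\xi_0;\bar w_{-1})$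 is the minimum of $\mathbb E[\sum_{t\in\mathcal T}\ell(w_t(\boldsymbol\xi_{0:t});\xi_t)\mid\xi_0=\bar\xi_0]$ over functions $w_t=[x_t;u_t]:\boldsymbol\Xi_{0:t}(\bar\xi_0)\to\mathbb R^{n_x}\times\mathbb R^{n_u}$ subject to $x_0(\bar\xi_0)=f(\bar w_{-1};\bar\xi_0)$ and $x_t(\boldsymbol\zeta_{0:t})=f(w_{t-1}(\boldsymbol\zeta_{0:t-1});\zeta_t)$ for all $t\in\mathcal T_{1:T}$, $\boldsymbol\zeta_{0:t}\in\boldsymbol\Xi_{0:t}(\bar\xi_0)$. Truncated problem $\mathrm P_{\tau,W}(\bar{\boldsymbol\xi}_{0:\tau},\bar w_{\tau-1})$: the analogous minimization of $\mathbb E[\sum_{t\in\mathcal T_{\tau:\tau+W}}\ell(w_t(\boldsymbol\xi_{0:t});\xi_t)\mid\boldsymbol\xi_{0:\tau}=\bar{\boldsymbol\xi}_{0:\tau}]$ over $w_t:\boldsymbol\Xi_{0:t}(\bar{\boldsymbol\xi}_{0:\tau})\to\mathbb R^{n_x}\times\mathbb R^{n_u}$, $t\in\mathcal T_{\tau:\tau+W}$, subject to $x_\tau(\bar{\boldsymbol\xi}_{0:\tau})=f(\bar w_{\tau-1};\bar\xi_\tau)$ and $x_t(\boldsymbol\zeta_{0:t})=f(w_{t-1}(\boldsymbol\zeta_{0:t-1});\zeta_t)$ for $t\in\mathcal T_{\tau+1:\tau+W}$, $\boldsymbol\zeta_{0:t}\in\boldsymbol\Xi_{0:t}(\bar{\boldsymbol\xi}_{0:\tau})$;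 solutions for all $\bar{\boldsymbol\xi}_{0:\tau}\in\boldsymbol\Xi_{0:\tau}(\bar\xi_0)$ are glued into $w^{(\tau,W)}_t(\cdot;\bar w_{\tau-1})$ on $\boldsymbol\Xi_{0:t}(\bar\xi_0)$. SPC policy: $w^{(W)}_{-1}=\bar w_{-1}$, $w^{(W)}_t(\boldsymbol\xi_{0:t};\bar w_{-1})=w^{(t,W)}_t(\boldsymbol\xi_{0:t};w^{(W)}_{t-1}(\boldsymbol\xi_{0:t-1};\bar w_{-1}))$. SPC performance: $J^{(W)}(\bar\xi_0;\bar w_{-1})=\mathbb E[\sum_{t\in\mathcal T}\ell(w^{(W)}_t(\boldsymbol\xi_{0:t};\bar w_{-1});\xi_t)\mid\xi_0=\bar\xi_0]$. Assumption 1: $\boldsymbol\xi$ has finite support. Stochastic notions: $\{\Phi_t(\boldsymbol\xi_{0:t})\}_{t\in\mathcal T_{1:T}}$ is $(L,\alpha)$-stable if $\|\Phi_{t''}(\boldsymbol\xi_{0:t''})\cdots\Phi_{t'+1}(\boldsymbol\xi_{0:t'+1})\|\le L\alpha^{t''-t'}$ a.s. for all $t'<t''$ in $\mathcal T$; stabilizability of $(\{A(\xi_t)\},\{B(\xi_t)\})_{t\in\mathcal T_{1:T}}$: there are $K_t(\boldsymbol\xi_{0:t})$, $t\in\mathcal T_{0:T-1}$, $\|K_t\|\le L$ a.s., with $\{A(\xi_t)-B(\xi_t)K_{t-1}(\boldsymbol\xi_{0:t-1})\}_{t\in\mathcal T_{1:T}}$ $(L,\alpha)$-stable; detectability of $(\{A(\xi_t)\}_{t\in\mathcal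 T_{1:T}},\{C(\xi_t)\}_{t\in\mathcal T_{0:T-1}})$: there are $K_t(\boldsymbol\xi_{0:t})$, $t\in\mathcal T_{1:T}$, $\|K_t\|\le L$ a.s., with $\{A(\xi_t)-K_t(\boldsymbol\xi_{0:t})C(\xi_{t-1})\}_{t\in\mathcal T_{1:T}}$ $(L,\alpha)$-stable. Assumption 2: there exist $L\ge1$, $\alpha\in(0,1)$, $\gamma\in(0,1]$ with (a) $\|A(\xi_t)\|,\|B(\xi_t)\|,\|Q(\xi_t)\|,\|R(\xi_t)\|\le L$ a.s.; (b) $Q(\xi_t)\succeq0$, $R(\xi_t)\succeq\gamma I$ a.s.; (c) $(\{A(\xi_t)\},\{B(\xi_t)\})$ is $(L,\alpha)$-stabilizable; (d) $(\{A(\xi_t)\}_{t\in\mathcal T_{1:T}},\{Q(\xi_t)^{1/2}\}_{t\in\mathcal T_{0:T-1}})$ is $(L,\alpha)$-detectable. Constants: $L_H=2L+1$, $\gamma_F=\frac{(1-\alpha)^2}{(1+L)^2L^2}$, $\gamma_G=\frac{\gamma(1-\alpha)^2}{2(1+L)^2L^4}$, $\bar\mu=\frac{2L_H^2/\gamma_G+\gamma_G+L_H}{\gamma_F}$, $\gamma_H=\Big(\frac2{\gamma_G}+\big(1+\frac{4L_H}{\gamma_G}+\frac{4L_H^2}{\gamma_G^2}\big)\frac{L_H(1+\bar\mu L_H)}{\gamma_F}+\bar\mu\Big)^{-1}$, $\rho=\big(\frac{L_H^2-\gamma_H^2}{L_H^2+\gamma_H^2}\big)^{1/2}$, $c_1=\frac{L_H}{\gamma_H^2\rho}$.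 *)

theory Defs
  imports "HOL-Probability.Probability"
begin

(* Problem data A,B,d,Q,R,q,r as functions on the sample space type 'xi (playing the role of \<Xi>).
   State space R^{n_x} = real^'nx, input space R^{n_u} = real^'nu; w = [x;u] is a pair (x,u). *)
record ('xi, 'nx::finite, 'nu::finite) lqdata =
  Am :: "'xi \<Rightarrow> real^'nx^'nx"
  Bm :: "'xi \<Rightarrow> real^'nu^'nx"
  dv :: "'xi \<Rightarrow> real^'nx"
  Qm :: "'xi \<Rightarrow> real^'nx^'nx"
  Rm :: "'xi \<Rightarrow> real^'nu^'nu"
  qv :: "'xi \<Rightarrow> real^'nx"
  rv :: "'xi \<Rightarrow> real^'nu"

definition mnorm :: "real^'n::finite^'m::finite \<Rightarrow> real" where
  "mnorm M = onorm (\<lambda>x. M *v x)"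

definition dyn :: "('xi,'nx::finite,'nu::finite) lqdata \<Rightarrow> (real^'nx) \<times> (real^'nu) \<Rightarrow> 'xi \<Rightarrow> real^'nx" where
  "dyn S w \<xi> = Am S \<xi> *v fst w + Bm S \<xi> *v snd w + dv S \<xi>"

definition stage :: "('xi,'nx::finite,'nu::finite) lqdata \<Rightarrow> (real^'nx) \<times> (real^'nu) \<Rightarrow> 'xi \<Rightarrow> real" where
  "stage S w \<xi> = (1/2) * (fst w \<bullet> (Qm S \<xi> *v fst w)) + (1/2) * (snd w \<bullet> (Rm S \<xi> *v snd w))
                   - qv S \<xi> \<bullet> fst w - rv S \<xi> \<bullet> snd w"

(* norm of p(xi) = [q;r;d] *)
definition pnorm :: "('xi,'nx::finite,'nu::finite) lqdata \<Rightarrow> 'xi \<Rightarrow> real" where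
  "pnorm S \<xi> = sqrt ((norm (qv S \<xi>))^2 + (norm (rv S \<xi>))^2 + (norm (dv S \<xi>))^2)"

(* The process xi = (xi_0,...,xi_T) is a pmf P on lists (paths) of length T+1.
   A policy is w :: nat => 'xi list => (x,u); w t is applied to the prefix xi_{0:t} = take (t+1) zeta.
   Truncated problem P_{tau,N}(a, wp), a = prefix xi_{0:tau}, horizon T_{tau:tau+N}. *)
definition tr_feasible ::
  "('xi,'nx::finite,'nu::finite) lqdata \<Rightarrow> 'xi list pmf \<Rightarrow> nat \<Rightarrow> nat \<Rightarrow> nat \<Rightarrow> 'xi list
    \<Rightarrow> (real^'nx) \<times> (real^'nu) \<Rightarrow> (nat \<Rightarrow> 'xi list \<Rightarrow> (real^'nx) \<times> (real^'nu)) \<Rightarrow> bool" where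
  "tr_feasible S P T \<tau> N a wp w \<longleftrightarrow>
     fst (w \<tau> a) = dyn S wp (last a) \<and>
     (\<forall>\<zeta>\<in>set_pmf P. take (Suc \<tau>) \<zeta> = a \<longrightarrow>
        (\<forall>t\<in>{Suc \<tau>..min (\<tau>+N) T}. fst (w t (take (Suc t) \<zeta>)) = dyn S (w (t-1) (take t \<zeta>)) (\<zeta> ! t)))"

definition tr_cost ::
  "('xi,'nx::finite,'nu::finite) lqdata \<Rightarrow> 'xi list pmf \<Rightarrow> nat \<Rightarrow> nat \<Rightarrow> nat \<Rightarrow> 'xi list
    \<Rightarrow> (nat \<Rightarrow> 'xi list \<Rightarrow> (real^'nx) \<times> (real^'nu)) \<Rightarrow> real" where
  "tr_cost S P T \<tau> N a w =
     measure_pmf.expectation (cond_pmf P {\<zeta>. take (Suc \<tau>) \<zeta> = a})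
       (\<lambda>\<zeta>. \<Sum>t\<in>{\<tau>..min (\<tau>+N) T}. stage S (w t (take (Suc t) \<zeta>)) (\<zeta> ! t))"

definition tr_solution where
  "tr_solution S P T \<tau> N a wp =
     (SOME w. tr_feasible S P T \<tau> N a wp w \<and>
        (\<forall>w'. tr_feasible S P T \<tau> N a wp w' \<longrightarrow> tr_cost S P T \<tau> N a w \<le> tr_cost S P T \<tau> N a w'))"

fun spc :: "('xi,'nx::finite,'nu::finite) lqdata \<Rightarrow> 'xi list pmf \<Rightarrow> nat \<Rightarrow> nat \<Rightarrow> (real^'nx) \<times> (real^'nu)
    \<Rightarrow> nat \<Rightarrow> 'xi list \<Rightarrow> (real^'nx) \<times> (real^'nu)" where
  "spc S P T W wb 0 \<zeta> = tr_solution S P T 0 W (take 1 \<zeta>) wb 0 (take 1 \<zeta>)"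
| "spc S P T W wb (Suc t) \<zeta> =
     tr_solution S P T (Suc t) W (take (Suc (Suc t)) \<zeta>) (spc S P T W wb t \<zeta>) (Suc t) (take (Suc (Suc t)) \<zeta>)"

definition J_spc where
  "J_spc S P T W xi0 wb =
     measure_pmf.expectation (cond_pmf P {\<zeta>. take 1 \<zeta> = [xi0]})
       (\<lambda>\<zeta>. \<Sum>t\<in>{0..T}. stage S (spc S P T W wb t \<zeta>) (\<zeta> ! t))"

(* optimal value J^*: the full problem is literally P_{0,T}([xi0], wb) *)
definition J_star where
  "J_star S P T xi0 wb =
     Inf {tr_cost S P T 0 T [xi0] w | w. tr_feasible S P T 0 T [xi0] wb w}"

fun lprod :: "(nat \<Rightarrow> real^'n::finite^'n) \<Rightarrow> nat \<Rightarrow> nat \<Rightarrow> real^'n^'n" where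
  "lprod \<Phi> t' 0 = mat 1"
| "lprod \<Phi> t' (Suc k) = \<Phi> (t' + Suc k) ** lprod \<Phi> t' k"

definition stable :: "'xi list pmf \<Rightarrow> nat \<Rightarrow> real \<Rightarrow> real \<Rightarrow> (nat \<Rightarrow> 'xi list \<Rightarrow> real^'n::finite^'n) \<Rightarrow> bool" where
  "stable P T L \<alpha> \<Phi> \<longleftrightarrow>
     (\<forall>\<zeta>\<in>set_pmf P. \<forall>t' t''. t' < t'' \<and> t'' \<le> T \<longrightarrow>
        mnorm (lprod (\<lambda>s. \<Phi> s (take (Suc s) \<zeta>)) t' (t'' - t')) \<le> L * \<alpha> ^ (t'' - t'))"

definition stabilizable :: "'xi list pmf \<Rightarrow> nat \<Rightarrow> real \<Rightarrow> real \<Rightarrow> ('xi \<Rightarrow> real^'nx::finite^'nx)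
    \<Rightarrow> ('xi \<Rightarrow> real^'nu::finite^'nx) \<Rightarrow> bool" where
  "stabilizable P T L \<alpha> A B \<longleftrightarrow>
     (\<exists>K :: nat \<Rightarrow> 'xi list \<Rightarrow> real^'nx^'nu.
        (\<forall>\<zeta>\<in>set_pmf P. \<forall>t<T. mnorm (K t (take (Suc t) \<zeta>)) \<le> L) \<and>
        stable P T L \<alpha> (\<lambda>s \<zeta>. A (\<zeta> ! s) - B (\<zeta> ! s) ** K (s - 1) (take s \<zeta>)))"

definition detectable :: "'xi list pmf \<Rightarrow> nat \<Rightarrow> real \<Rightarrow> real \<Rightarrow> ('xi \<Rightarrow> real^'nx::finite^'nx)
    \<Rightarrow> ('xi \<Rightarrow> real^'nx^'ny::finite) \<Rightarrow> bool" where
  "detectable P T L \<alpha> A C \<longleftrightarrow>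
     (\<exists>K :: nat \<Rightarrow> 'xi list \<Rightarrow> real^'ny^'nx.
        (\<forall>\<zeta>\<in>set_pmf P. \<forall>t\<in>{1..T}. mnorm (K t (take (Suc t) \<zeta>)) \<le> L) \<and>
        stable P T L \<alpha> (\<lambda>s \<zeta>. A (\<zeta> ! s) - K s (take (Suc s) \<zeta>) ** C (\<zeta> ! (s - 1))))"

definition psd :: "real^'n::finite^'n \<Rightarrow> bool" where
  "psd M \<longleftrightarrow> transpose M = M \<and> (\<forall>x. 0 \<le> x \<bullet> (M *v x))"

definition msqrt :: "real^'n::finite^'n \<Rightarrow> real^'n^'n" where
  "msqrt M = (THE S. psd S \<and> S ** S = M)"

definition assumption2 :: "('xi,'nx::finite,'nu::finite) lqdata \<Rightarrow> 'xi list pmf \<Rightarrow> nat \<Rightarrow> real \<Rightarrow> real \<Rightarrow> real \<Rightarrow> bool" where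
  "assumption2 S P T L \<alpha> \<gamma> \<longleftrightarrow>
     1 \<le> L \<and> 0 < \<alpha> \<and> \<alpha> < 1 \<and> 0 < \<gamma> \<and> \<gamma> \<le> 1 \<and>
     (\<forall>\<zeta>\<in>set_pmf P. \<forall>t\<le>T.
        mnorm (Am S (\<zeta>!t)) \<le> L \<and> mnorm (Bm S (\<zeta>!t)) \<le> L \<and>
        mnorm (Qm S (\<zeta>!t)) \<le> L \<and> mnorm (Rm S (\<zeta>!t)) \<le> L \<and>
        (\<forall>x. 0 \<le> x \<bullet> (Qm S (\<zeta>!t) *v x)) \<and>
        (\<forall>u. \<gamma> * (u \<bullet> u) \<le> u \<bullet> (Rm S (\<zeta>!t) *v u))) \<and>
     stabilizable P T L \<alpha> (Am S) (Bm S) \<and>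
     detectable P T L \<alpha> (Am S) (\<lambda>\<xi>. msqrt (Qm S \<xi>))"

definition Dconst where
  "Dconst S P T xi0 =
     Max ((\<lambda>t. sqrt (measure_pmf.expectation (cond_pmf P {\<zeta>. take 1 \<zeta> = [xi0]})
                       (\<lambda>\<zeta>. (pnorm S (\<zeta> ! t))^2))) ` {0..T})"

definition "L_H L = 2*L + 1"
definition "gam_F L \<alpha> = (1-\<alpha>)^2 / ((1+L)^2 * L^2)"
definition "gam_G L \<alpha> \<gamma> = \<gamma> * (1-\<alpha>)^2 / (2 * (1+L)^2 * L^4)"
definition "mu_bar L \<alpha> \<gamma> = (2 * (L_H L)^2 / gam_G L \<alpha> \<gamma> + gam_G L \<alpha> \<gamma> + L_H L) / gam_F L \<alpha>"
definition "gam_H L \<alpha> \<gamma> = inverse (2 / gam_G L \<alpha> \<gamma>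
     + (1 + 4 * L_H L / gam_G L \<alpha> \<gamma> + 4 * (L_H L)^2 / (gam_G L \<alpha> \<gamma>)^2)
       * (L_H L * (1 + mu_bar L \<alpha> \<gamma> * L_H L) / gam_F L \<alpha>)
     + mu_bar L \<alpha> \<gamma>)"
definition "rho L \<alpha> \<gamma> = sqrt (((L_H L)^2 - (gam_H L \<alpha> \<gamma>)^2) / ((L_H L)^2 + (gam_H L \<alpha> \<gamma>)^2))"
definition "c1 L \<alpha> \<gamma> = L_H L / ((gam_H L \<alpha> \<gamma>)^2 * rho L \<alpha> \<gamma>)"
definition "Wbar L \<alpha> \<gamma> = ln ((sqrt \<alpha> - \<alpha>) / (4 * (c1 L \<alpha> \<gamma>)^2 * L^3)) / (2 * ln (rho L \<alpha> \<gamma>))"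
definition "c2 L \<alpha> \<gamma> = 2 * (c1 L \<alpha> \<gamma>)^2 * L / (rho L \<alpha> \<gamma> * (1 - rho L \<alpha> \<gamma> powr (3/2)))"
definition "c3 L \<alpha> \<gamma> = 4 * (c1 L \<alpha> \<gamma>)^2 * L *
     (2 * c2 L \<alpha> \<gamma> * L / (1 - sqrt (rho L \<alpha> \<gamma>)) + 1 / (1 - rho L \<alpha> \<gamma>))"
definition "c4 L \<alpha> \<gamma> = 8 * (c1 L \<alpha> \<gamma>)^2 * c2 L \<alpha> \<gamma> * L^3"
definition "c5 L \<alpha> \<gamma> =
   (let \<rho> = rho L \<alpha> \<gamma>; k1 = c1 L \<alpha> \<gamma>; k2 = c2 L \<alpha> \<gamma>; k3 = c3 L \<alpha> \<gamma> in
    k3 * (2 * k2 * L / (1 - sqrt \<rho>) + k3 * L / 2 + 1)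
    + 2 * k1^2 * k3 * L^2 / (1 - \<rho>^2)
      * (-1 + 2 * k3 * L + 4 / (1 - \<rho>) + 8 * k2 * L / (1 - sqrt \<rho>)))"
definition "c6 L \<alpha> \<gamma> =
   (let \<rho> = rho L \<alpha> \<gamma>; k1 = c1 L \<alpha> \<gamma>; k2 = c2 L \<alpha> \<gamma>; k3 = c3 L \<alpha> \<gamma>; k4 = c4 L \<alpha> \<gamma> in
    1 / (1 - sqrt \<rho>) *
    (2 * k2 * k4 * L / (1 - sqrt \<rho>) + k3 * k4 * L + k4 + 2 * k2 * k3 * L^2
     + 2 * k1^2 * L^2 / (1 - \<rho>^2)
       * (- k4 + 2 * k3 * k4 * L + 4 * k4 / (1 - \<rho>) + 8 * k2 * k4 * L / (1 - sqrt \<rho>)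
          + 2 * k3 * L * (4 * k2 * L + k4))))"
definition "c7 L \<alpha> \<gamma> =
   (let \<rho> = rho L \<alpha> \<gamma>; k1 = c1 L \<alpha> \<gamma>; k2 = c2 L \<alpha> \<gamma>; k4 = c4 L \<alpha> \<gamma> in
    1 / (1 - \<rho>) *
    (k4 * (2 * k2 * L^2 + k4 * L / 2)
     + 4 * k1^2 * k4 * L^3 * (4 * k2 * L + k4) / (1 - \<rho>^2)))"

end

theory Submission
  imports Defs
begin

text \<open>
  Everything is an energy estimate on the scenario tree.  The cost is quadratic, so for an admissible
  \<open>w\<close> and the optimal \<open>w*\<close> the gap is half the energy of \<open>w - w*\<close>, which by detectability controls
  the norm of \<open>w - w*\<close>.  Testing stationarity with \<open>\<theta>\<^sup>t w\<close>, made feasible by a stabilised correction,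
  shows that a stationary trajectory is bounded in every slowly varying geometric weight by its
  initial state and its data.  A truncated solution, extended by zero, solves the full problem with
  data altered only beyond the truncation time, so its first input deviates from that of the
  full solution by a factor decaying exponentially in \<open>W\<close>.  Telescoping over the times at which one switches
  from the SPC policy to an optimal policy bounds the gap by the sum of these squared deviations;
  for \<open>W\<close> at least the threshold, their dependence on the SPC trajectory itself is absorbed.  The
  rate \<open>\<theta>\<close> and all constants obtained this way are far better than \<open>\<rho>\<close> and \<open>c5\<close>, \<open>c7\<close>, which makes
  the final comparison crude.
\<close>

section \<open>Square roots of positive semidefinite matrices\<close>

text \<open>Nonanticipativity shapes the argument: stationarity holds only after averaging over the
  tree, and only against test trajectories that are functions of the prefix. Energy estimates are
  therefore made path by path, with the terms that cancel only on average carried along to the end,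
  and every correction is generated forward in time by a feedback law; no multipliers or Riccati
  recursions occur. A weight \<open>\<theta> ^ t\<close> creates a drift proportional to
  \<open>1 - \<theta>\<close> in the dynamics, and absorbing it into the energy is what limits
  \<open>1 - \<theta>\<close> to \<open>1 / (40 * L^5 * cc)\<close>, where \<open>cc\<close>
  collects all dependence on \<open>\<gamma>\<close> and \<open>\<alpha>\<close>. Half of the
  resulting decay pays for a factor linear in \<open>W\<close>, which leaves
  \<open>sqrt theta ^ W\<close>. As \<open>sqrt theta\<close> is at most the square of
  \<open>rho\<close>, one of two factors \<open>rho ^ W\<close> is to spare; beyond the threshold it
  is at most \<open>1 / c1\<close>, and \<open>c1\<close> is so large that this surplus covers all
  accumulated constants.\<close>

lemma quadratic_nonneg_imp_linear_zero:
  fixes a c :: real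
  assumes "\<And>t. 0 \<le> t * a + t\<^sup>2 * c"
  shows "a = 0"
proof (rule ccontr)
  assume "a \<noteq> 0"
  \<comment> \<open>The denominator \<open>\<bar>c\<bar> + 1\<close> makes
    \<open>s * c < \<bar>a\<bar>\<close> whatever the sign of \<open>c\<close>; then
    \<open>t = - sgn a * s\<close> refutes the assumption.\<close>
  define s where "s = \<bar>a\<bar> / (\<bar>c\<bar> + 1)"
  have s: "s > 0" using \<open>a \<noteq> 0\<close> by (simp add: s_def)
  have "s * c \<le> s * \<bar>c\<bar>" using s by (simp add: mult_left_mono)
  also have "\<dots> < s * (\<bar>c\<bar> + 1)" using s by simp
  also have "\<dots> = \<bar>a\<bar>" by (simp add: s_def)
  finally have sc: "s * c < \<bar>a\<bar>" .
  have "0 \<le> (- sgn a * s) * a + (- sgn a * s)\<^sup>2 * c" by (rule assms)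
  also have "\<dots> = s * (s * c - \<bar>a\<bar>)"
    using \<open>a \<noteq> 0\<close> by (simp add: sgn_if power2_eq_square algebra_simps)
  also have "\<dots> < 0" using s sc by (simp add: mult_pos_neg)
  finally show False by simp
qed

text \<open>A maximiser of the Rayleigh quotient on the unit sphere of \<open>V\<close> is an
  eigenvector: by invariance of \<open>V\<close> the residual \<open>f v - l *\<^sub>R v\<close> is
  an allowed direction, and moving along it would increase the quotient unless it vanishes.\<close>

lemma symmetric_eigenvector_in_subspace:
  fixes f :: "'a::euclidean_space \<Rightarrow> 'a"
  assumes f: "linear f" and sym: "\<And>x y. f x \<bullet> y = x \<bullet> f y"
    and V: "subspace V" "f ` V \<subseteq> V" "z \<in> V" "z \<noteq> 0"
  obtains v l where "v \<in> V" "norm v = 1" "f v = l *\<^sub>R v"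
proof -
  let ?K = "V \<inter> sphere 0 1"
  have "compact ?K"
    using V by (simp add: closed_Int_compact closed_subspace)
  moreover have "z /\<^sub>R norm z \<in> ?K"
    using V by (simp add: subspace_scale)
  moreover have "continuous_on ?K (\<lambda>x. x \<bullet> f x)"
    using f by (intro continuous_intros linear_continuous_on) (simp add: linear_conv_bounded_linear)
  ultimately obtain v where v: "v \<in> ?K" and mx: "\<And>y. y \<in> ?K \<Longrightarrow> y \<bullet> f y \<le> v \<bullet> f v"
    using continuous_attains_sup[of ?K "\<lambda>x. x \<bullet> f x"] by blast
  define l where "l = v \<bullet> f v"
  \<comment> \<open>Homogeneity carries maximality from the sphere to all of \<open>V\<close>, so
    that \<open>v + t *\<^sub>R w\<close> can be tested without normalising it.\<close>
  have bound: "y \<bullet> f y \<le> l * (y \<bullet> y)" if "y \<in> V" for y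
  proof (cases "y = 0")
    case False
    have "y /\<^sub>R norm y \<in> ?K" using False that V by (simp add: subspace_scale)
    from mx[OF this] have "(y \<bullet> f y) / (norm y)\<^sup>2 \<le> l"
      using f by (simp add: l_def linear_cmul power2_eq_square field_simps)
    then show ?thesis using False by (simp add: field_simps power2_norm_eq_inner)
  qed (use f in \<open>simp add: linear_0\<close>)
  define w where "w = f v - l *\<^sub>R v"
  have wV: "w \<in> V" using v V by (auto simp: w_def subspace_diff subspace_scale)
  have vv: "v \<bullet> v = 1" using v by (simp add: dot_square_norm)
  have "0 \<le> t * (- 2 * (w \<bullet> w)) + t\<^sup>2 * (l * (w \<bullet> w) - w \<bullet> f w)" for t
  proof -
    have "(v + t *\<^sub>R w) \<bullet> f (v + t *\<^sub>R w) \<le> l * ((v + t *\<^sub>R w) \<bullet> (v + t *\<^sub>R w))"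
      using v wV V by (intro bound) (auto simp: subspace_add subspace_scale)
    moreover have "(v + t *\<^sub>R w) \<bullet> f (v + t *\<^sub>R w) = l + 2 * t * (w \<bullet> f v) + t\<^sup>2 * (w \<bullet> f w)"
      using f sym[of v w]
      by (simp add: linear_add linear_cmul inner_add_left inner_add_right l_def power2_eq_square
          inner_commute[of "f v" w] algebra_simps)
    moreover have "(v + t *\<^sub>R w) \<bullet> (v + t *\<^sub>R w) = 1 + 2 * t * (w \<bullet> v) + t\<^sup>2 * (w \<bullet> w)"
      by (simp add: inner_add_left inner_add_right power2_eq_square inner_commute[of v w]
          vv algebra_simps)
    moreover have "w \<bullet> f v = w \<bullet> w + l * (w \<bullet> v)"
      by (simp add: w_def inner_diff_left inner_diff_right algebra_simps)
    ultimately have "l + 2 * t * (w \<bullet> f v) + t\<^sup>2 * (w \<bullet> f w)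
        \<le> l * (1 + 2 * t * (w \<bullet> v) + t\<^sup>2 * (w \<bullet> w))" "w \<bullet> f v = w \<bullet> w + l * (w \<bullet> v)"
      by (simp_all only:)
    then show ?thesis by (simp add: algebra_simps)
  qed
  then have "- 2 * (w \<bullet> w) = 0" by (rule quadratic_nonneg_imp_linear_zero)
  then have "f v = l *\<^sub>R v" by (simp add: w_def)
  then show ?thesis using that v by auto
qed

text \<open>Take an orthonormal set of eigenvectors of largest cardinality. By symmetry its
  orthogonal complement is invariant, so a vector that is not reproduced leaves a nonzero residual
  there, which yields a further eigenvector.\<close>

lemma symmetric_eigenbasis:
  fixes f :: "'a::euclidean_space \<Rightarrow> 'a"
  assumes f: "linear f" and sym: "\<And>x y. f x \<bullet> y = x \<bullet> f y"
  obtains B l where "finite B" "\<And>b. b \<in> B \<Longrightarrow> f b = l b *\<^sub>R b"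
    "\<And>a b. a \<in> B \<Longrightarrow> b \<in> B \<Longrightarrow> a \<bullet> b = (if a = b then 1 else 0)"
    "\<And>x. (\<Sum>b\<in>B. (x \<bullet> b) *\<^sub>R b) = x"
proof -
  define E where "E B \<longleftrightarrow> finite B \<and> (\<forall>a\<in>B. \<forall>b\<in>B. a \<bullet> b = (if a = b then 1 else 0)) \<and>
    (\<forall>b\<in>B. \<exists>l. f b = l *\<^sub>R b)" for B :: "'a set"
  have cardE: "card B \<le> DIM('a)" if "E B" for B
  proof -
    have "pairwise orthogonal B" "0 \<notin> B"
      using that by (force simp: E_def pairwise_def orthogonal_def)+
    then show ?thesis by (metis pairwise_orthogonal_independent independent_bound)
  qed
  have "E {}" by (simp add: E_def)
  then obtain B where B: "E B" and mx: "\<And>B'. E B' \<Longrightarrow> card B' \<le> card B"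
    using cardE ex_has_greatest_nat[of E "{}" card "Suc (DIM('a))"] by (auto simp: less_Suc_eq_le)
  have fin: "finite B" and on: "\<And>a b. a \<in> B \<Longrightarrow> b \<in> B \<Longrightarrow> a \<bullet> b = (if a = b then 1 else 0)"
    and ev: "\<And>b. b \<in> B \<Longrightarrow> \<exists>l. f b = l *\<^sub>R b"
    using B by (auto simp: E_def)
  have expand: "(\<Sum>b\<in>B. (x \<bullet> b) *\<^sub>R b) = x" for x
  proof (rule ccontr)
    assume neq: "(\<Sum>b\<in>B. (x \<bullet> b) *\<^sub>R b) \<noteq> x"
    define z where "z = x - (\<Sum>b\<in>B. (x \<bullet> b) *\<^sub>R b)"
    define V where "V = {y. \<forall>b\<in>B. y \<bullet> b = 0}"
    have "subspace V" by (auto simp: V_def subspace_def inner_add_left)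
    moreover have "f ` V \<subseteq> V"
    proof -
      have "f y \<bullet> b = 0" if "y \<in> V" "b \<in> B" for y b
        using ev[OF that(2)] that by (auto simp: sym V_def)
      then show ?thesis by (auto simp: V_def)
    qed
    moreover have "z \<in> V"
    proof -
      have "z \<bullet> c = 0" if "c \<in> B" for c
      proof -
        have "(\<Sum>b\<in>B. (x \<bullet> b) *\<^sub>R b) \<bullet> c = (\<Sum>b\<in>B. if b = c then x \<bullet> c else 0)"
          unfolding inner_sum_left using that on by (intro sum.cong) auto
        then show ?thesis using that fin by (simp add: z_def inner_diff_left)
      qed
      then show ?thesis by (simp add: V_def)
    qed
    moreover have "z \<noteq> 0" using neq by (simp add: z_def)
    ultimately obtain v l where v: "v \<in> V" "norm v = 1" "f v = l *\<^sub>R v"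
      using symmetric_eigenvector_in_subspace[OF f sym] by metis
    have vv: "v \<bullet> v = 1" using v by (simp add: dot_square_norm)
    have "v \<notin> B" using v vv by (auto simp: V_def)
    moreover have "E (insert v B)"
      using v vv B \<open>v \<notin> B\<close> by (auto simp: E_def V_def inner_commute)
    ultimately show False using mx[of "insert v B"] fin by simp
  qed
  obtain l where "\<And>b. b \<in> B \<Longrightarrow> f b = l b *\<^sub>R b" using ev by metis
  with fin on expand that show ?thesis by blast
qed

lemma symmetric_matrix_inner:
  fixes M :: "real^'n::finite^'n"
  assumes "transpose M = M"
  shows "(M *v x) \<bullet> y = x \<bullet> (M *v y)"
  using assms by (metis dot_lmul_matrix transpose_matrix_vector)

lemma psd_square_root_exists:
  fixes M :: "real^'n::finite^'n"
  assumes "psd M"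
  obtains S where "psd S" "S ** S = M"
proof -
  have M: "\<And>x y. (M *v x) \<bullet> y = x \<bullet> (M *v y)" "\<And>x. 0 \<le> x \<bullet> (M *v x)"
    using assms symmetric_matrix_inner by (auto simp: psd_def)
  obtain B l where fin: "finite B" and ev: "\<And>b. b \<in> B \<Longrightarrow> M *v b = l b *\<^sub>R b"
    and on: "\<And>a b. a \<in> B \<Longrightarrow> b \<in> B \<Longrightarrow> a \<bullet> b = (if a = b then 1 else 0)"
    and ex: "\<And>x. (\<Sum>b\<in>B. (x \<bullet> b) *\<^sub>R b) = x"
    by (rule symmetric_eigenbasis[OF matrix_vector_mul_linear M(1)]) (rule that)
  have l: "0 \<le> l b" if "b \<in> B" for b
    using M(2)[of b] ev[OF that] on[OF that that] by simp
  define g where "g x = (\<Sum>b\<in>B. (sqrt (l b) * (x \<bullet> b)) *\<^sub>R b)" for x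
  have "linear g"
    by (rule linearI) (simp_all add: g_def inner_add_left sum.distrib algebra_simps scaleR_sum_right)
  then have g: "matrix g *v x = g x" for x by (simp add: matrix_works)
  have gb: "g b = sqrt (l b) *\<^sub>R b" if "b \<in> B" for b
  proof -
    have "g b = (\<Sum>c\<in>B. if c = b then sqrt (l b) *\<^sub>R b else 0)"
      unfolding g_def using that on by (intro sum.cong) auto
    then show ?thesis using that fin by simp
  qed
  have gx: "g x \<bullet> y = (\<Sum>b\<in>B. sqrt (l b) * (x \<bullet> b) * (y \<bullet> b))" for x y
    unfolding g_def inner_sum_left inner_scaleR_left by (simp add: inner_commute[of _ y])
  show ?thesis
  proof
    have "transpose (matrix g) = matrix g"
    proof -
      have "transpose (matrix g) *v x = matrix g *v x" for x
      proof (rule vector_eq_ldot[THEN iffD1, rule_format])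
        fix y
        have "y \<bullet> (transpose (matrix g) *v x) = g y \<bullet> x"
          by (metis g dot_lmul_matrix inner_commute transpose_matrix_vector)
        also have "\<dots> = g x \<bullet> y" unfolding gx by (simp add: ac_simps)
        finally show "y \<bullet> (transpose (matrix g) *v x) = y \<bullet> (matrix g *v x)"
          by (simp add: g inner_commute)
      qed
      then show ?thesis by (simp add: matrix_eq)
    qed
    moreover have "0 \<le> x \<bullet> (matrix g *v x)" for x
      unfolding g inner_commute[of x] gx by (intro sum_nonneg) (simp add: l mult.assoc)
    ultimately show "psd (matrix g)" by (simp add: psd_def)
    have "g (g x) = M *v x" for x
    proof -
      have "g (g x) = (\<Sum>b\<in>B. (sqrt (l b) * (x \<bullet> b)) *\<^sub>R g b)"
        unfolding g_def[of x] using \<open>linear g\<close> by (simp add: linear_sum linear_cmul)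
      also have "\<dots> = (\<Sum>b\<in>B. (x \<bullet> b) *\<^sub>R (M *v b))"
        by (intro sum.cong) (auto simp: gb ev l)
      also have "\<dots> = M *v (\<Sum>b\<in>B. (x \<bullet> b) *\<^sub>R b)"
        by (simp add: matrix_vector_mult_scaleR linear_sum[OF matrix_vector_mul_linear])
      finally show ?thesis by (simp only: ex)
    qed
    then show "matrix g ** matrix g = M"
      by (simp add: matrix_eq matrix_vector_mul_assoc[symmetric] g)
  qed
qed

text \<open>Diagonalise the difference \<open>D\<close>. On an eigenvector \<open>b\<close>, equal
  squares give \<open>S1 *v b\<close> and \<open>S2 *v b\<close> the same norm, so
  \<open>l b\<close> times the sum of two nonnegative quadratic forms is zero. If \<open>l b\<close>
  were nonzero, both forms would vanish at \<open>b\<close>, yet they differ by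
  \<open>l b\<close>.\<close>

lemma psd_square_root_unique:
  fixes S1 S2 :: "real^'n::finite^'n"
  assumes "psd S1" "psd S2" "S1 ** S1 = S2 ** S2"
  shows "S1 = S2"
proof -
  have s1: "\<And>x y. (S1 *v x) \<bullet> y = x \<bullet> (S1 *v y)" "\<And>x. 0 \<le> x \<bullet> (S1 *v x)"
    and s2: "\<And>x y. (S2 *v x) \<bullet> y = x \<bullet> (S2 *v y)" "\<And>x. 0 \<le> x \<bullet> (S2 *v x)"
    using assms symmetric_matrix_inner by (auto simp: psd_def)
  define D where "D = S1 - S2"
  have D: "(D *v x) \<bullet> y = x \<bullet> (D *v y)" for x y
    by (simp add: D_def matrix_vector_mult_diff_rdistrib inner_diff_left inner_diff_right s1 s2)
  obtain B l where fin: "finite B" and ev: "\<And>b. b \<in> B \<Longrightarrow> D *v b = l b *\<^sub>R b"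
    and on: "\<And>a b. a \<in> B \<Longrightarrow> b \<in> B \<Longrightarrow> a \<bullet> b = (if a = b then 1 else 0)"
    and ex: "\<And>x. (\<Sum>b\<in>B. (x \<bullet> b) *\<^sub>R b) = x"
    by (rule symmetric_eigenbasis[OF matrix_vector_mul_linear D]) (rule that)
  have l0: "l b = 0" if "b \<in> B" for b
  proof (rule ccontr)
    assume l: "l b \<noteq> 0"
    have bb: "b \<bullet> b = 1" using on[OF that that] by simp
    have Db: "S1 *v b - S2 *v b = l b *\<^sub>R b"
      using ev[OF that] by (simp add: D_def matrix_vector_mult_diff_rdistrib)
    have "S1 *v (S1 *v b) = S2 *v (S2 *v b)"
      using assms(3) by (simp add: matrix_vector_mul_assoc)
    then have "(S1 *v b) \<bullet> (S1 *v b) = (S2 *v b) \<bullet> (S2 *v b)"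
      by (simp add: s1 s2)
    then have "(S1 *v b - S2 *v b) \<bullet> (S1 *v b + S2 *v b) = 0"
      by (simp add: inner_add_right inner_diff_left inner_commute algebra_simps)
    then have "l b * (b \<bullet> (S1 *v b) + b \<bullet> (S2 *v b)) = 0"
      by (simp add: Db inner_add_right distrib_left del: mult_eq_0_iff)
    then have "b \<bullet> (S1 *v b) + b \<bullet> (S2 *v b) = 0"
      using l by (metis mult_eq_0_iff)
    then have z: "b \<bullet> (S1 *v b) = 0" "b \<bullet> (S2 *v b) = 0"
      using s1(2)[of b] s2(2)[of b] by linarith+
    have "b \<bullet> (S1 *v b - S2 *v b) = 0" using z by (simp add: inner_diff_right)
    then show False using l bb by (simp add: Db)
  qed
  have "D *v x = 0" for x
  proof -
    have "D *v (\<Sum>b\<in>B. (x \<bullet> b) *\<^sub>R b) = (\<Sum>b\<in>B. (x \<bullet> b) *\<^sub>R (D *v b))"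
      by (simp add: matrix_vector_mult_scaleR linear_sum[OF matrix_vector_mul_linear])
    also have "\<dots> = 0" by (simp add: ev l0)
    finally show ?thesis by (simp only: ex)
  qed
  then have "D = 0" by (simp add: matrix_eq)
  then show ?thesis by (simp add: D_def)
qed

text \<open>Existence and uniqueness give the description in \<open>msqrt\<close> its meaning. The
  identity turns the output \<open>msqrt Q *v x\<close> of the detectability assumption into the
  state part of the cost.\<close>

lemma norm_msqrt_sq:
  fixes M :: "real^'n::finite^'n"
  assumes "psd M"
  shows "(norm (msqrt M *v x))\<^sup>2 = x \<bullet> (M *v x)"
proof -
  obtain S where S: "psd S" "S ** S = M" using psd_square_root_exists[OF assms] .
  have "msqrt M = S"
    unfolding msqrt_def by (rule the_equality) (use S psd_square_root_unique in auto)
  then show ?thesis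
    using S symmetric_matrix_inner[of S x "S *v x"]
    by (simp add: psd_def power2_norm_eq_inner matrix_vector_mul_assoc)
qed

section \<open>Weighted convolution estimates\<close>

lemma matrix_vector_norm_le:
  fixes M :: "real^'n::finite^'m::finite"
  assumes "mnorm M \<le> c"
  shows "norm (M *v x) \<le> c * norm x"
proof -
  have "norm (M *v x) \<le> mnorm M * norm x"
    unfolding mnorm_def by (rule onorm) simp
  also have "\<dots> \<le> c * norm x" using assms by (simp add: mult_right_mono)
  finally show ?thesis .
qed

lemma sum_power_diff_le:
  fixes \<alpha> :: real
  assumes "0 \<le> \<alpha>" "\<alpha> < 1"
  shows "(\<Sum>k\<in>{m..n}. \<alpha> ^ (k - m)) \<le> 1 / (1 - \<alpha>)"
    and "(\<Sum>k\<in>{m..n}. \<alpha> ^ (n - k)) \<le> 1 / (1 - \<alpha>)"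
proof -
  have fin: "(\<Sum>i\<in>A. \<alpha> ^ i) \<le> 1 / (1 - \<alpha>)" if "finite A" for A
    using sum_le_suminf[OF summable_geometric[of \<alpha>] that] suminf_geometric[of \<alpha>] assms by simp
  have "(\<Sum>k\<in>{m..n}. \<alpha> ^ (k - m)) = (\<Sum>i\<in>(\<lambda>k. k - m) ` {m..n}. \<alpha> ^ i)"
    by (subst sum.reindex) (auto simp: inj_on_def)
  then show "(\<Sum>k\<in>{m..n}. \<alpha> ^ (k - m)) \<le> 1 / (1 - \<alpha>)" by (simp add: fin)
  have "(\<Sum>k\<in>{m..n}. \<alpha> ^ (n - k)) = (\<Sum>i\<in>(\<lambda>k. n - k) ` {m..n}. \<alpha> ^ i)"
    by (subst sum.reindex) (auto simp: inj_on_def)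
  then show "(\<Sum>k\<in>{m..n}. \<alpha> ^ (n - k)) \<le> 1 / (1 - \<alpha>)" by (simp add: fin)
qed

text \<open>A weighted Young inequality. Cauchy-Schwarz splits \<open>\<alpha> ^ (t - k)\<close>
  into two square roots and costs \<open>1 / (1 - \<alpha>)\<close>; after exchanging the sums,
  \<open>\<omega> ^ t = \<omega> ^ k * \<omega> ^ (t - k)\<close> leaves a geometric series of ratio
  \<open>\<alpha> * \<omega>\<close>. Weights above 1 are included because corrections will be
  measured with \<open>1 / \<theta>\<close>.\<close>

lemma weighted_convolution_bound:
  fixes \<alpha> \<omega> :: real and g :: "nat \<Rightarrow> real"
  assumes \<alpha>: "0 < \<alpha>" "\<alpha> < 1" and \<omega>: "0 < \<omega>" "\<alpha> * \<omega> < 1"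
  shows "(\<Sum>t\<in>{\<tau>..N}. \<omega> ^ t * (\<Sum>k\<in>{\<tau>..t}. \<alpha> ^ (t - k) * g k)\<^sup>2)
    \<le> (1 / ((1 - \<alpha>) * (1 - \<alpha> * \<omega>))) * (\<Sum>k\<in>{\<tau>..N}. \<omega> ^ k * (g k)\<^sup>2)"
proof -
  have cs: "(\<Sum>k\<in>{\<tau>..t}. \<alpha> ^ (t - k) * g k)\<^sup>2 \<le> (1 / (1 - \<alpha>)) * (\<Sum>k\<in>{\<tau>..t}. \<alpha> ^ (t - k) * (g k)\<^sup>2)" for t
  proof -
    have "(\<Sum>k\<in>{\<tau>..t}. \<alpha> ^ (t - k) * g k)\<^sup>2
        = (\<Sum>k\<in>{\<tau>..t}. sqrt (\<alpha> ^ (t - k)) * (sqrt (\<alpha> ^ (t - k)) * g k))\<^sup>2"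
      using \<alpha> by (simp add: mult.assoc[symmetric])
    also have "\<dots> \<le> (\<Sum>k\<in>{\<tau>..t}. (sqrt (\<alpha> ^ (t - k)))\<^sup>2) * (\<Sum>k\<in>{\<tau>..t}. (sqrt (\<alpha> ^ (t - k)) * g k)\<^sup>2)"
      by (rule Cauchy_Schwarz_ineq_sum)
    also have "\<dots> = (\<Sum>k\<in>{\<tau>..t}. \<alpha> ^ (t - k)) * (\<Sum>k\<in>{\<tau>..t}. \<alpha> ^ (t - k) * (g k)\<^sup>2)"
      using \<alpha> by (simp add: power_mult_distrib)
    also have "\<dots> \<le> (1 / (1 - \<alpha>)) * (\<Sum>k\<in>{\<tau>..t}. \<alpha> ^ (t - k) * (g k)\<^sup>2)"
      using \<alpha> by (intro mult_right_mono sum_power_diff_le sum_nonneg) auto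
    finally show ?thesis .
  qed
  have "(\<Sum>t\<in>{\<tau>..N}. \<omega> ^ t * (\<Sum>k\<in>{\<tau>..t}. \<alpha> ^ (t - k) * g k)\<^sup>2)
      \<le> (\<Sum>t\<in>{\<tau>..N}. \<omega> ^ t * ((1 / (1 - \<alpha>)) * (\<Sum>k\<in>{\<tau>..t}. \<alpha> ^ (t - k) * (g k)\<^sup>2)))"
    using \<omega> cs by (intro sum_mono mult_left_mono) auto
  also have "\<dots> = (1 / (1 - \<alpha>)) * (\<Sum>t\<in>{\<tau>..N}. \<Sum>k\<in>{\<tau>..N}. if k \<le> t then \<omega> ^ t * (\<alpha> ^ (t - k) * (g k)\<^sup>2) else 0)"
  proof -
    have "\<omega> ^ t * ((1 / (1 - \<alpha>)) * (\<Sum>k\<in>{\<tau>..t}. \<alpha> ^ (t - k) * (g k)\<^sup>2))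
      = (1 / (1 - \<alpha>)) * (\<Sum>k\<in>{\<tau>..N}. if k \<le> t then \<omega> ^ t * (\<alpha> ^ (t - k) * (g k)\<^sup>2) else 0)"
      if "t \<in> {\<tau>..N}" for t
    proof -
      have "{k \<in> {\<tau>..N}. k \<le> t} = {\<tau>..t}" using that by auto
      then show ?thesis by (simp add: sum.If_cases Int_def sum_distrib_left algebra_simps)
    qed
    then show ?thesis by (simp add: sum_distrib_left)
  qed
  also have "\<dots> = (1 / (1 - \<alpha>)) * (\<Sum>k\<in>{\<tau>..N}. \<Sum>t\<in>{\<tau>..N}. if k \<le> t then \<omega> ^ t * (\<alpha> ^ (t - k) * (g k)\<^sup>2) else 0)"
    by (subst sum.swap) simp
  also have "\<dots> \<le> (1 / (1 - \<alpha>)) * (\<Sum>k\<in>{\<tau>..N}. (\<omega> ^ k * (g k)\<^sup>2) * (1 / (1 - \<alpha> * \<omega>)))"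
  proof (intro mult_left_mono sum_mono)
    fix k assume k: "k \<in> {\<tau>..N}"
    have "{t \<in> {\<tau>..N}. k \<le> t} = {k..N}" using k by auto
    then have "(\<Sum>t\<in>{\<tau>..N}. if k \<le> t then \<omega> ^ t * (\<alpha> ^ (t - k) * (g k)\<^sup>2) else 0)
      = (\<Sum>t\<in>{k..N}. \<omega> ^ t * (\<alpha> ^ (t - k) * (g k)\<^sup>2))"
      by (simp add: sum.If_cases Int_def)
    also have "\<dots> = (\<Sum>t\<in>{k..N}. (\<omega> ^ k * (g k)\<^sup>2) * (\<alpha> * \<omega>) ^ (t - k))"
    proof (rule sum.cong)
      fix t assume "t \<in> {k..N}"
      then have "\<omega> ^ t = \<omega> ^ k * \<omega> ^ (t - k)" by (simp flip: power_add)
      then show "\<omega> ^ t * (\<alpha> ^ (t - k) * (g k)\<^sup>2) = (\<omega> ^ k * (g k)\<^sup>2) * (\<alpha> * \<omega>) ^ (t - k)"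
        by (simp add: power_mult_distrib)
    qed simp
    also have "\<dots> = (\<omega> ^ k * (g k)\<^sup>2) * (\<Sum>t\<in>{k..N}. (\<alpha> * \<omega>) ^ (t - k))"
      by (simp add: sum_distrib_left)
    also have "\<dots> \<le> (\<omega> ^ k * (g k)\<^sup>2) * (1 / (1 - \<alpha> * \<omega>))"
      using \<alpha> \<omega> by (intro mult_left_mono sum_power_diff_le) auto
    finally show "(\<Sum>t\<in>{\<tau>..N}. if k \<le> t then \<omega> ^ t * (\<alpha> ^ (t - k) * (g k)\<^sup>2) else 0)
      \<le> (\<omega> ^ k * (g k)\<^sup>2) * (1 / (1 - \<alpha> * \<omega>))" .
  qed (use \<alpha> in auto)
  also have "\<dots> = (1 / ((1 - \<alpha>) * (1 - \<alpha> * \<omega>))) * (\<Sum>k\<in>{\<tau>..N}. \<omega> ^ k * (g k)\<^sup>2)"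
    by (simp add: sum_divide_distrib[symmetric] field_simps)
  finally show ?thesis .
qed

text \<open>Variation of constants, with the initial state counted as the forcing at time
  \<open>\<tau>\<close>.\<close>

lemma linear_recursion_bound:
  fixes \<Phi> :: "nat \<Rightarrow> real^'n::finite^'n" and x h :: "nat \<Rightarrow> real^'n"
  assumes stab: "\<And>k j. \<tau> \<le> k \<Longrightarrow> k < j \<Longrightarrow> j \<le> N \<Longrightarrow> mnorm (lprod \<Phi> k (j - k)) \<le> L * \<alpha> ^ (j - k)"
    and "1 \<le> L"
    and init: "x \<tau> = h \<tau>"
    and step: "\<And>t. \<tau> \<le> t \<Longrightarrow> t < N \<Longrightarrow> x (Suc t) = \<Phi> (Suc t) *v x t + h (Suc t)"
    and t: "\<tau> \<le> t" "t \<le> N"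
  shows "norm (x t) \<le> L * (\<Sum>k\<in>{\<tau>..t}. \<alpha> ^ (t - k) * norm (h k))"
proof -
  have "x t = (\<Sum>k\<in>{\<tau>..t}. lprod \<Phi> k (t - k) *v h k)"
    using t
  proof (induction t rule: dec_induct)
    case base
    then show ?case by (simp add: init)
  next
    case (step t)
    have "(\<Sum>k\<in>{\<tau>..Suc t}. lprod \<Phi> k (Suc t - k) *v h k)
        = (\<Sum>k\<in>{\<tau>..t}. lprod \<Phi> k (Suc t - k) *v h k) + h (Suc t)"
      using step.hyps by (simp add: sum.atLeastAtMost_shift_bounds)
    also have "(\<Sum>k\<in>{\<tau>..t}. lprod \<Phi> k (Suc t - k) *v h k)
        = (\<Sum>k\<in>{\<tau>..t}. \<Phi> (Suc t) *v (lprod \<Phi> k (t - k) *v h k))"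
      by (intro sum.cong) (auto simp: Suc_diff_le matrix_vector_mul_assoc)
    also have "\<dots> = \<Phi> (Suc t) *v x t"
      using step by (simp add: linear_sum[OF matrix_vector_mul_linear])
    finally show ?case using step.prems step.hyps assms(4)[of t] by simp
  qed
  then have "norm (x t) \<le> (\<Sum>k\<in>{\<tau>..t}. norm (lprod \<Phi> k (t - k) *v h k))"
    by (simp add: norm_sum)
  also have "\<dots> \<le> (\<Sum>k\<in>{\<tau>..t}. (L * \<alpha> ^ (t - k)) * norm (h k))"
  proof (rule sum_mono)
    fix k assume k: "k \<in> {\<tau>..t}"
    show "norm (lprod \<Phi> k (t - k) *v h k) \<le> (L * \<alpha> ^ (t - k)) * norm (h k)"
    \<comment> \<open>The stability bound concerns \<open>k < j\<close> only; the empty product at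
      \<open>k = t\<close> is the identity, which is covered by \<open>1 \<le> L\<close>.\<close>
    proof (cases "k = t")
      case True
      then show ?thesis using \<open>1 \<le> L\<close> mult_right_mono[of 1 L "norm (h t)"] by simp
    next
      case False
      then show ?thesis using k t by (intro matrix_vector_norm_le stab) auto
    qed
  qed
  finally show ?thesis by (simp add: sum_distrib_left mult.assoc)
qed

lemma linear_recursion_weighted_bound:
  fixes \<Phi> :: "nat \<Rightarrow> real^'n::finite^'n" and x h :: "nat \<Rightarrow> real^'n"
  assumes stab: "\<And>k j. \<tau> \<le> k \<Longrightarrow> k < j \<Longrightarrow> j \<le> N \<Longrightarrow> mnorm (lprod \<Phi> k (j - k)) \<le> L * \<alpha> ^ (j - k)"
    and L: "1 \<le> L" and \<alpha>: "0 < \<alpha>" "\<alpha> < 1" and \<omega>: "0 < \<omega>" "\<alpha> * \<omega> < 1"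
    and init: "x \<tau> = h \<tau>"
    and step: "\<And>t. \<tau> \<le> t \<Longrightarrow> t < N \<Longrightarrow> x (Suc t) = \<Phi> (Suc t) *v x t + h (Suc t)"
  shows "(\<Sum>t\<in>{\<tau>..N}. \<omega> ^ t * (norm (x t))\<^sup>2)
    \<le> (L\<^sup>2 / ((1 - \<alpha>) * (1 - \<alpha> * \<omega>))) * (\<Sum>t\<in>{\<tau>..N}. \<omega> ^ t * (norm (h t))\<^sup>2)"
proof -
  have "(\<Sum>t\<in>{\<tau>..N}. \<omega> ^ t * (norm (x t))\<^sup>2)
    \<le> (\<Sum>t\<in>{\<tau>..N}. \<omega> ^ t * (L * (\<Sum>k\<in>{\<tau>..t}. \<alpha> ^ (t - k) * norm (h k)))\<^sup>2)"
    using \<omega> by (intro sum_mono mult_left_mono power_mono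
        linear_recursion_bound[OF stab L init step]) auto
  also have "\<dots> = L\<^sup>2 * (\<Sum>t\<in>{\<tau>..N}. \<omega> ^ t * (\<Sum>k\<in>{\<tau>..t}. \<alpha> ^ (t - k) * norm (h k))\<^sup>2)"
    by (simp add: power_mult_distrib sum_distrib_left[of "L\<^sup>2"] mult.left_commute)
  also have "\<dots> \<le> L\<^sup>2 * ((1 / ((1 - \<alpha>) * (1 - \<alpha> * \<omega>))) * (\<Sum>k\<in>{\<tau>..N}. \<omega> ^ k * (norm (h k))\<^sup>2))"
    by (intro mult_left_mono weighted_convolution_bound \<alpha> \<omega>) auto
  finally show ?thesis by simp
qed

section \<open>Quadratic energy on the scenario tree\<close>

abbreviation at_prefix :: "(nat \<Rightarrow> 'xi list \<Rightarrow> 'v) \<Rightarrow> nat \<Rightarrow> 'xi list \<Rightarrow> 'v" where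
  "at_prefix w t \<zeta> \<equiv> w t (take (Suc t) \<zeta>)"

definition step :: "('xi,'nx::finite,'nu::finite) lqdata \<Rightarrow> 'xi \<Rightarrow> (real^'nx) \<times> (real^'nu) \<Rightarrow> real^'nx" where
  "step S \<xi> w = Am S \<xi> *v fst w + Bm S \<xi> *v snd w"

definition hess :: "('xi,'nx::finite,'nu::finite) lqdata \<Rightarrow> 'xi \<Rightarrow> (real^'nx) \<times> (real^'nu)
    \<Rightarrow> (real^'nx) \<times> (real^'nu) \<Rightarrow> real" where
  "hess S \<xi> v w = fst v \<bullet> (Qm S \<xi> *v fst w) + snd v \<bullet> (Rm S \<xi> *v snd w)"

lemma step_linear:
  "step S \<xi> (v + w) = step S \<xi> v + step S \<xi> w"
  "step S \<xi> (v - w) = step S \<xi> v - step S \<xi> w"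
  "step S \<xi> (k *\<^sub>R w) = k *\<^sub>R step S \<xi> w"
  "step S \<xi> 0 = 0"
  by (simp_all add: step_def matrix_vector_right_distrib matrix_vector_mult_diff_distrib
      matrix_vector_mult_scaleR scaleR_add_right algebra_simps)

lemma dyn_eq_step: "dyn S w \<xi> = step S \<xi> w + dv S \<xi>"
  by (simp add: dyn_def step_def)

lemma hess_linear:
  "hess S \<xi> (u + v) w = hess S \<xi> u w + hess S \<xi> v w"
  "hess S \<xi> (u - v) w = hess S \<xi> u w - hess S \<xi> v w"
  "hess S \<xi> (k *\<^sub>R v) w = k * hess S \<xi> v w"
  "hess S \<xi> w (u + v) = hess S \<xi> w u + hess S \<xi> w v"
  "hess S \<xi> w (u - v) = hess S \<xi> w u - hess S \<xi> w v"
  "hess S \<xi> w (k *\<^sub>R v) = k * hess S \<xi> w v"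
  "hess S \<xi> 0 w = 0" "hess S \<xi> w 0 = 0"
  by (simp_all add: hess_def matrix_vector_right_distrib matrix_vector_mult_diff_distrib
      matrix_vector_mult_scaleR inner_add_left inner_add_right inner_diff_left inner_diff_right
      algebra_simps)

lemma stage_eq_hess: "stage S w \<xi> = hess S \<xi> w w / 2 - (qv S \<xi>, rv S \<xi>) \<bullet> w"
  by (cases w) (simp add: stage_def hess_def algebra_simps)

lemma young_product:
  fixes a b k :: real
  assumes "0 < k"
  shows "a * b \<le> a\<^sup>2 / (4 * k) + k * b\<^sup>2"
proof -
  have "0 \<le> (a - 2 * k * b)\<^sup>2" by simp
  then have "4 * k * (a * b) \<le> a\<^sup>2 + 4 * k * (k * b\<^sup>2)"
    by (simp add: power2_eq_square algebra_simps)
  then show ?thesis using assms by (simp add: field_simps)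
qed

lemma norm_diff_sq_le: "(norm (a - b))\<^sup>2 \<le> 2 * (norm a)\<^sup>2 + 2 * (norm b)\<^sup>2"
  for a b :: "'v::real_inner"
proof -
  have "0 \<le> (norm (a + b))\<^sup>2" by simp
  then show ?thesis by (simp add: power2_norm_eq_inner inner_simps inner_commute)
qed

lemma norm_pair_sq: "(norm w)\<^sup>2 = (norm (fst w))\<^sup>2 + (norm (snd w))\<^sup>2"
  for w :: "'a::real_normed_vector \<times> 'b::real_normed_vector"
  by (cases w) (simp add: norm_Pair)

text \<open>\<^term>\<open>rollout S U g \<tau> t b\<close> is the state at time \<open>t\<close> on the prefix \<open>b\<close> of the system
  started at time \<open>\<tau>\<close> in \<open>g \<tau>\<close>, driven by \<open>g\<close> and controlled by the feedback law \<open>U\<close>.\<close>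

fun rollout :: "('xi,'nx::finite,'nu::finite) lqdata \<Rightarrow> (nat \<Rightarrow> 'xi list \<Rightarrow> real^'nx \<Rightarrow> real^'nu)
    \<Rightarrow> (nat \<Rightarrow> 'xi list \<Rightarrow> real^'nx) \<Rightarrow> nat \<Rightarrow> nat \<Rightarrow> 'xi list \<Rightarrow> real^'nx" where
  "rollout S U g \<tau> 0 b = at_prefix g 0 b"
| "rollout S U g \<tau> (Suc t) b =
     (if \<tau> \<le> t then step S (b ! Suc t) (rollout S U g \<tau> t b, U t (take (Suc t) b) (rollout S U g \<tau> t b)) else 0)
      + at_prefix g (Suc t) b"

text \<open>Nonanticipativity of the feedback system: it allows the state computed on a whole path
  to be read as a function of the prefix.\<close>

lemma rollout_take: "t < m \<Longrightarrow> rollout S U g \<tau> t (take m b) = rollout S U g \<tau> t b"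
  by (induction t) (simp_all add: min_def)

lemma rollout_exists:
  fixes S :: "('xi,'nx::finite,'nu::finite) lqdata"
  obtains v :: "nat \<Rightarrow> 'xi list \<Rightarrow> (real^'nx) \<times> (real^'nu)"
  where "\<And>\<zeta>. fst (at_prefix v \<tau> \<zeta>) = at_prefix g \<tau> \<zeta>"
    "\<And>\<zeta> t. snd (at_prefix v t \<zeta>) = U t (take (Suc t) \<zeta>) (fst (at_prefix v t \<zeta>))"
    "\<And>\<zeta> t. \<tau> \<le> t \<Longrightarrow>
       fst (at_prefix v (Suc t) \<zeta>) = step S (\<zeta> ! Suc t) (at_prefix v t \<zeta>) + at_prefix g (Suc t) \<zeta>"
proof -
  define v where "v t b = (rollout S U g \<tau> t b, U t (take (Suc t) b) (rollout S U g \<tau> t b))" for t b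
  have 1: "fst (at_prefix v \<tau> \<zeta>) = at_prefix g \<tau> \<zeta>" for \<zeta>
    by (cases \<tau>) (simp_all add: v_def rollout_take)
  have 2: "snd (at_prefix v t \<zeta>) = U t (take (Suc t) \<zeta>) (fst (at_prefix v t \<zeta>))" for \<zeta> t
    by (simp add: v_def)
  have 3: "fst (at_prefix v (Suc t) \<zeta>) = step S (\<zeta> ! Suc t) (at_prefix v t \<zeta>) + at_prefix g (Suc t) \<zeta>"
    if "\<tau> \<le> t" for \<zeta> t
    using that by (simp add: v_def rollout_take min_def)
  show ?thesis using 1 2 3 by (rule that)
qed

section \<open>Estimates along a single path under the standing assumptions\<close>

locale lq_tree =
  fixes S :: "('xi,'nx::finite,'nu::finite) lqdata"
    and P :: "'xi list pmf" and T :: nat and L \<alpha> \<gamma> :: real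
  assumes length_path: "\<And>\<zeta>. \<zeta> \<in> set_pmf P \<Longrightarrow> length \<zeta> = Suc T"
    and finite_paths: "finite (set_pmf P)"
    and sym_Q: "\<And>\<xi>. transpose (Qm S \<xi>) = Qm S \<xi>"
    and sym_R: "\<And>\<xi>. transpose (Rm S \<xi>) = Rm S \<xi>"
    and A2: "assumption2 S P T L \<alpha> \<gamma>"
begin

lemma params: "1 \<le> L" "0 < \<alpha>" "\<alpha> < 1" "0 < \<gamma>" "\<gamma> \<le> 1"
  using A2 by (auto simp: assumption2_def)

text \<open>The single quantity through which \<open>\<gamma>\<close> and \<open>\<alpha>\<close>
  enter: later constants are bounded by a number times a power of \<open>L\<close> times a power of
  \<open>cc\<close>, so that they multiply and compare as monomials.\<close>

definition cc :: real where "cc = 1 / (\<gamma> * (1 - \<alpha>)\<^sup>2)"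

lemma cc_ge:
  "1 \<le> cc" "1 / \<gamma> \<le> cc" "1 / (1 - \<alpha>) \<le> cc" "1 / (1 - \<alpha>)\<^sup>2 \<le> cc" "1 / (\<gamma> * (1 - \<alpha>)\<^sup>2) = cc"
proof -
  have b: "0 < (1 - \<alpha>)\<^sup>2" "(1 - \<alpha>)\<^sup>2 \<le> 1" "(1 - \<alpha>)\<^sup>2 \<le> 1 - \<alpha>"
    using params power_decreasing[of 1 2 "1 - \<alpha>"] by (auto simp: power_le_one)
  have *: "x \<ge> \<gamma> * (1 - \<alpha>)\<^sup>2 \<Longrightarrow> 1 / x \<le> cc" for x
    unfolding cc_def using params b by (intro divide_left_mono mult_pos_pos) (auto intro: less_le_trans[of 0 "\<gamma> * (1 - \<alpha>)\<^sup>2"])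
  show "1 \<le> cc" using *[of 1] params b by (simp add: mult_le_one)
  show "1 / \<gamma> \<le> cc" using params b by (intro *) (simp add: mult_left_le)
  have "\<gamma> * (1 - \<alpha>)\<^sup>2 \<le> (1 - \<alpha>)\<^sup>2" using params b by (simp add: mult_left_le_one_le)
  then show "1 / (1 - \<alpha>)\<^sup>2 \<le> cc" "1 / (1 - \<alpha>) \<le> cc" using b by (auto intro!: * order_trans[OF _ b(3)])
qed (simp add: cc_def)

lemma path_bounds:
  assumes "\<zeta> \<in> set_pmf P" "t \<le> T"
  shows "norm (Am S (\<zeta> ! t) *v x) \<le> L * norm x"
    "norm (Bm S (\<zeta> ! t) *v u) \<le> L * norm u"
    "norm (Qm S (\<zeta> ! t) *v x) \<le> L * norm x"
    "norm (Rm S (\<zeta> ! t) *v u) \<le> L * norm u"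
    "0 \<le> x \<bullet> (Qm S (\<zeta> ! t) *v x)"
    "\<gamma> * (norm u)\<^sup>2 \<le> u \<bullet> (Rm S (\<zeta> ! t) *v u)"
  using A2 assms unfolding assumption2_def
  by (auto simp: power2_norm_eq_inner intro!: matrix_vector_norm_le)

lemma hess_commute: "hess S \<xi> v w = hess S \<xi> w v"
  unfolding hess_def
  by (metis inner_commute sym_Q sym_R symmetric_matrix_inner)

lemma hess_ge:
  assumes "\<zeta> \<in> set_pmf P" "t \<le> T"
  shows "(norm (msqrt (Qm S (\<zeta> ! t)) *v fst w))\<^sup>2 + \<gamma> * (norm (snd w))\<^sup>2 \<le> hess S (\<zeta> ! t) w w"
proof -
  have "psd (Qm S (\<zeta> ! t))" using path_bounds(5)[OF assms] sym_Q by (simp add: psd_def)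
  then show ?thesis
    using path_bounds(6)[OF assms] by (simp add: hess_def norm_msqrt_sq)
qed

lemma hess_nonneg:
  assumes "\<zeta> \<in> set_pmf P" "t \<le> T"
  shows "0 \<le> hess S (\<zeta> ! t) w w" "\<gamma> * (norm (snd w))\<^sup>2 \<le> hess S (\<zeta> ! t) w w"
proof -
  have "0 \<le> \<gamma> * (norm (snd w))\<^sup>2" using params by simp
  then show "0 \<le> hess S (\<zeta> ! t) w w" "\<gamma> * (norm (snd w))\<^sup>2 \<le> hess S (\<zeta> ! t) w w"
    using hess_ge[OF assms, of w] zero_le_power2[of "norm (msqrt (Qm S (\<zeta> ! t)) *v fst w)"]
    by linarith+
qed

lemma hess_le:
  assumes "\<zeta> \<in> set_pmf P" "t \<le> T"
  shows "hess S (\<zeta> ! t) w w \<le> L * (norm w)\<^sup>2"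
proof -
  have "fst w \<bullet> (Qm S (\<zeta> ! t) *v fst w) \<le> norm (fst w) * (L * norm (fst w))"
    using path_bounds(3)[OF assms, of "fst w"]
    by (intro order_trans[OF norm_cauchy_schwarz] mult_left_mono) auto
  moreover have "snd w \<bullet> (Rm S (\<zeta> ! t) *v snd w) \<le> norm (snd w) * (L * norm (snd w))"
    using path_bounds(4)[OF assms, of "snd w"]
    by (intro order_trans[OF norm_cauchy_schwarz] mult_left_mono) auto
  ultimately show ?thesis
    unfolding norm_pair_sq by (simp add: hess_def power2_eq_square algebra_simps)
qed

text \<open>Expand the form at \<open>c *\<^sub>R v - w\<close>, where it is nonnegative. The
  parameter will be a weight \<open>\<theta> ^ t\<close>; one factor then receives this weight and
  the other its reciprocal.\<close>

lemma hess_young: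
  assumes "\<zeta> \<in> set_pmf P" "t \<le> T" "0 < c"
  shows "hess S (\<zeta> ! t) v w \<le> c * hess S (\<zeta> ! t) v v / 2 + hess S (\<zeta> ! t) w w / (2 * c)"
proof -
  have "0 \<le> hess S (\<zeta> ! t) (c *\<^sub>R v - w) (c *\<^sub>R v - w)"
    by (rule hess_nonneg) (use assms in auto)
  also have "\<dots> = c * (c * hess S (\<zeta> ! t) v v) - 2 * c * hess S (\<zeta> ! t) v w + hess S (\<zeta> ! t) w w"
    by (simp add: hess_linear hess_commute[of _ w v] algebra_simps)
  finally show ?thesis using assms(3) by (simp add: field_simps)
qed

lemma step_norm_le:
  assumes "\<zeta> \<in> set_pmf P" "t \<le> T"
  shows "(norm (step S (\<zeta> ! t) w))\<^sup>2 \<le> 2 * L\<^sup>2 * (norm w)\<^sup>2"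
proof -
  have "norm (step S (\<zeta> ! t) w) \<le> L * norm (fst w) + L * norm (snd w)"
    unfolding step_def using path_bounds(1,2)[OF assms]
    by (intro order_trans[OF norm_triangle_ineq] add_mono) auto
  then have "(norm (step S (\<zeta> ! t) w))\<^sup>2 \<le> (L * norm (fst w) + L * norm (snd w))\<^sup>2"
    by (simp add: power_mono)
  also have "\<dots> \<le> 2 * (L * norm (fst w))\<^sup>2 + 2 * (L * norm (snd w))\<^sup>2"
    using sum_squares_bound[of "L * norm (fst w)" "L * norm (snd w)"]
    by (simp add: power2_sum)
  finally show ?thesis by (simp add: norm_pair_sq power_mult_distrib algebra_simps)
qed

text \<open>Output injection: written with the stable matrices \<open>A - K C\<close>, the state
  equation has the output \<open>C x\<close>, the input and \<open>d\<close> as forcing. By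
  \<open>hess_ge\<close> the energy pays for output and input, and \<open>\<theta> \<le> 1\<close>
  keeps the weighted ratio at most \<open>\<alpha>\<close>. The factor 6 is 3 for the states plus 3
  for the inputs.\<close>

lemma detectability_bound:
  assumes \<zeta>: "\<zeta> \<in> set_pmf P" and \<tau>: "\<tau> \<le> N" "N \<le> T" and \<theta>: "0 < \<theta>" "\<theta> \<le> 1"
    and dyn: "\<And>t. \<tau> \<le> t \<Longrightarrow> t < N \<Longrightarrow> fst (w (Suc t)) = step S (\<zeta> ! Suc t) (w t) + d (Suc t)"
  shows "(\<Sum>t\<in>{\<tau>..N}. \<theta> ^ t * (norm (w t))\<^sup>2) \<le> 6 * L^4 * cc *
    (\<theta> ^ \<tau> * (norm (fst (w \<tau>)))\<^sup>2 + (\<Sum>t\<in>{\<tau>..N}. \<theta> ^ t * hess S (\<zeta> ! t) (w t) (w t))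
      + (\<Sum>t\<in>{\<tau>..N}. \<theta> ^ t * (norm (d t))\<^sup>2))"
proof -
  let ?b = "1 - \<alpha>"
  let ?C = "\<lambda>t. msqrt (Qm S (\<zeta> ! t))"
  let ?h = "\<lambda>t. hess S (\<zeta> ! t) (w t) (w t)"
  define I where "I = \<theta> ^ \<tau> * (norm (fst (w \<tau>)))\<^sup>2"
  define E where "E = (\<Sum>t\<in>{\<tau>..N}. \<theta> ^ t * ?h t)"
  define G where "G = (\<Sum>t\<in>{\<tau>..N}. \<theta> ^ t * (norm (d t))\<^sup>2)"
  have h0: "0 \<le> ?h t" if "t \<le> N" for t using hess_nonneg(1)[OF \<zeta>] that \<tau> by auto
  have nn: "0 \<le> I" "0 \<le> E" "0 \<le> G"
    using \<theta> h0 by (auto simp: I_def E_def G_def intro!: sum_nonneg)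
  obtain K where K: "\<And>t. t \<in> {1..T} \<Longrightarrow> mnorm (K t (take (Suc t) \<zeta>)) \<le> L"
    and stab: "stable P T L \<alpha> (\<lambda>s \<zeta>. Am S (\<zeta> ! s) - K s (take (Suc s) \<zeta>) ** msqrt (Qm S (\<zeta> ! (s - 1))))"
    using A2 \<zeta> unfolding assumption2_def detectable_def by blast
  define \<Phi> where "\<Phi> s = Am S (\<zeta> ! s) - K s (take (Suc s) \<zeta>) ** ?C (s - 1)" for s
  have stab': "mnorm (lprod \<Phi> k (j - k)) \<le> L * \<alpha> ^ (j - k)" if "\<tau> \<le> k" "k < j" "j \<le> N" for k j
    using stab \<zeta> that \<tau> unfolding stable_def by (simp add: \<Phi>_def[abs_def])
  define h where "h t = (if t = \<tau> then fst (w \<tau>)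
     else K t (take (Suc t) \<zeta>) *v (?C (t - 1) *v fst (w (t - 1))) + Bm S (\<zeta> ! t) *v snd (w (t - 1)) + d t)" for t
  have "(\<Sum>t\<in>{\<tau>..N}. \<theta> ^ t * (norm (fst (w t)))\<^sup>2)
    \<le> (L\<^sup>2 / (?b * (1 - \<alpha> * \<theta>))) * (\<Sum>t\<in>{\<tau>..N}. \<theta> ^ t * (norm (h t))\<^sup>2)"
  proof (rule linear_recursion_weighted_bound[OF stab'])
    show "\<alpha> * \<theta> < 1" using params \<theta> mult_left_le[of \<theta> \<alpha>] by linarith
    show "fst (w (Suc t)) = \<Phi> (Suc t) *v fst (w t) + h (Suc t)" if "\<tau> \<le> t" "t < N" for t
      using dyn[OF that] that
      by (simp add: h_def \<Phi>_def step_def matrix_vector_mult_diff_rdistrib matrix_vector_mul_assoc)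
  qed (use params \<theta> in \<open>auto simp: h_def\<close>)
  also have "\<dots> \<le> (L\<^sup>2 / ?b\<^sup>2) * (3 * L\<^sup>2 * (1 / \<gamma>) * (I + E + G))"
  proof (rule mult_mono)
    have "\<alpha> * \<theta> \<le> \<alpha>" using params \<theta> by (simp add: mult_left_le)
    moreover from this have "\<alpha> * \<theta> < 1" using params by linarith
    ultimately show "L\<^sup>2 / (?b * (1 - \<alpha> * \<theta>)) \<le> L\<^sup>2 / ?b\<^sup>2"
      using params unfolding power2_eq_square by (intro divide_left_mono mult_left_mono mult_pos_pos) auto
    have g1: "1 \<le> 1 / \<gamma>" using params by simp
    have hb: "\<theta> ^ t * (norm (h t))\<^sup>2
      \<le> 3 * L\<^sup>2 * (1 / \<gamma>) * (\<theta> ^ (t - 1) * ?h (t - 1) + \<theta> ^ t * (norm (d t))\<^sup>2)"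
      if t: "t \<in> {Suc \<tau>..N}" for t
    proof -
      let ?y = "?C (t - 1) *v fst (w (t - 1))" and ?u = "snd (w (t - 1))"
      have "norm (h t) \<le> L * norm ?y + L * norm ?u + norm (d t)"
      proof -
        have "norm (K t (take (Suc t) \<zeta>) *v ?y) \<le> L * norm ?y"
          using K[of t] t \<tau> by (intro matrix_vector_norm_le) auto
        moreover have "norm (Bm S (\<zeta> ! t) *v ?u) \<le> L * norm ?u"
          using path_bounds(2)[OF \<zeta>] t \<tau> by auto
        ultimately show ?thesis using t unfolding h_def
          by (auto intro!: order_trans[OF norm_triangle_ineq] add_mono)
      qed
      then have "(norm (h t))\<^sup>2 \<le> (L * norm ?y + L * norm ?u + norm (d t))\<^sup>2"
        by (simp add: power_mono)
      also have "\<dots> \<le> 3 * ((L * norm ?y)\<^sup>2 + (L * norm ?u)\<^sup>2 + (norm (d t))\<^sup>2)"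
        using sum_squares_bound[of "L * norm ?y" "L * norm ?u"]
          sum_squares_bound[of "L * norm ?y" "norm (d t)"] sum_squares_bound[of "L * norm ?u" "norm (d t)"]
        by (simp add: power2_eq_square algebra_simps)
      also have "\<dots> \<le> 3 * L\<^sup>2 * (1 / \<gamma>) * (?h (t - 1) + (norm (d t))\<^sup>2)"
      proof -
        have "(norm ?y)\<^sup>2 + \<gamma> * (norm ?u)\<^sup>2 \<le> ?h (t - 1)"
          using t \<tau> by (intro hess_ge \<zeta>) auto
        moreover have "\<gamma> * (norm ?y)\<^sup>2 \<le> (norm ?y)\<^sup>2" using params by (simp add: mult_left_le_one_le)
        ultimately have "\<gamma> * ((norm ?y)\<^sup>2 + (norm ?u)\<^sup>2) \<le> ?h (t - 1)" by (simp add: algebra_simps)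
        then have "(norm ?y)\<^sup>2 + (norm ?u)\<^sup>2 \<le> (1 / \<gamma>) * ?h (t - 1)"
          using params by (simp add: field_simps)
        then have 1: "L\<^sup>2 * ((norm ?y)\<^sup>2 + (norm ?u)\<^sup>2) \<le> L\<^sup>2 * ((1 / \<gamma>) * ?h (t - 1))"
          by (intro mult_left_mono) auto
        have "1 \<le> L\<^sup>2 * (1 / \<gamma>)" using params g1 mult_mono[of 1 "L\<^sup>2" 1 "1 / \<gamma>"] by simp
        then have 2: "(norm (d t))\<^sup>2 \<le> L\<^sup>2 * (1 / \<gamma>) * (norm (d t))\<^sup>2"
          using mult_right_mono[of 1 "L\<^sup>2 * (1 / \<gamma>)" "(norm (d t))\<^sup>2"] by simp
        show ?thesis using 1 2 by (simp add: power_mult_distrib algebra_simps)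
      qed
      finally have "\<theta> ^ t * (norm (h t))\<^sup>2 \<le> \<theta> ^ t * (3 * L\<^sup>2 * (1 / \<gamma>) * (?h (t - 1) + (norm (d t))\<^sup>2))"
        using \<theta> by (intro mult_left_mono) auto
      also have "\<dots> = 3 * L\<^sup>2 * (1 / \<gamma>) * (\<theta> ^ t * ?h (t - 1) + \<theta> ^ t * (norm (d t))\<^sup>2)"
        by (simp add: algebra_simps)
      \<comment> \<open>The energy belongs to time \<open>t - 1\<close>; its proper weight
        \<open>\<theta> ^ (t - 1)\<close> is at least \<open>\<theta> ^ t\<close>.\<close>
      also have "\<dots> \<le> 3 * L\<^sup>2 * (1 / \<gamma>) * (\<theta> ^ (t - 1) * ?h (t - 1) + \<theta> ^ t * (norm (d t))\<^sup>2)"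
        using \<theta> h0[of "t - 1"] t params
        by (intro mult_left_mono add_mono mult_right_mono power_decreasing) auto
      finally show ?thesis .
    qed
    have "(\<Sum>t\<in>{\<tau>..N}. \<theta> ^ t * (norm (h t))\<^sup>2) = I + (\<Sum>t\<in>{Suc \<tau>..N}. \<theta> ^ t * (norm (h t))\<^sup>2)"
      using \<tau> by (subst sum.atLeast_Suc_atMost) (auto simp: I_def h_def)
    also have "\<dots> \<le> I + (\<Sum>t\<in>{Suc \<tau>..N}. 3 * L\<^sup>2 * (1 / \<gamma>) * (\<theta> ^ (t - 1) * ?h (t - 1) + \<theta> ^ t * (norm (d t))\<^sup>2))"
      by (intro add_left_mono sum_mono hb)
    also have "\<dots> = I + 3 * L\<^sup>2 * (1 / \<gamma>) * ((\<Sum>t\<in>{Suc \<tau>..N}. \<theta> ^ (t - 1) * ?h (t - 1))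
        + (\<Sum>t\<in>{Suc \<tau>..N}. \<theta> ^ t * (norm (d t))\<^sup>2))"
      by (simp add: sum_distrib_left sum.distrib distrib_left)
    also have "\<dots> \<le> 3 * L\<^sup>2 * (1 / \<gamma>) * I + 3 * L\<^sup>2 * (1 / \<gamma>) * (E + G)"
    proof (intro add_mono mult_left_mono)
      have "(\<Sum>t\<in>{Suc \<tau>..N}. \<theta> ^ (t - 1) * ?h (t - 1)) = (\<Sum>t\<in>(\<lambda>t. t - 1) ` {Suc \<tau>..N}. \<theta> ^ t * ?h t)"
        by (subst sum.reindex) (auto simp: inj_on_def)
      also have "\<dots> \<le> E"
        unfolding E_def using \<theta> h0 by (intro sum_mono2) auto
      finally show "(\<Sum>t\<in>{Suc \<tau>..N}. \<theta> ^ (t - 1) * ?h (t - 1)) \<le> E" .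
      show "(\<Sum>t\<in>{Suc \<tau>..N}. \<theta> ^ t * (norm (d t))\<^sup>2) \<le> G"
        unfolding G_def using \<theta> by (intro sum_mono2) auto
      have "1 \<le> L\<^sup>2 * (1 / \<gamma>)" using params g1 mult_mono[of 1 "L\<^sup>2" 1 "1 / \<gamma>"] by simp
      then have "1 \<le> 3 * L\<^sup>2 * (1 / \<gamma>)" by simp
      then show "I \<le> 3 * L\<^sup>2 * (1 / \<gamma>) * I"
        using mult_right_mono[of 1 "3 * L\<^sup>2 * (1 / \<gamma>)" I] nn by simp
    qed (use params in auto)
    finally show "(\<Sum>t\<in>{\<tau>..N}. \<theta> ^ t * (norm (h t))\<^sup>2) \<le> 3 * L\<^sup>2 * (1 / \<gamma>) * (I + E + G)"
      by (simp only: distrib_left add.assoc)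
  qed (use params \<theta> in \<open>auto intro!: sum_nonneg\<close>)
  also have "\<dots> = 3 * L^4 * cc * (I + E + G)"
    using params by (simp add: cc_def field_simps power4_eq_xxxx power2_eq_square)
  finally have x: "(\<Sum>t\<in>{\<tau>..N}. \<theta> ^ t * (norm (fst (w t)))\<^sup>2) \<le> 3 * L^4 * cc * (I + E + G)" .
  have "\<theta> ^ t * (norm (snd (w t)))\<^sup>2 \<le> cc * (\<theta> ^ t * ?h t)" if "t \<in> {\<tau>..N}" for t
  proof -
    have "(norm (snd (w t)))\<^sup>2 \<le> (1 / \<gamma>) * ?h t"
      using hess_nonneg(2)[OF \<zeta>, of t "w t"] that \<tau> params by (simp add: field_simps)
    also have "\<dots> \<le> cc * ?h t" using cc_ge(2) h0[of t] that by (intro mult_right_mono) auto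
    finally show ?thesis using \<theta> by (simp add: mult.left_commute mult_left_mono)
  qed
  then have "(\<Sum>t\<in>{\<tau>..N}. \<theta> ^ t * (norm (snd (w t)))\<^sup>2) \<le> cc * E"
    unfolding E_def sum_distrib_left by (rule sum_mono)
  also have "\<dots> \<le> 3 * L^4 * cc * (I + E + G)"
  proof -
    have "1 \<le> 3 * L^4" using one_le_power[of L 4] params by linarith
    then have "1 * E \<le> (3 * L^4) * (I + E + G)" using nn by (intro mult_mono) auto
    then show ?thesis using cc_ge(1) mult_left_mono[of E "3 * L^4 * (I + E + G)" cc] by (simp add: ac_simps)
  qed
  finally show ?thesis using x
    by (simp add: norm_pair_sq distrib_left sum.distrib I_def E_def G_def)
qed

text \<open>The input is set to zero at time \<open>T\<close>, where the stabilising gains are not controlled.\<close>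

lemma stabilised_response:
  obtains v :: "nat \<Rightarrow> 'xi list \<Rightarrow> (real^'nx) \<times> (real^'nu)"
  where "\<And>\<zeta>. fst (at_prefix v \<tau> \<zeta>) = at_prefix g \<tau> \<zeta>"
    "\<And>\<zeta> t. \<tau> \<le> t \<Longrightarrow>
       fst (at_prefix v (Suc t) \<zeta>) = step S (\<zeta> ! Suc t) (at_prefix v t \<zeta>) + at_prefix g (Suc t) \<zeta>"
    "\<And>\<zeta> t. \<zeta> \<in> set_pmf P \<Longrightarrow> t \<le> T \<Longrightarrow>
       norm (snd (at_prefix v t \<zeta>)) \<le> L * norm (fst (at_prefix v t \<zeta>))"
    "\<And>\<zeta> \<omega> N. \<zeta> \<in> set_pmf P \<Longrightarrow> 0 < \<omega> \<Longrightarrow> \<alpha> * \<omega> < 1 \<Longrightarrow> N \<le> T \<Longrightarrow>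
       (\<Sum>t\<in>{\<tau>..N}. \<omega> ^ t * (norm (fst (at_prefix v t \<zeta>)))\<^sup>2)
         \<le> (L\<^sup>2 / ((1 - \<alpha>) * (1 - \<alpha> * \<omega>))) * (\<Sum>t\<in>{\<tau>..N}. \<omega> ^ t * (norm (at_prefix g t \<zeta>))\<^sup>2)"
proof -
  obtain K where K: "\<And>\<zeta> t. \<zeta> \<in> set_pmf P \<Longrightarrow> t < T \<Longrightarrow> mnorm (K t (take (Suc t) \<zeta>)) \<le> L"
    and stab: "stable P T L \<alpha> (\<lambda>s \<zeta>. Am S (\<zeta> ! s) - Bm S (\<zeta> ! s) ** K (s - 1) (take s \<zeta>))"
    using A2 unfolding assumption2_def stabilizable_def by blast
  define U where "U t b x = (if t < T then - (K t b *v x) else 0)" for t b x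
  obtain v where v: "\<And>\<zeta>. fst (at_prefix v \<tau> \<zeta>) = at_prefix g \<tau> \<zeta>"
    "\<And>\<zeta> t. snd (at_prefix v t \<zeta>) = U t (take (Suc t) \<zeta>) (fst (at_prefix v t \<zeta>))"
    "\<And>\<zeta> t. \<tau> \<le> t \<Longrightarrow>
       fst (at_prefix v (Suc t) \<zeta>) = step S (\<zeta> ! Suc t) (at_prefix v t \<zeta>) + at_prefix g (Suc t) \<zeta>"
    using rollout_exists[of \<tau> g U S] by metis
  show ?thesis
  proof (rule that[OF v(1,3)])
    show "norm (snd (at_prefix v t \<zeta>)) \<le> L * norm (fst (at_prefix v t \<zeta>))"
      if "\<zeta> \<in> set_pmf P" "t \<le> T" for \<zeta> t
      using params K[OF that(1)] matrix_vector_norm_le by (auto simp: v(2) U_def)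
    fix \<zeta> \<omega> N assume \<zeta>: "\<zeta> \<in> set_pmf P" and \<omega>: "0 < \<omega>" "\<alpha> * \<omega> < 1" and N: "N \<le> T"
    define \<Phi> where "\<Phi> s = Am S (\<zeta> ! s) - Bm S (\<zeta> ! s) ** K (s - 1) (take s \<zeta>)" for s
    have stab': "mnorm (lprod \<Phi> k (j - k)) \<le> L * \<alpha> ^ (j - k)" if "\<tau> \<le> k" "k < j" "j \<le> N" for k j
      using stab \<zeta> that N unfolding stable_def by (simp add: \<Phi>_def[abs_def])
    show "(\<Sum>t\<in>{\<tau>..N}. \<omega> ^ t * (norm (fst (at_prefix v t \<zeta>)))\<^sup>2)
         \<le> (L\<^sup>2 / ((1 - \<alpha>) * (1 - \<alpha> * \<omega>))) * (\<Sum>t\<in>{\<tau>..N}. \<omega> ^ t * (norm (at_prefix g t \<zeta>))\<^sup>2)"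
    proof (rule linear_recursion_weighted_bound[OF stab'])
      \<comment> \<open>Since \<open>t < N\<close> and \<open>N \<le> T\<close>, the feedback branch
        of \<open>U\<close> is active and the state equation becomes the closed-loop
        recursion.\<close>
      show "fst (at_prefix v (Suc t) \<zeta>) = \<Phi> (Suc t) *v fst (at_prefix v t \<zeta>) + at_prefix g (Suc t) \<zeta>"
        if "\<tau> \<le> t" "t < N" for t
        using that N unfolding v(3)[OF that(1)]
        by (simp add: v(2) U_def step_def \<Phi>_def matrix_vector_mult_diff_rdistrib matrix_vector_mul_assoc
            linear_neg[OF matrix_vector_mul_linear])
    qed (use params \<omega> v in auto)
  qed
qed

section \<open>Variational calculus on a subtree\<close>

definition paths :: "nat \<Rightarrow> 'xi list \<Rightarrow> 'xi list set" where
  "paths \<tau> a = {\<zeta> \<in> set_pmf P. take (Suc \<tau>) \<zeta> = a}"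

text \<open>Unnormalised conditional expectation given the prefix \<open>a\<close>.\<close>

definition esum :: "nat \<Rightarrow> 'xi list \<Rightarrow> ('xi list \<Rightarrow> real) \<Rightarrow> real" where
  "esum \<tau> a f = (\<Sum>\<zeta>\<in>paths \<tau> a. pmf P \<zeta> * f \<zeta>)"

lemma finite_paths_prefix [simp]: "finite (paths \<tau> a)"
  using finite_paths by (simp add: paths_def)

lemma paths_D: "\<zeta> \<in> paths \<tau> a \<Longrightarrow> \<zeta> \<in> set_pmf P" "\<zeta> \<in> paths \<tau> a \<Longrightarrow> take (Suc \<tau>) \<zeta> = a"
  by (auto simp: paths_def)

lemma esum_linear:
  "esum \<tau> a (\<lambda>\<zeta>. f \<zeta> + g \<zeta>) = esum \<tau> a f + esum \<tau> a g"
  "esum \<tau> a (\<lambda>\<zeta>. f \<zeta> - g \<zeta>) = esum \<tau> a f - esum \<tau> a g"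
  "esum \<tau> a (\<lambda>\<zeta>. k * f \<zeta>) = k * esum \<tau> a f"
  by (simp_all add: esum_def sum.distrib sum_subtractf sum_distrib_left algebra_simps)

lemma esum_mono: "(\<And>\<zeta>. \<zeta> \<in> paths \<tau> a \<Longrightarrow> f \<zeta> \<le> g \<zeta>) \<Longrightarrow> esum \<tau> a f \<le> esum \<tau> a g"
  unfolding esum_def by (intro sum_mono mult_left_mono) auto

lemma esum_nonneg: "(\<And>\<zeta>. \<zeta> \<in> paths \<tau> a \<Longrightarrow> 0 \<le> f \<zeta>) \<Longrightarrow> 0 \<le> esum \<tau> a f"
  unfolding esum_def by (intro sum_nonneg mult_nonneg_nonneg) auto

lemma esum_cong: "(\<And>\<zeta>. \<zeta> \<in> paths \<tau> a \<Longrightarrow> f \<zeta> = g \<zeta>) \<Longrightarrow> esum \<tau> a f = esum \<tau> a g"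
  unfolding esum_def by (intro sum.cong) auto

text \<open>The forcing is a parameter so that one notion serves the true dynamics, the homogeneous
  test directions and trajectories with a defect. The state at \<open>\<tau>\<close> is left
  free.\<close>

definition traj :: "nat \<Rightarrow> nat \<Rightarrow> 'xi list \<Rightarrow> (nat \<Rightarrow> 'xi list \<Rightarrow> real^'nx)
    \<Rightarrow> (nat \<Rightarrow> 'xi list \<Rightarrow> (real^'nx) \<times> (real^'nu)) \<Rightarrow> bool" where
  "traj \<tau> N a d w \<longleftrightarrow> (\<forall>\<zeta>\<in>paths \<tau> a. \<forall>t\<in>{\<tau>..<N}.
     fst (at_prefix w (Suc t) \<zeta>) = step S (\<zeta> ! Suc t) (at_prefix w t \<zeta>) + at_prefix d (Suc t) \<zeta>)"

lemma trajD: "traj \<tau> N a d w \<Longrightarrow> \<zeta> \<in> paths \<tau> a \<Longrightarrow> \<tau> \<le> t \<Longrightarrow> t < N \<Longrightarrow>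
    fst (at_prefix w (Suc t) \<zeta>) = step S (\<zeta> ! Suc t) (at_prefix w t \<zeta>) + at_prefix d (Suc t) \<zeta>"
  by (auto simp: traj_def)

lemma traj_add_scaled:
  assumes "traj \<tau> N a d v" "traj \<tau> N a e w"
  shows "traj \<tau> N a (\<lambda>t b. d t b + k *\<^sub>R e t b) (\<lambda>t b. v t b + k *\<^sub>R w t b)"
  using assms by (auto simp: traj_def step_linear algebra_simps)

lemma traj_diff:
  assumes "traj \<tau> N a d v" "traj \<tau> N a e w"
  shows "traj \<tau> N a (\<lambda>t b. d t b - e t b) (\<lambda>t b. v t b - w t b)"
  using assms by (auto simp: traj_def step_linear algebra_simps)

definition admissible :: "nat \<Rightarrow> nat \<Rightarrow> 'xi list \<Rightarrow> real^'nx
    \<Rightarrow> (nat \<Rightarrow> 'xi list \<Rightarrow> (real^'nx) \<times> (real^'nu)) \<Rightarrow> bool" where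
  "admissible \<tau> N a x w \<longleftrightarrow> fst (w \<tau> a) = x \<and> traj \<tau> N a (\<lambda>t b. dv S (b ! t)) w"

definition cost :: "nat \<Rightarrow> nat \<Rightarrow> 'xi list \<Rightarrow> (nat \<Rightarrow> 'xi list \<Rightarrow> (real^'nx) \<times> (real^'nu)) \<Rightarrow> real" where
  "cost \<tau> N a w = esum \<tau> a (\<lambda>\<zeta>. \<Sum>t\<in>{\<tau>..N}. stage S (at_prefix w t \<zeta>) (\<zeta> ! t))"

definition energy :: "nat \<Rightarrow> nat \<Rightarrow> 'xi list \<Rightarrow> (nat \<Rightarrow> 'xi list \<Rightarrow> (real^'nx) \<times> (real^'nu))
    \<Rightarrow> (nat \<Rightarrow> 'xi list \<Rightarrow> (real^'nx) \<times> (real^'nu)) \<Rightarrow> real" where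
  "energy \<tau> N a v w = esum \<tau> a (\<lambda>\<zeta>. \<Sum>t\<in>{\<tau>..N}. hess S (\<zeta> ! t) (at_prefix v t \<zeta>) (at_prefix w t \<zeta>))"

definition load :: "nat \<Rightarrow> nat \<Rightarrow> 'xi list \<Rightarrow> (nat \<Rightarrow> 'xi list \<Rightarrow> (real^'nx) \<times> (real^'nu))
    \<Rightarrow> (nat \<Rightarrow> 'xi list \<Rightarrow> (real^'nx) \<times> (real^'nu)) \<Rightarrow> real" where
  "load \<tau> N a F v = esum \<tau> a (\<lambda>\<zeta>. \<Sum>t\<in>{\<tau>..N}. F t \<zeta> \<bullet> at_prefix v t \<zeta>)"

text \<open>The weak form of the optimality conditions: testing with homogeneous trajectories that
  start at zero replaces multipliers. The load \<open>F\<close> is general because the error of a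
  truncated solution is stationary for a load different from \<open>source\<close>.\<close>

definition stationary :: "nat \<Rightarrow> nat \<Rightarrow> 'xi list \<Rightarrow> (nat \<Rightarrow> 'xi list \<Rightarrow> (real^'nx) \<times> (real^'nu))
    \<Rightarrow> (nat \<Rightarrow> 'xi list \<Rightarrow> (real^'nx) \<times> (real^'nu)) \<Rightarrow> bool" where
  "stationary \<tau> N a F w \<longleftrightarrow>
     (\<forall>v. traj \<tau> N a (\<lambda>_ _. 0) v \<and> fst (v \<tau> a) = 0 \<longrightarrow> energy \<tau> N a w v = load \<tau> N a F v)"

definition source :: "nat \<Rightarrow> 'xi list \<Rightarrow> (real^'nx) \<times> (real^'nu)" where
  "source t \<zeta> = (qv S (\<zeta> ! t), rv S (\<zeta> ! t))"

lemma admissible_diff: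
  assumes "admissible \<tau> N a x v" "admissible \<tau> N a x w"
  shows "traj \<tau> N a (\<lambda>_ _. 0) (\<lambda>t b. v t b - w t b)" "fst (v \<tau> a - w \<tau> a) = 0"
  using assms traj_diff[of \<tau> N a _ v _ w] by (fastforce simp: admissible_def)+

lemma admissible_add:
  assumes "admissible \<tau> N a x w" "traj \<tau> N a (\<lambda>_ _. 0) v" "fst (v \<tau> a) = 0"
  shows "admissible \<tau> N a x (\<lambda>t b. w t b + k *\<^sub>R v t b)"
  using assms traj_add_scaled[of \<tau> N a _ w _ v k] by (fastforce simp: admissible_def)

text \<open>Exact because the stage cost is quadratic and its Hessian symmetric. The coefficient of
  \<open>k\<close> is the first variation; the identity serves for stationarity, for the gap formula
  and for the midpoint comparison of a minimising sequence.\<close>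

lemma cost_expand:
  "cost \<tau> N a (\<lambda>t b. w t b + k *\<^sub>R v t b)
    = cost \<tau> N a w + k * (energy \<tau> N a w v - load \<tau> N a source v) + k\<^sup>2 * (energy \<tau> N a v v / 2)"
proof -
  have "stage S (w + k *\<^sub>R v) (\<zeta> ! t) = stage S w (\<zeta> ! t) + k * (hess S (\<zeta> ! t) w v - source t \<zeta> \<bullet> v)
      + k\<^sup>2 * (1/2) * hess S (\<zeta> ! t) v v" for w v \<zeta> t
    by (simp add: stage_eq_hess hess_linear hess_commute[of _ v w] source_def[symmetric]
        inner_add_right power2_eq_square algebra_simps)
  then have "cost \<tau> N a (\<lambda>t b. w t b + k *\<^sub>R v t b) = esum \<tau> a (\<lambda>\<zeta>.
      (\<Sum>t\<in>{\<tau>..N}. stage S (at_prefix w t \<zeta>) (\<zeta> ! t))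
      + k * ((\<Sum>t\<in>{\<tau>..N}. hess S (\<zeta> ! t) (at_prefix w t \<zeta>) (at_prefix v t \<zeta>))
           - (\<Sum>t\<in>{\<tau>..N}. source t \<zeta> \<bullet> at_prefix v t \<zeta>))
      + k\<^sup>2 * (1/2) * (\<Sum>t\<in>{\<tau>..N}. hess S (\<zeta> ! t) (at_prefix v t \<zeta>) (at_prefix v t \<zeta>)))"
    by (simp only: cost_def sum.distrib sum_subtractf sum_distrib_left[symmetric])
  then show ?thesis
    unfolding cost_def energy_def load_def by (simp only: esum_linear)
qed

lemma energy_nonneg:
  assumes "N \<le> T" shows "0 \<le> energy \<tau> N a v v"
  unfolding energy_def using assms
  by (intro esum_nonneg sum_nonneg hess_nonneg) (auto dest: paths_D)

lemma minimiser_stationary: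
  assumes adm: "admissible \<tau> N a x w"
    and min: "\<And>w'. admissible \<tau> N a x w' \<Longrightarrow> cost \<tau> N a w \<le> cost \<tau> N a w'"
  shows "stationary \<tau> N a source w"
  unfolding stationary_def
proof (intro allI impI)
  fix v assume v: "traj \<tau> N a (\<lambda>_ _. 0) v \<and> fst (v \<tau> a) = 0"
  have "energy \<tau> N a w v - load \<tau> N a source v = 0"
  proof (rule quadratic_nonneg_imp_linear_zero)
    fix k
    show "0 \<le> k * (energy \<tau> N a w v - load \<tau> N a source v) + k\<^sup>2 * (energy \<tau> N a v v / 2)"
      using min[OF admissible_add[OF adm, of v k]] v by (simp add: cost_expand)
  qed
  then show "energy \<tau> N a w v = load \<tau> N a source v" by simp
qed

lemma cost_stationary_add:
  assumes "stationary \<tau> N a source w" "traj \<tau> N a (\<lambda>_ _. 0) v" "fst (v \<tau> a) = 0"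
  shows "cost \<tau> N a (\<lambda>t b. w t b + v t b) = cost \<tau> N a w + energy \<tau> N a v v / 2"
  using cost_expand[of \<tau> N a w 1 v] assms by (auto simp: stationary_def)

text \<open>Detectability with weight 1: without initial state and forcing, only the energy is left
  to bound the trajectory.\<close>

lemma coercive:
  assumes "\<tau> \<le> N" "N \<le> T" "traj \<tau> N a (\<lambda>_ _. 0) v" "fst (v \<tau> a) = 0"
  shows "esum \<tau> a (\<lambda>\<zeta>. \<Sum>t\<in>{\<tau>..N}. (norm (at_prefix v t \<zeta>))\<^sup>2) \<le> 6 * L^4 * cc * energy \<tau> N a v v"
proof -
  have "(\<Sum>t\<in>{\<tau>..N}. (norm (at_prefix v t \<zeta>))\<^sup>2)
      \<le> 6 * L^4 * cc * (\<Sum>t\<in>{\<tau>..N}. hess S (\<zeta> ! t) (at_prefix v t \<zeta>) (at_prefix v t \<zeta>))"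
    if \<zeta>: "\<zeta> \<in> paths \<tau> a" for \<zeta>
    using detectability_bound[OF paths_D(1)[OF \<zeta>] assms(1,2), of 1 "\<lambda>t. at_prefix v t \<zeta>" "\<lambda>_. 0"]
      trajD[OF assms(3) \<zeta>] assms(4) paths_D(2)[OF \<zeta>] by simp
  then have "esum \<tau> a (\<lambda>\<zeta>. \<Sum>t\<in>{\<tau>..N}. (norm (at_prefix v t \<zeta>))\<^sup>2)
     \<le> esum \<tau> a (\<lambda>\<zeta>. 6 * L^4 * cc * (\<Sum>t\<in>{\<tau>..N}. hess S (\<zeta> ! t) (at_prefix v t \<zeta>) (at_prefix v t \<zeta>)))"
    by (intro esum_mono) auto
  then show ?thesis by (simp only: esum_linear energy_def)
qed

section \<open>Existence of minimisers\<close>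

lemma power_cc_ge_1: "1 \<le> L^4 * cc" "1 \<le> L ^ n * cc"
  using params cc_ge(1) one_le_power[of L n] one_le_power[of L 4]
    mult_mono[of 1 "L ^ n" 1 cc] mult_mono[of 1 "L ^ 4" 1 cc] by auto

text \<open>The linear part of the cost is split by \<open>young_product\<close> with the
  detectability constant \<open>k\<close>, so that it consumes at most a quarter of the energy,
  while the quadratic part supplies half of it.\<close>

lemma cost_bounded_below:
  assumes "\<tau> \<le> N" "N \<le> T"
  obtains c where "\<And>w. admissible \<tau> N a x w \<Longrightarrow> c \<le> cost \<tau> N a w"
proof -
  define k where "k = 6 * L^4 * cc"
  have k: "0 < k" using power_cc_ge_1(1) unfolding k_def by linarith
  let ?G = "\<lambda>\<zeta>. \<Sum>t\<in>{\<tau>..N}. (norm (dv S (\<zeta> ! t)))\<^sup>2"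
  let ?F = "\<lambda>\<zeta>. \<Sum>t\<in>{\<tau>..N}. (norm (source t \<zeta>))\<^sup>2"
  show ?thesis
  proof (rule that)
    fix w assume w: "admissible \<tau> N a x w"
    show "esum \<tau> a (\<lambda>\<zeta>. - ((norm x)\<^sup>2 + ?G \<zeta>) / 4 - k * ?F \<zeta>) \<le> cost \<tau> N a w"
      unfolding cost_def
    proof (rule esum_mono)
      fix \<zeta> assume \<zeta>: "\<zeta> \<in> paths \<tau> a"
      let ?w = "\<lambda>t. at_prefix w t \<zeta>"
      define E where "E = (\<Sum>t\<in>{\<tau>..N}. hess S (\<zeta> ! t) (?w t) (?w t))"
      have E: "0 \<le> E" unfolding E_def using assms paths_D(1)[OF \<zeta>]
        by (intro sum_nonneg hess_nonneg) auto
      have "(\<Sum>t\<in>{\<tau>..N}. 1 ^ t * (norm (?w t))\<^sup>2) \<le> 6 * L^4 * cc *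
        (1 ^ \<tau> * (norm (fst (?w \<tau>)))\<^sup>2 + (\<Sum>t\<in>{\<tau>..N}. 1 ^ t * hess S (\<zeta> ! t) (?w t) (?w t))
          + (\<Sum>t\<in>{\<tau>..N}. 1 ^ t * (norm (dv S (\<zeta> ! t)))\<^sup>2))"
        using w trajD[OF _ \<zeta>, of N "\<lambda>t b. dv S (b ! t)" w]
        by (intro detectability_bound[OF paths_D(1)[OF \<zeta>] assms]) (auto simp: admissible_def)
      then have X: "(\<Sum>t\<in>{\<tau>..N}. (norm (?w t))\<^sup>2) \<le> k * ((norm x)\<^sup>2 + E + ?G \<zeta>)"
        using w paths_D(2)[OF \<zeta>] by (simp add: k_def E_def admissible_def)
      have "source t \<zeta> \<bullet> ?w t \<le> (norm (?w t))\<^sup>2 / (4 * k) + k * (norm (source t \<zeta>))\<^sup>2" for t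
        using young_product[OF k, of "norm (?w t)" "norm (source t \<zeta>)"]
          norm_cauchy_schwarz[of "source t \<zeta>" "?w t"] by (simp add: mult.commute)
      then have "(\<Sum>t\<in>{\<tau>..N}. source t \<zeta> \<bullet> ?w t)
        \<le> (\<Sum>t\<in>{\<tau>..N}. (norm (?w t))\<^sup>2 / (4 * k) + k * (norm (source t \<zeta>))\<^sup>2)"
        by (intro sum_mono) auto
      also have "\<dots> = (\<Sum>t\<in>{\<tau>..N}. (norm (?w t))\<^sup>2) / (4 * k) + k * ?F \<zeta>"
        by (simp add: sum.distrib sum_divide_distrib sum_distrib_left)
      also have "\<dots> \<le> ((norm x)\<^sup>2 + E + ?G \<zeta>) / 4 + k * ?F \<zeta>"
        using X k by (simp add: field_simps)
      finally have "(\<Sum>t\<in>{\<tau>..N}. source t \<zeta> \<bullet> ?w t) \<le> ((norm x)\<^sup>2 + E + ?G \<zeta>) / 4 + k * ?F \<zeta>" .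
      moreover have "(\<Sum>t\<in>{\<tau>..N}. stage S (?w t) (\<zeta> ! t)) = E / 2 - (\<Sum>t\<in>{\<tau>..N}. source t \<zeta> \<bullet> ?w t)"
        by (simp add: stage_eq_hess source_def E_def sum_subtractf sum_divide_distrib)
      ultimately show "- ((norm x)\<^sup>2 + ?G \<zeta>) / 4 - k * ?F \<zeta> \<le> (\<Sum>t\<in>{\<tau>..N}. stage S (?w t) (\<zeta> ! t))"
        using E by (simp add: field_simps)
    qed
  qed
qed

lemma admissible_exists:
  obtains w where "admissible \<tau> N a x w"
proof -
  define g :: "nat \<Rightarrow> 'xi list \<Rightarrow> real^'nx" where "g t b = (if t = \<tau> then x else dv S (b ! t))" for t b
  obtain v where v: "\<And>\<zeta>. fst (at_prefix v \<tau> \<zeta>) = at_prefix g \<tau> \<zeta>"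
    "\<And>\<zeta> t. \<tau> \<le> t \<Longrightarrow>
       fst (at_prefix v (Suc t) \<zeta>) = step S (\<zeta> ! Suc t) (at_prefix v t \<zeta>) + at_prefix g (Suc t) \<zeta>"
    using rollout_exists[of \<tau> g "\<lambda>_ _ _. 0" S] by metis
  \<comment> \<open>The rollout has state \<open>x\<close> at every prefix of time
    \<open>\<tau>\<close>; the patch covers a list \<open>a\<close> that is too long to be such a
    prefix.\<close>
  define w where "w t b = (if t = \<tau> \<and> b = a then (x, snd (v t b)) else v t b)" for t b
  have "w t (take (Suc t) \<zeta>) = v t (take (Suc t) \<zeta>)" for t \<zeta>
    using v(1)[of \<zeta>] by (auto simp: w_def g_def prod_eq_iff)
  then have "admissible \<tau> N a x w"
    unfolding admissible_def traj_def using v(2) by (auto simp: g_def) (simp add: w_def)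
  then show ?thesis by (rule that)
qed

text \<open>By the parallelogram identity and coercivity a minimising sequence is a Cauchy sequence
  at every node of the tree.\<close>

lemma minimiser_exists:
  assumes N: "\<tau> \<le> N" "N \<le> T" and ne: "paths \<tau> a \<noteq> {}"
  obtains w where "admissible \<tau> N a x w"
    "\<And>w'. admissible \<tau> N a x w' \<Longrightarrow> cost \<tau> N a w \<le> cost \<tau> N a w'"
proof -
  define m where "m = Inf (cost \<tau> N a ` {w. admissible \<tau> N a x w})"
  obtain c where c: "\<And>w. admissible \<tau> N a x w \<Longrightarrow> c \<le> cost \<tau> N a w"
    using cost_bounded_below[OF N] by blast
  have bdd: "bdd_below (cost \<tau> N a ` {w. admissible \<tau> N a x w})" using c by (auto simp: bdd_below_def)
  have nonempty: "cost \<tau> N a ` {w. admissible \<tau> N a x w} \<noteq> {}"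
    using admissible_exists[of \<tau> N a x] by blast
  have lower: "m \<le> cost \<tau> N a w" if "admissible \<tau> N a x w" for w
    unfolding m_def using bdd that by (intro cInf_lower) auto
  have "\<exists>w. admissible \<tau> N a x w \<and> cost \<tau> N a w < m + inverse (real (Suc n))" for n
    using cInf_lessD[OF nonempty, of "m + inverse (real (Suc n))"] by (auto simp: m_def)
  then obtain s where s: "\<And>n. admissible \<tau> N a x (s n)"
    and sc: "\<And>n. cost \<tau> N a (s n) < m + inverse (real (Suc n))" by metis
  have para: "energy \<tau> N a (\<lambda>t b. s j t b - s i t b) (\<lambda>t b. s j t b - s i t b)
      \<le> 4 * (inverse (real (Suc i)) + inverse (real (Suc j)))" for i j
  proof -
    let ?v = "\<lambda>t b. s j t b - s i t b"
    note v = admissible_diff[OF s[of j] s[of i]]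
    \<comment> \<open>The midpoint of \<open>s i\<close> and \<open>s j\<close> costs the average of
      their costs minus an eighth of the energy of the difference. Being at least \<open>m\<close>,
      it bounds that energy by four times the sum of the two excesses over \<open>m\<close>.\<close>
    have "m \<le> cost \<tau> N a (\<lambda>t b. s i t b + (1/2) *\<^sub>R ?v t b)"
      using v by (intro lower admissible_add[OF s]) auto
    moreover define D where "D = energy \<tau> N a (s i) ?v - load \<tau> N a source ?v"
    moreover define E where "E = energy \<tau> N a ?v ?v"
    ultimately have "m \<le> cost \<tau> N a (s i) + D / 2 + E / 8"
      by (simp add: cost_expand power2_eq_square)
    moreover have "cost \<tau> N a (s j) = cost \<tau> N a (s i) + D + E / 2"
      using cost_expand[of \<tau> N a "s i" 1 ?v] by (simp add: D_def E_def)
    ultimately have "E \<le> 4 * (inverse (real (Suc i)) + inverse (real (Suc j)))"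
      using sc[of i] sc[of j] by argo
    then show ?thesis by (simp only: E_def)
  qed
  have conv: "convergent (\<lambda>n. at_prefix (s n) t \<zeta>)" if \<zeta>: "\<zeta> \<in> paths \<tau> a" and t: "t \<in> {\<tau>..N}" for t \<zeta>
  proof (rule Cauchy_convergent, rule metric_CauchyI)
    fix e :: real assume e: "0 < e"
    define K where "K = 6 * L^4 * cc * 4"
    have K: "0 < K" using power_cc_ge_1(1) unfolding K_def by linarith
    have p: "0 < pmf P \<zeta>" using paths_D(1)[OF \<zeta>] by (simp add: pmf_positive)
    \<comment> \<open>One path enters the averaged bound with weight \<open>pmf P \<zeta>\<close>,
      which is positive; this is the loss in passing from the average to a node.\<close>
    obtain M where M: "inverse (real (Suc M)) < pmf P \<zeta> * e\<^sup>2 / (2 * K)"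
      using reals_Archimedean[of "pmf P \<zeta> * e\<^sup>2 / (2 * K)"] p e K by auto
    have "dist (at_prefix (s i) t \<zeta>) (at_prefix (s j) t \<zeta>) < e" if ij: "M \<le> i" "M \<le> j" for i j
    proof -
      let ?v = "\<lambda>t b. s j t b - s i t b"
      have "pmf P \<zeta> * (norm (at_prefix ?v t \<zeta>))\<^sup>2
        \<le> pmf P \<zeta> * (\<Sum>t\<in>{\<tau>..N}. (norm (at_prefix ?v t \<zeta>))\<^sup>2)"
        using t by (intro mult_left_mono member_le_sum) auto
      also have "\<dots> \<le> esum \<tau> a (\<lambda>\<zeta>. \<Sum>t\<in>{\<tau>..N}. (norm (at_prefix ?v t \<zeta>))\<^sup>2)"
        unfolding esum_def using \<zeta>
        by (intro member_le_sum[of \<zeta> _ "\<lambda>\<zeta>. pmf P \<zeta> * (\<Sum>t\<in>{\<tau>..N}. (norm (at_prefix ?v t \<zeta>))\<^sup>2)"])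
           (auto intro!: mult_nonneg_nonneg sum_nonneg)
      also have "\<dots> \<le> 6 * L^4 * cc * energy \<tau> N a ?v ?v"
        by (rule coercive[OF N admissible_diff[OF s[of j] s[of i]]])
      also have "\<dots> \<le> 6 * L^4 * cc * (4 * (inverse (real (Suc i)) + inverse (real (Suc j))))"
        using para[of j i] K by (intro mult_left_mono para) (auto simp: K_def)
      also have "\<dots> \<le> 6 * L^4 * cc * (4 * (inverse (real (Suc M)) + inverse (real (Suc M))))"
        using ij K by (intro mult_left_mono add_mono le_imp_inverse_le) (auto simp: K_def)
      also have "\<dots> = K * (2 * inverse (real (Suc M)))" by (simp add: K_def)
      also have "\<dots> < pmf P \<zeta> * e\<^sup>2"
        using M K by (simp add: field_simps)
      finally have "(norm (at_prefix ?v t \<zeta>))\<^sup>2 < e\<^sup>2" using p by simp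
      then show ?thesis using e by (simp add: dist_norm norm_minus_commute power_less_imp_less_base)
    qed
    then show "\<exists>M. \<forall>i\<ge>M. \<forall>j\<ge>M. dist (at_prefix (s i) t \<zeta>) (at_prefix (s j) t \<zeta>) < e" by blast
  qed
  \<comment> \<open>The limit is taken node by node; where no path through \<open>a\<close> passes,
    or outside \<open>{\<tau>..N}\<close>, its value is unspecified.\<close>
  define w where "w t b = lim (\<lambda>n. s n t b)" for t b
  have lim: "(\<lambda>n. at_prefix (s n) t \<zeta>) \<longlonglongrightarrow> at_prefix w t \<zeta>" if "\<zeta> \<in> paths \<tau> a" "t \<in> {\<tau>..N}" for t \<zeta>
    using conv[OF that] by (simp add: w_def convergent_LIMSEQ_iff)
  have mv: "(\<lambda>n. M *v f n) \<longlonglongrightarrow> M *v y" if "f \<longlonglongrightarrow> y"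
    for M :: "real^'p::finite^'q::finite" and f y
    using bounded_linear.tendsto[OF matrix_vector_mul_bounded_linear that] .
  have adm: "admissible \<tau> N a x w"
    unfolding admissible_def traj_def
  proof (intro conjI ballI)
    obtain \<zeta> where \<zeta>: "\<zeta> \<in> paths \<tau> a" using ne by auto
    have "(\<lambda>n. fst (s n \<tau> a)) \<longlonglongrightarrow> fst (w \<tau> a)"
      using lim[OF \<zeta>, of \<tau>] N paths_D(2)[OF \<zeta>] by (auto intro: tendsto_fst)
    then show "fst (w \<tau> a) = x"
      using s by (simp add: admissible_def LIMSEQ_const_iff)
  next
    fix \<zeta> t assume \<zeta>: "\<zeta> \<in> paths \<tau> a" and t: "t \<in> {\<tau>..<N}"
    have "(\<lambda>n. fst (at_prefix (s n) (Suc t) \<zeta>)) \<longlonglongrightarrow> fst (at_prefix w (Suc t) \<zeta>)"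
      using lim[OF \<zeta>, of "Suc t"] t by (auto intro!: tendsto_fst)
    moreover have "(\<lambda>n. step S (\<zeta> ! Suc t) (at_prefix (s n) t \<zeta>) + dv S (take (Suc (Suc t)) \<zeta> ! Suc t))
        \<longlonglongrightarrow> step S (\<zeta> ! Suc t) (at_prefix w t \<zeta>) + dv S (take (Suc (Suc t)) \<zeta> ! Suc t)"
      unfolding step_def using t
      by (intro tendsto_add tendsto_const mv tendsto_fst tendsto_snd lim[OF \<zeta>]) auto
    moreover have "fst (at_prefix (s n) (Suc t) \<zeta>)
        = step S (\<zeta> ! Suc t) (at_prefix (s n) t \<zeta>) + dv S (take (Suc (Suc t)) \<zeta> ! Suc t)" for n
      using s[of n] trajD[OF _ \<zeta>, of N "\<lambda>t b. dv S (b ! t)" "s n" t] t by (auto simp: admissible_def)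
    ultimately show "fst (at_prefix w (Suc t) \<zeta>)
        = step S (\<zeta> ! Suc t) (at_prefix w t \<zeta>) + dv S (take (Suc (Suc t)) \<zeta> ! Suc t)"
      by (simp add: LIMSEQ_unique)
  qed
  have "(\<lambda>n. cost \<tau> N a (s n)) \<longlonglongrightarrow> cost \<tau> N a w"
    unfolding cost_def esum_def stage_def
    by (intro tendsto_sum tendsto_add tendsto_diff tendsto_mult tendsto_const tendsto_inner mv
        tendsto_fst tendsto_snd lim) auto
  moreover have "(\<lambda>n. m + inverse (real (Suc n))) \<longlonglongrightarrow> m + 0"
    by (intro tendsto_add tendsto_const LIMSEQ_inverse_real_of_nat)
  ultimately have "cost \<tau> N a w \<le> m"
    using sc by (intro LIMSEQ_le[where X="\<lambda>n. cost \<tau> N a (s n)" and Y="\<lambda>n. m + inverse (real (Suc n))"])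
      (auto intro: less_imp_le)
  then show ?thesis using that[OF adm] lower by force
qed

section \<open>Weighted stability of stationary trajectories\<close>

text \<open>The detectability constant \<open>6 * L^4 * cc\<close> times the factor
  \<open>181 * L^5 * cc\<close> from the energy bound gives 1086, rounded up to 1100.\<close>

definition cM :: real where "cM = 1100 * L^9 * cc\<^sup>2"

text \<open>The test direction is the trajectory itself multiplied by the slowly varying weight
  \<open>\<theta> ^ t\<close>, with the resulting defect in the dynamics absorbed by a stabilised response.\<close>

lemma weighted_stationary_bound:
  assumes N: "\<tau> \<le> N" "N \<le> T" and traj: "traj \<tau> N a d w" and stat: "stationary \<tau> N a F w"
    and \<theta>: "0 < \<theta>" "\<theta> \<le> 1" "1 - \<theta> \<le> 1 / (40 * L^5 * cc)"
  shows "esum \<tau> a (\<lambda>\<zeta>. \<Sum>t\<in>{\<tau>..N}. \<theta> ^ t * (norm (at_prefix w t \<zeta>))\<^sup>2)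
    \<le> cM * esum \<tau> a (\<lambda>\<zeta>. \<theta> ^ \<tau> * (norm (fst (at_prefix w \<tau> \<zeta>)))\<^sup>2
        + (\<Sum>t\<in>{\<tau>..N}. \<theta> ^ t * ((norm (F t \<zeta>))\<^sup>2 + (norm (at_prefix d t \<zeta>))\<^sup>2)))"
proof -
  let ?b = "1 - \<alpha>"
  define k where "k = 6 * L^4 * cc"
  have k: "0 < k" using power_cc_ge_1(1) unfolding k_def by linarith
  have L: "1 \<le> L" and b: "0 < ?b" "?b < 1" using params by auto
  have L45: "L^4 \<le> L^5" "1 \<le> L^5" using L by (auto intro: power_increasing)
  have c45: "L^4 * cc \<le> L^5 * cc" "1 \<le> L^5 * cc" "L^5 / ?b\<^sup>2 \<le> L^5 * cc"
    using L L45 cc_ge(1) power_cc_ge_1(2)[of 5] mult_left_mono[OF cc_ge(4), of "L^5"]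
    by (auto intro: mult_right_mono)
  \<comment> \<open>This prepares the weight \<open>1 / \<theta>\<close>: it keeps
    \<open>1 - \<alpha> * (1 / \<theta>)\<close> above half of \<open>1 - \<alpha>\<close>, and the
    square of \<open>1 / \<theta>\<close> at most 4.\<close>
  have \<theta>b: "1 - \<theta> \<le> ?b / 2" "1 / 2 \<le> \<theta>"
  proof -
    have "1 * cc \<le> L^5 * cc" using L45(2) cc_ge(1) by (intro mult_right_mono) auto
    then have "2 * cc \<le> 40 * L^5 * cc" using cc_ge(1) by linarith
    then have "1 / (40 * L^5 * cc) \<le> 1 / (2 * cc)"
      using cc_ge(1) L by (intro divide_left_mono mult_pos_pos) auto
    moreover have "1 / cc \<le> ?b" using cc_ge(1,3) b by (simp add: field_simps)
    ultimately show "1 - \<theta> \<le> ?b / 2" using \<theta>(3) by (simp add: field_simps)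
    then show "1 / 2 \<le> \<theta>" using b by (simp add: field_simps)
  qed
  \<comment> \<open>Here the number 40 is decided: the drift caused by the varying weight may take
    an eighth of the energy, and \<open>32 * 6 / 40\<^sup>2\<close> is just below
    \<open>1 / 8\<close>.\<close>
  have small: "(32 * L^5 / ?b\<^sup>2) * (1 - \<theta>)\<^sup>2 * k \<le> 1 / 8"
  proof -
    have "(1 - \<theta>)\<^sup>2 \<le> (1 / (40 * L^5 * cc))\<^sup>2" using \<theta> by (intro power_mono) auto
    then have "(32 * L^5 / ?b\<^sup>2) * (1 - \<theta>)\<^sup>2 * k \<le> (32 * (L^5 * cc)) * (1 / (40 * L^5 * cc))\<^sup>2 * (6 * (L^5 * cc))"
      using k c45 cc_ge(1) L45 by (intro mult_mono) (auto simp: k_def)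
    also have "\<dots> = 192 / 1600"
      using c45 L45 cc_ge(1) L by (simp add: power2_eq_square field_simps)
    finally show ?thesis by simp
  qed
  \<comment> \<open>For \<open>t > \<tau>\<close> this is the defect of the weighted trajectory:
    \<open>\<theta> ^ t\<close> times the state minus the step from
    \<open>\<theta> ^ (t - 1) *\<^sub>R w\<close>. At \<open>\<tau>\<close> it is the weighted
    initial state. The response \<open>v\<close> to \<open>g\<close> has the same defect and initial
    state, so \<open>y\<close> is a legitimate test direction.\<close>
  define g where "g t b = (if t = \<tau> then \<theta> ^ \<tau> *\<^sub>R fst (w \<tau> b)
     else \<theta> ^ (t - 1) *\<^sub>R (d t b - (1 - \<theta>) *\<^sub>R fst (w t b)))" for t b
  obtain v where v: "\<And>\<zeta>. fst (at_prefix v \<tau> \<zeta>) = at_prefix g \<tau> \<zeta>"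
    "\<And>\<zeta> t. \<tau> \<le> t \<Longrightarrow>
       fst (at_prefix v (Suc t) \<zeta>) = step S (\<zeta> ! Suc t) (at_prefix v t \<zeta>) + at_prefix g (Suc t) \<zeta>"
    "\<And>\<zeta> t. \<zeta> \<in> set_pmf P \<Longrightarrow> t \<le> T \<Longrightarrow>
       norm (snd (at_prefix v t \<zeta>)) \<le> L * norm (fst (at_prefix v t \<zeta>))"
    "\<And>\<zeta> \<omega> N. \<zeta> \<in> set_pmf P \<Longrightarrow> 0 < \<omega> \<Longrightarrow> \<alpha> * \<omega> < 1 \<Longrightarrow> N \<le> T \<Longrightarrow>
       (\<Sum>t\<in>{\<tau>..N}. \<omega> ^ t * (norm (fst (at_prefix v t \<zeta>)))\<^sup>2)
         \<le> (L\<^sup>2 / ((1 - \<alpha>) * (1 - \<alpha> * \<omega>))) * (\<Sum>t\<in>{\<tau>..N}. \<omega> ^ t * (norm (at_prefix g t \<zeta>))\<^sup>2)"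
    by (rule stabilised_response[of \<tau> g]) (rule that)
  define y where "y t b = \<theta> ^ t *\<^sub>R w t b - v t b" for t b
  define E where "E \<zeta> = (\<Sum>t\<in>{\<tau>..N}. \<theta> ^ t * hess S (\<zeta> ! t) (at_prefix w t \<zeta>) (at_prefix w t \<zeta>))" for \<zeta>
  define X where "X \<zeta> = (\<Sum>t\<in>{\<tau>..N}. \<theta> ^ t * (norm (at_prefix w t \<zeta>))\<^sup>2)" for \<zeta>
  define I where "I \<zeta> = \<theta> ^ \<tau> * (norm (fst (at_prefix w \<tau> \<zeta>)))\<^sup>2" for \<zeta>
  define G where "G \<zeta> = (\<Sum>t\<in>{\<tau>..N}. \<theta> ^ t * ((norm (F t \<zeta>))\<^sup>2 + (norm (at_prefix d t \<zeta>))\<^sup>2))" for \<zeta>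
  define Hv where "Hv \<zeta> = (\<Sum>t\<in>{\<tau>..N}. hess S (\<zeta> ! t) (at_prefix w t \<zeta>) (at_prefix v t \<zeta>))" for \<zeta>
  define Fy where "Fy \<zeta> = (\<Sum>t\<in>{\<tau>..N}. F t \<zeta> \<bullet> at_prefix y t \<zeta>)" for \<zeta>
  \<comment> \<open>The forcing \<open>g\<close> carries the weight
    \<open>\<theta> ^ (t - 1)\<close>, so its square against \<open>(1 / \<theta>) ^ t\<close> is
    again of order \<open>\<theta> ^ t\<close>. This dual weight is also the one that
    \<open>hess_young\<close> assigns to \<open>v\<close> in the pairing with
    \<open>w\<close>.\<close>
  define Z where "Z \<zeta> = (\<Sum>t\<in>{\<tau>..N}. (1 / \<theta>) ^ t * (norm (fst (at_prefix v t \<zeta>)))\<^sup>2)" for \<zeta>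
  have XE: "X \<zeta> \<le> k * (I \<zeta> + E \<zeta> + G \<zeta>)" if \<zeta>: "\<zeta> \<in> paths \<tau> a" for \<zeta>
  proof -
    have "X \<zeta> \<le> k * (I \<zeta> + E \<zeta> + (\<Sum>t\<in>{\<tau>..N}. \<theta> ^ t * (norm (at_prefix d t \<zeta>))\<^sup>2))"
      unfolding X_def k_def I_def E_def
      using trajD[OF traj \<zeta>] by (intro detectability_bound[OF paths_D(1)[OF \<zeta>] N \<theta>(1,2)]) auto
    also have "\<dots> \<le> k * (I \<zeta> + E \<zeta> + G \<zeta>)"
      unfolding G_def using k \<theta> by (intro mult_left_mono add_left_mono sum_mono) auto
    finally show ?thesis .
  qed
  \<comment> \<open>The last bracket has no sign on a single path but averages to zero by
    stationarity. The share \<open>3/4\<close> of the energy is \<open>1/2\<close> from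
    \<open>Hv\<close>, \<open>1/8\<close> from the two terms in \<open>Z\<close> and
    \<open>1/8\<close> from \<open>X / (8 * k)\<close>.\<close>
  have path: "E \<zeta> \<le> (3/4) * E \<zeta> + 45 * (L^5 * cc) * (I \<zeta> + G \<zeta>) + (E \<zeta> - Hv \<zeta> - Fy \<zeta>)"
    if \<zeta>: "\<zeta> \<in> paths \<tau> a" for \<zeta>
  proof -
    note \<zeta>P = paths_D(1)[OF \<zeta>]
    let ?w = "\<lambda>t. at_prefix w t \<zeta>" and ?v = "\<lambda>t. at_prefix v t \<zeta>"
    have IG: "0 \<le> I \<zeta>" "0 \<le> G \<zeta>" using \<theta> by (auto simp: I_def G_def intro!: sum_nonneg)
    have vv: "(norm (?v t))\<^sup>2 \<le> 2 * L\<^sup>2 * (norm (fst (?v t)))\<^sup>2" if "t \<le> T" for t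
    proof -
      have "(norm (snd (?v t)))\<^sup>2 \<le> (L * norm (fst (?v t)))\<^sup>2"
        using v(3)[OF \<zeta>P that] by (intro power_mono) auto
      moreover have "(norm (fst (?v t)))\<^sup>2 \<le> L\<^sup>2 * (norm (fst (?v t)))\<^sup>2"
        using L by (simp add: mult_left_le_one_le mult_le_cancel_right1)
      ultimately show ?thesis by (simp add: norm_pair_sq power_mult_distrib)
    qed
    have Hv: "Hv \<zeta> \<le> E \<zeta> / 2 + L^3 * Z \<zeta>"
    proof -
      have "hess S (\<zeta> ! t) (?w t) (?v t)
          \<le> \<theta> ^ t * hess S (\<zeta> ! t) (?w t) (?w t) / 2 + L^3 * ((1 / \<theta>) ^ t * (norm (fst (?v t)))\<^sup>2)"
        if t: "t \<in> {\<tau>..N}" for t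
      proof -
        have tT: "t \<le> T" using t N by auto
        have "hess S (\<zeta> ! t) (?v t) (?v t) \<le> L * (2 * L\<^sup>2 * (norm (fst (?v t)))\<^sup>2)"
          using hess_le[OF \<zeta>P tT, of "?v t"] vv[OF tT] L mult_left_mono[OF vv[OF tT], of L] by linarith
        then have "hess S (\<zeta> ! t) (?v t) (?v t) / (2 * \<theta> ^ t) \<le> L * (2 * L\<^sup>2 * (norm (fst (?v t)))\<^sup>2) / (2 * \<theta> ^ t)"
          using \<theta> by (intro divide_right_mono) auto
        also have "\<dots> = L^3 * ((1 / \<theta>) ^ t * (norm (fst (?v t)))\<^sup>2)"
          using \<theta> by (simp add: power_divide power2_eq_square power3_eq_cube)
        finally show ?thesis
          using hess_young[OF \<zeta>P tT, of "\<theta> ^ t" "?w t" "?v t"] \<theta> by simp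
      qed
      then have "Hv \<zeta> \<le> (\<Sum>t\<in>{\<tau>..N}. \<theta> ^ t * hess S (\<zeta> ! t) (?w t) (?w t) / 2
          + L^3 * ((1 / \<theta>) ^ t * (norm (fst (?v t)))\<^sup>2))"
        unfolding Hv_def by (rule sum_mono)
      then show ?thesis
        by (simp add: E_def Z_def sum.distrib sum_divide_distrib sum_distrib_left)
    qed
    have Fy: "Fy \<zeta> \<le> X \<zeta> / (8 * k) + (2 * k + 1/2) * G \<zeta> + L^3 * Z \<zeta>"
    proof -
      have "F t \<zeta> \<bullet> at_prefix y t \<zeta> \<le> \<theta> ^ t * (norm (?w t))\<^sup>2 / (8 * k)
          + (2 * k + 1/2) * (\<theta> ^ t * ((norm (F t \<zeta>))\<^sup>2 + (norm (at_prefix d t \<zeta>))\<^sup>2))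
          + L^3 * ((1 / \<theta>) ^ t * (norm (fst (?v t)))\<^sup>2)"
        if t: "t \<in> {\<tau>..N}" for t
      proof -
        have tT: "t \<le> T" using t N by auto
        have \<theta>t: "0 < \<theta> ^ t" using \<theta> by simp
        have "F t \<zeta> \<bullet> ?w t \<le> (norm (?w t))\<^sup>2 / (4 * (2 * k)) + 2 * k * (norm (F t \<zeta>))\<^sup>2"
          using young_product[of "2 * k" "norm (?w t)" "norm (F t \<zeta>)"] k
            norm_cauchy_schwarz[of "F t \<zeta>" "?w t"] by (simp add: mult.commute)
        then have "\<theta> ^ t * (F t \<zeta> \<bullet> ?w t) \<le> \<theta> ^ t * ((norm (?w t))\<^sup>2 / (8 * k) + 2 * k * (norm (F t \<zeta>))\<^sup>2)"
          using \<theta>t by (intro mult_left_mono) auto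
        moreover have "- (F t \<zeta> \<bullet> ?v t) \<le> L^3 * ((1 / \<theta>) ^ t * (norm (fst (?v t)))\<^sup>2) + (1/2) * (\<theta> ^ t * (norm (F t \<zeta>))\<^sup>2)"
        proof -
          have "- (F t \<zeta> \<bullet> ?v t) \<le> norm (?v t) * norm (F t \<zeta>)"
            using norm_cauchy_schwarz[of "- F t \<zeta>" "?v t"] by (simp add: mult.commute)
          also have "\<dots> \<le> (norm (?v t))\<^sup>2 / (4 * (\<theta> ^ t / 2)) + (\<theta> ^ t / 2) * (norm (F t \<zeta>))\<^sup>2"
            using \<theta>t by (intro young_product) auto
          also have "(norm (?v t))\<^sup>2 / (4 * (\<theta> ^ t / 2)) \<le> (2 * L\<^sup>2 * (norm (fst (?v t)))\<^sup>2) / (4 * (\<theta> ^ t / 2))"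
            using \<theta>t vv[OF tT] by (intro divide_right_mono) auto
          also have "\<dots> = L\<^sup>2 * ((1 / \<theta>) ^ t * (norm (fst (?v t)))\<^sup>2)"
            using \<theta>t by (simp add: power_divide)
          also have "\<dots> \<le> L^3 * ((1 / \<theta>) ^ t * (norm (fst (?v t)))\<^sup>2)"
            using L \<theta> by (intro mult_right_mono power_increasing) auto
          finally show ?thesis by simp
        qed
        moreover have "0 \<le> (2 * k + 1/2) * (\<theta> ^ t * (norm (at_prefix d t \<zeta>))\<^sup>2)"
          using k \<theta>t by simp
        moreover have "F t \<zeta> \<bullet> at_prefix y t \<zeta> = \<theta> ^ t * (F t \<zeta> \<bullet> ?w t) - F t \<zeta> \<bullet> ?v t"
          by (simp add: y_def inner_diff_right)
        ultimately show ?thesis by (simp add: algebra_simps)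
      qed
      then have "Fy \<zeta> \<le> (\<Sum>t\<in>{\<tau>..N}. \<theta> ^ t * (norm (?w t))\<^sup>2 / (8 * k)
          + (2 * k + 1/2) * (\<theta> ^ t * ((norm (F t \<zeta>))\<^sup>2 + (norm (at_prefix d t \<zeta>))\<^sup>2))
          + L^3 * ((1 / \<theta>) ^ t * (norm (fst (?v t)))\<^sup>2))"
        unfolding Fy_def by (rule sum_mono)
      then show ?thesis
        unfolding X_def Z_def G_def sum.distrib sum_divide_distrib sum_distrib_left by simp
    qed
    have Z: "Z \<zeta> \<le> (2 * L\<^sup>2 / ?b\<^sup>2) * (I \<zeta> + 8 * G \<zeta> + 8 * (1 - \<theta>)\<^sup>2 * X \<zeta>)"
    proof -
      have \<omega>: "\<alpha> * (1 / \<theta>) < 1" "?b / 2 \<le> 1 - \<alpha> * (1 / \<theta>)"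
      proof -
        have "(?b / 2) * \<theta> \<le> ?b / 2" using \<theta> b by (simp add: mult_left_le)
        also have "\<dots> \<le> \<theta> - \<alpha>" using \<theta>b(1) by (simp add: field_simps)
        also have "\<dots> = (1 - \<alpha> * (1 / \<theta>)) * \<theta>" using \<theta> by (simp add: field_simps)
        finally have "(?b / 2) * \<theta> \<le> (1 - \<alpha> * (1 / \<theta>)) * \<theta>" .
        then show "?b / 2 \<le> 1 - \<alpha> * (1 / \<theta>)" using \<theta> by (simp only: mult_le_cancel_right_pos)
        moreover have "0 < ?b / 2" using b by simp
        ultimately show "\<alpha> * (1 / \<theta>) < 1" by linarith
      qed
      have "Z \<zeta> \<le> (L\<^sup>2 / (?b * (1 - \<alpha> * (1 / \<theta>)))) * (\<Sum>t\<in>{\<tau>..N}. (1 / \<theta>) ^ t * (norm (at_prefix g t \<zeta>))\<^sup>2)"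
        unfolding Z_def using \<theta> \<omega> N by (intro v(4) \<zeta>P) auto
      also have "\<dots> \<le> (L\<^sup>2 / (?b * (?b / 2))) * (I \<zeta> + 8 * G \<zeta> + 8 * (1 - \<theta>)\<^sup>2 * X \<zeta>)"
      proof (rule mult_mono)
        show "L\<^sup>2 / (?b * (1 - \<alpha> * (1 / \<theta>))) \<le> L\<^sup>2 / (?b * (?b / 2))"
          using \<omega> b by (intro divide_left_mono mult_left_mono mult_pos_pos) auto
        have "(1 / \<theta>) ^ t * (norm (at_prefix g t \<zeta>))\<^sup>2 \<le> 8 * (\<theta> ^ t * (norm (at_prefix d t \<zeta>))\<^sup>2)
            + 8 * (1 - \<theta>)\<^sup>2 * (\<theta> ^ t * (norm (?w t))\<^sup>2)" if t: "t \<in> {Suc \<tau>..N}" for t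
        proof -
          obtain s where s: "t = Suc s" using t by (cases t) auto
          let ?q = "at_prefix d t \<zeta> - (1 - \<theta>) *\<^sub>R fst (?w t)"
          have "(1 / \<theta>) ^ t * (norm (at_prefix g t \<zeta>))\<^sup>2 = (\<theta> ^ t / \<theta>\<^sup>2) * (norm ?q)\<^sup>2"
            using t \<theta> by (simp add: g_def s power_mult_distrib power_divide power2_eq_square)
          also have "\<dots> \<le> (4 * \<theta> ^ t) * (2 * (norm (at_prefix d t \<zeta>))\<^sup>2 + 2 * (norm ((1 - \<theta>) *\<^sub>R fst (?w t)))\<^sup>2)"
          proof (intro mult_mono norm_diff_sq_le)
            have "(1/2)\<^sup>2 \<le> \<theta>\<^sup>2" using \<theta>b by (intro power_mono) auto
            then have "1 \<le> 4 * \<theta>\<^sup>2" by (simp add: power2_eq_square)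
            then have "\<theta> ^ t * 1 \<le> \<theta> ^ t * (4 * \<theta>\<^sup>2)" using \<theta> by (intro mult_left_mono) auto
            then show "\<theta> ^ t / \<theta>\<^sup>2 \<le> 4 * \<theta> ^ t" using \<theta> by (simp add: field_simps)
          qed (use \<theta> in auto)
          also have "\<dots> = 8 * (\<theta> ^ t * (norm (at_prefix d t \<zeta>))\<^sup>2) + 8 * (1 - \<theta>)\<^sup>2 * (\<theta> ^ t * (norm (fst (?w t)))\<^sup>2)"
            unfolding norm_scaleR power_mult_distrib power2_abs by (simp only: distrib_left ac_simps)
          also have "\<dots> \<le> 8 * (\<theta> ^ t * (norm (at_prefix d t \<zeta>))\<^sup>2) + 8 * (1 - \<theta>)\<^sup>2 * (\<theta> ^ t * (norm (?w t))\<^sup>2)"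
            using \<theta> by (intro add_left_mono mult_left_mono) (auto simp: norm_pair_sq[of "?w t"])
          finally show ?thesis .
        qed
        then have "(\<Sum>t\<in>{Suc \<tau>..N}. (1 / \<theta>) ^ t * (norm (at_prefix g t \<zeta>))\<^sup>2)
            \<le> (\<Sum>t\<in>{Suc \<tau>..N}. 8 * (\<theta> ^ t * (norm (at_prefix d t \<zeta>))\<^sup>2) + 8 * (1 - \<theta>)\<^sup>2 * (\<theta> ^ t * (norm (?w t))\<^sup>2))"
          by (intro sum_mono) auto
        also have "\<dots> = 8 * (\<Sum>t\<in>{Suc \<tau>..N}. \<theta> ^ t * (norm (at_prefix d t \<zeta>))\<^sup>2)
            + 8 * (1 - \<theta>)\<^sup>2 * (\<Sum>t\<in>{Suc \<tau>..N}. \<theta> ^ t * (norm (?w t))\<^sup>2)"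
          by (simp only: sum.distrib sum_distrib_left[symmetric])
        also have "\<dots> \<le> 8 * G \<zeta> + 8 * (1 - \<theta>)\<^sup>2 * X \<zeta>"
        proof (intro add_mono mult_left_mono)
          show "(\<Sum>t\<in>{Suc \<tau>..N}. \<theta> ^ t * (norm (?w t))\<^sup>2) \<le> X \<zeta>"
            unfolding X_def using \<theta> by (intro sum_mono2) auto
          have "(\<Sum>t\<in>{Suc \<tau>..N}. \<theta> ^ t * (norm (at_prefix d t \<zeta>))\<^sup>2)
              \<le> (\<Sum>t\<in>{Suc \<tau>..N}. \<theta> ^ t * ((norm (F t \<zeta>))\<^sup>2 + (norm (at_prefix d t \<zeta>))\<^sup>2))"
            using \<theta> by (intro sum_mono mult_left_mono) auto
          also have "\<dots> \<le> G \<zeta>" unfolding G_def using \<theta> by (intro sum_mono2) auto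
          finally show "(\<Sum>t\<in>{Suc \<tau>..N}. \<theta> ^ t * (norm (at_prefix d t \<zeta>))\<^sup>2) \<le> G \<zeta>" .
        qed auto
        finally have "(\<Sum>t\<in>{Suc \<tau>..N}. (1 / \<theta>) ^ t * (norm (at_prefix g t \<zeta>))\<^sup>2)
            \<le> 8 * G \<zeta> + 8 * (1 - \<theta>)\<^sup>2 * X \<zeta>" .
        moreover have "(1 / \<theta>) ^ \<tau> * (norm (at_prefix g \<tau> \<zeta>))\<^sup>2 = I \<zeta>"
          using \<theta> by (simp add: g_def I_def power_mult_distrib power_divide power2_eq_square)
        ultimately show "(\<Sum>t\<in>{\<tau>..N}. (1 / \<theta>) ^ t * (norm (at_prefix g t \<zeta>))\<^sup>2)
            \<le> I \<zeta> + 8 * G \<zeta> + 8 * (1 - \<theta>)\<^sup>2 * X \<zeta>"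
          using N by (subst sum.atLeast_Suc_atMost) auto
      qed (use b \<theta> in \<open>auto intro!: sum_nonneg\<close>)
      finally show ?thesis by (simp add: power2_eq_square mult.commute[of "L * L" 2])
    qed
    define A where "A = L^5 / ?b\<^sup>2"
    have A: "0 \<le> A" "A \<le> L^5 * cc" using c45 L by (auto simp: A_def)
    have eq: "2 * L^3 * ((2 * L\<^sup>2 / B) * (i + 8 * g + 8 * r * x))
        = 4 * (L^5 / B) * i + 32 * (L^5 / B) * g + (32 * (L^5 / B) * r) * x" for i g r x B
      by (simp add: eval_nat_numeral algebra_simps add_divide_distrib)
    have "2 * L^3 * Z \<zeta> \<le> 2 * L^3 * ((2 * L\<^sup>2 / ?b\<^sup>2) * (I \<zeta> + 8 * G \<zeta> + 8 * (1 - \<theta>)\<^sup>2 * X \<zeta>))"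
      using Z L by (intro mult_left_mono) auto
    also have "\<dots> = 4 * A * I \<zeta> + 32 * A * G \<zeta> + (32 * A * (1 - \<theta>)\<^sup>2) * X \<zeta>"
      by (simp only: A_def eq)
    also have "(32 * A * (1 - \<theta>)\<^sup>2) * X \<zeta> \<le> (32 * A * (1 - \<theta>)\<^sup>2) * (k * (I \<zeta> + E \<zeta> + G \<zeta>))"
      using A by (intro mult_left_mono XE \<zeta>) auto
    also have "\<dots> \<le> (1 / 8) * (I \<zeta> + E \<zeta> + G \<zeta>)"
    proof -
      have "0 \<le> E \<zeta>" unfolding E_def using \<theta> N
        by (intro sum_nonneg mult_nonneg_nonneg hess_nonneg[OF \<zeta>P]) auto
      then have "(32 * A * (1 - \<theta>)\<^sup>2 * k) * (I \<zeta> + E \<zeta> + G \<zeta>) \<le> (1 / 8) * (I \<zeta> + E \<zeta> + G \<zeta>)"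
        using small IG by (intro mult_right_mono) (auto simp: A_def)
      then show ?thesis by (simp add: mult.assoc)
    qed
    finally have LZ: "2 * L^3 * Z \<zeta> \<le> 4 * A * I \<zeta> + 32 * A * G \<zeta> + (1 / 8) * (I \<zeta> + E \<zeta> + G \<zeta>)" by simp
    have Xk: "X \<zeta> / (8 * k) \<le> (1 / 8) * (I \<zeta> + E \<zeta> + G \<zeta>)"
      using XE[OF \<zeta>] k by (simp add: field_simps)
    have "4 * A * I \<zeta> + (1 / 4) * I \<zeta> \<le> 45 * (L^5 * cc) * I \<zeta>"
    proof -
      have "4 * A + 1 / 4 \<le> 45 * (L^5 * cc)" using A c45 by linarith
      then show ?thesis using mult_right_mono[of "4 * A + 1/4" _ "I \<zeta>"] IG by (simp add: distrib_right)
    qed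
    moreover have "32 * A * G \<zeta> + (1 / 4) * G \<zeta> + (2 * k + 1 / 2) * G \<zeta> \<le> 45 * (L^5 * cc) * G \<zeta>"
    proof -
      have "32 * A + 1 / 4 + (2 * k + 1 / 2) \<le> 45 * (L^5 * cc)" using A c45 unfolding k_def by linarith
      then show ?thesis using mult_right_mono[of "32 * A + 1 / 4 + (2 * k + 1 / 2)" _ "G \<zeta>"] IG
        by (simp add: distrib_right)
    qed
    moreover have "45 * (L^5 * cc) * (I \<zeta> + G \<zeta>) = 45 * (L^5 * cc) * I \<zeta> + 45 * (L^5 * cc) * G \<zeta>"
      by (simp add: distrib_left)
    ultimately show ?thesis using Hv Fy LZ Xk by argo
  qed
  have yt: "traj \<tau> N a (\<lambda>_ _. 0) y"
    unfolding traj_def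
  proof (intro ballI)
    fix \<zeta> t assume \<zeta>: "\<zeta> \<in> paths \<tau> a" and t: "t \<in> {\<tau>..<N}"
    have 1: "fst (at_prefix w (Suc t) \<zeta>) = step S (\<zeta> ! Suc t) (at_prefix w t \<zeta>) + at_prefix d (Suc t) \<zeta>"
      using trajD[OF traj \<zeta>] t by auto
    have 2: "at_prefix g (Suc t) \<zeta> = \<theta> ^ t *\<^sub>R (at_prefix d (Suc t) \<zeta> - (1 - \<theta>) *\<^sub>R fst (at_prefix w (Suc t) \<zeta>))"
      using t by (simp add: g_def)
    have "fst (at_prefix y (Suc t) \<zeta>)
       = \<theta> ^ Suc t *\<^sub>R fst (at_prefix w (Suc t) \<zeta>) - (step S (\<zeta> ! Suc t) (at_prefix v t \<zeta>) + at_prefix g (Suc t) \<zeta>)"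
      using t v(2)[of t \<zeta>] by (simp add: y_def)
    also have "\<dots> = \<theta> ^ t *\<^sub>R (fst (at_prefix w (Suc t) \<zeta>) - at_prefix d (Suc t) \<zeta>) - step S (\<zeta> ! Suc t) (at_prefix v t \<zeta>)"
      unfolding 2 by (simp add: algebra_simps)
    also have "\<dots> = step S (\<zeta> ! Suc t) (at_prefix y t \<zeta>)"
      unfolding 1 by (simp add: y_def step_linear)
    finally show "fst (at_prefix y (Suc t) \<zeta>) = step S (\<zeta> ! Suc t) (at_prefix y t \<zeta>) + 0" by simp
  qed
  \<comment> \<open>Testing with \<open>y\<close>: its part \<open>\<theta> ^ t *\<^sub>R w\<close>
    produces the weighted energy \<open>E\<close>, its correction \<open>v\<close> produces
    \<open>Hv\<close>.\<close>
  have key: "esum \<tau> a E = esum \<tau> a (\<lambda>\<zeta>. Hv \<zeta> + Fy \<zeta>)" if ne: "paths \<tau> a \<noteq> {}"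
  proof -
    obtain \<zeta> where "\<zeta> \<in> paths \<tau> a" using ne by auto
    then have "fst (y \<tau> a) = 0" using v(1)[of \<zeta>] paths_D(2)[of \<zeta>] by (auto simp: y_def g_def)
    then have "energy \<tau> N a w y = load \<tau> N a F y" using stat yt by (simp add: stationary_def)
    moreover have "energy \<tau> N a w y = esum \<tau> a (\<lambda>\<zeta>. E \<zeta> - Hv \<zeta>)"
      unfolding energy_def E_def Hv_def
      by (intro esum_cong) (simp add: y_def hess_linear sum_subtractf)
    ultimately show ?thesis by (simp add: esum_linear load_def Fy_def)
  qed
  show ?thesis
  proof (cases "paths \<tau> a = {}")
    case True
    then show ?thesis by (simp add: esum_def)
  next
    case False
    define J where "J = esum \<tau> a (\<lambda>\<zeta>. I \<zeta> + G \<zeta>)"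
    have J: "0 \<le> J" unfolding J_def I_def G_def using \<theta>
      by (intro esum_nonneg add_nonneg_nonneg sum_nonneg) auto
    have "esum \<tau> a E \<le> esum \<tau> a (\<lambda>\<zeta>. (3/4) * E \<zeta> + 45 * (L^5 * cc) * (I \<zeta> + G \<zeta>) + (E \<zeta> - (Hv \<zeta> + Fy \<zeta>)))"
      using path by (intro esum_mono) (auto simp: algebra_simps)
    also have "\<dots> = (3/4) * esum \<tau> a E + 45 * (L^5 * cc) * J + (esum \<tau> a E - esum \<tau> a (\<lambda>\<zeta>. Hv \<zeta> + Fy \<zeta>))"
      unfolding J_def by (simp only: esum_linear)
    \<comment> \<open>After cancellation a quarter of the energy stays on the left, hence
      \<open>180 = 4 * 45\<close>.\<close>
    finally have EJ: "esum \<tau> a E \<le> 180 * (L^5 * cc) * J" using key[OF False] by simp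
    have "esum \<tau> a X \<le> esum \<tau> a (\<lambda>\<zeta>. k * (E \<zeta> + (I \<zeta> + G \<zeta>)))"
      using XE by (intro esum_mono) (auto simp: algebra_simps)
    also have "\<dots> = k * (esum \<tau> a E + J)" unfolding J_def by (simp only: esum_linear)
    also have "\<dots> \<le> k * (181 * (L^5 * cc) * J)"
      using EJ J k mult_right_mono[of 1 "L^5 * cc" J] c45 by (intro mult_left_mono) auto
    also have "\<dots> = 1086 * L^9 * cc\<^sup>2 * J"
      by (simp add: k_def eval_nat_numeral)
    also have "\<dots> \<le> cM * J"
      unfolding cM_def using J L by (intro mult_right_mono) auto
    finally show ?thesis unfolding X_def J_def I_def G_def .
  qed
qed

section \<open>Truncated problems and the closed loop\<close>

lemma tr_feasible_iff:
  assumes "\<tau> \<le> T"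
  shows "tr_feasible S P T \<tau> W a wp w \<longleftrightarrow> admissible \<tau> (min (\<tau> + W) T) a (dyn S wp (last a)) w"
proof -
  have "(\<forall>t\<in>{Suc \<tau>..N}. fst (w t (take (Suc t) \<zeta>)) = dyn S (w (t - 1) (take t \<zeta>)) (\<zeta> ! t))
    \<longleftrightarrow> (\<forall>t\<in>{\<tau>..<N}. fst (at_prefix w (Suc t) \<zeta>)
        = step S (\<zeta> ! Suc t) (at_prefix w t \<zeta>) + dv S (take (Suc (Suc t)) \<zeta> ! Suc t))" for \<zeta> N
  proof
    assume *: "\<forall>t\<in>{Suc \<tau>..N}. fst (w t (take (Suc t) \<zeta>)) = dyn S (w (t - 1) (take t \<zeta>)) (\<zeta> ! t)"
    show "\<forall>t\<in>{\<tau>..<N}. fst (at_prefix w (Suc t) \<zeta>)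
        = step S (\<zeta> ! Suc t) (at_prefix w t \<zeta>) + dv S (take (Suc (Suc t)) \<zeta> ! Suc t)"
    proof
      fix t assume "t \<in> {\<tau>..<N}"
      then show "fst (at_prefix w (Suc t) \<zeta>)
        = step S (\<zeta> ! Suc t) (at_prefix w t \<zeta>) + dv S (take (Suc (Suc t)) \<zeta> ! Suc t)"
        using *[rule_format, of "Suc t"] by (simp add: dyn_eq_step)
    qed
  next
    assume *: "\<forall>t\<in>{\<tau>..<N}. fst (at_prefix w (Suc t) \<zeta>)
        = step S (\<zeta> ! Suc t) (at_prefix w t \<zeta>) + dv S (take (Suc (Suc t)) \<zeta> ! Suc t)"
    show "\<forall>t\<in>{Suc \<tau>..N}. fst (w t (take (Suc t) \<zeta>)) = dyn S (w (t - 1) (take t \<zeta>)) (\<zeta> ! t)"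
    proof
      fix t assume t: "t \<in> {Suc \<tau>..N}"
      then show "fst (w t (take (Suc t) \<zeta>)) = dyn S (w (t - 1) (take t \<zeta>)) (\<zeta> ! t)"
        using *[rule_format, of "t - 1"] by (cases t) (simp_all add: dyn_eq_step)
    qed
  qed
  then show ?thesis
    unfolding tr_feasible_def admissible_def traj_def paths_def by auto
qed

text \<open>Conditioning divides by a positive number that depends on the prefix only, so all
  comparisons can be made with unnormalised sums.\<close>

lemma expectation_prefix:
  assumes "paths \<tau> a \<noteq> {}"
  shows "measure_pmf.expectation (cond_pmf P {\<zeta>. take (Suc \<tau>) \<zeta> = a}) f = esum \<tau> a f / esum \<tau> a (\<lambda>_. 1)"
    and "0 < esum \<tau> a (\<lambda>_. 1)"
proof -
  let ?A = "{\<zeta>. take (Suc \<tau>) \<zeta> = a}"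
  have paths: "paths \<tau> a = set_pmf P \<inter> ?A" by (auto simp: paths_def)
  have ne: "set_pmf P \<inter> ?A \<noteq> {}" using assms paths by simp
  have meas: "measure (measure_pmf P) ?A = esum \<tau> a (\<lambda>_. 1)"
  proof -
    have "measure (measure_pmf P) ?A = measure (measure_pmf P) (?A \<inter> set_pmf P)"
      by (rule measure_Int_set_pmf[symmetric])
    also have "\<dots> = (\<Sum>\<zeta>\<in>?A \<inter> set_pmf P. pmf P \<zeta>)"
      using finite_paths by (intro measure_measure_pmf_finite) auto
    finally show ?thesis by (simp add: esum_def paths Int_commute)
  qed
  obtain \<zeta> where \<zeta>: "\<zeta> \<in> paths \<tau> a" using assms by auto
  have "0 < pmf P \<zeta>" using paths_D(1)[OF \<zeta>] by (simp add: pmf_positive)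
  also have "\<dots> \<le> esum \<tau> a (\<lambda>_. 1)"
    unfolding esum_def using \<zeta> member_le_sum[of \<zeta> "paths \<tau> a" "pmf P"] by simp
  finally show pos: "0 < esum \<tau> a (\<lambda>_. 1)" .
  have "measure_pmf.expectation (cond_pmf P ?A) f = (\<Sum>\<zeta>\<in>paths \<tau> a. pmf (cond_pmf P ?A) \<zeta> *\<^sub>R f \<zeta>)"
    using ne by (intro integral_measure_pmf) (auto simp: set_cond_pmf paths finite_paths)
  also have "\<dots> = (\<Sum>\<zeta>\<in>paths \<tau> a. (pmf P \<zeta> * f \<zeta>) / esum \<tau> a (\<lambda>_. 1))"
    by (intro sum.cong) (auto simp: pmf_cond[OF ne] meas paths)
  finally show "measure_pmf.expectation (cond_pmf P ?A) f = esum \<tau> a f / esum \<tau> a (\<lambda>_. 1)"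
    by (simp add: esum_def sum_divide_distrib)
qed

lemma tr_cost_eq:
  assumes "paths \<tau> a \<noteq> {}"
  shows "tr_cost S P T \<tau> W a w = cost \<tau> (min (\<tau> + W) T) a w / esum \<tau> a (\<lambda>_. 1)"
  unfolding tr_cost_def cost_def by (rule expectation_prefix(1)[OF assms])

text \<open>The predicate behind the choice operator is satisfiable by
  \<open>minimiser_exists\<close>, so whatever solution is chosen is a true minimiser.\<close>

lemma tr_solution_minimal:
  assumes \<tau>: "\<tau> \<le> T" and ne: "paths \<tau> a \<noteq> {}"
  shows "admissible \<tau> (min (\<tau> + W) T) a (dyn S wp (last a)) (tr_solution S P T \<tau> W a wp)"
    and "admissible \<tau> (min (\<tau> + W) T) a (dyn S wp (last a)) w' \<Longrightarrow>
      cost \<tau> (min (\<tau> + W) T) a (tr_solution S P T \<tau> W a wp) \<le> cost \<tau> (min (\<tau> + W) T) a w'"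
proof -
  let ?N = "min (\<tau> + W) T"
  let ?Q = "\<lambda>w. tr_feasible S P T \<tau> W a wp w \<and>
    (\<forall>w'. tr_feasible S P T \<tau> W a wp w' \<longrightarrow> tr_cost S P T \<tau> W a w \<le> tr_cost S P T \<tau> W a w')"
  have Q: "?Q w \<longleftrightarrow> admissible \<tau> ?N a (dyn S wp (last a)) w \<and>
    (\<forall>w'. admissible \<tau> ?N a (dyn S wp (last a)) w' \<longrightarrow> cost \<tau> ?N a w \<le> cost \<tau> ?N a w')" for w
    using expectation_prefix(2)[OF ne]
    by (simp add: tr_feasible_iff[OF \<tau>] tr_cost_eq[OF ne] divide_le_cancel)
  have "\<exists>w. ?Q w"
    unfolding Q using minimiser_exists[of \<tau> ?N a "dyn S wp (last a)"] \<tau> ne by (metis min.cobounded2 le_add1 min.boundedI)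
  then have "?Q (tr_solution S P T \<tau> W a wp)"
    unfolding tr_solution_def by (rule someI_ex)
  then show "admissible \<tau> ?N a (dyn S wp (last a)) (tr_solution S P T \<tau> W a wp)"
    "admissible \<tau> ?N a (dyn S wp (last a)) w' \<Longrightarrow>
      cost \<tau> ?N a (tr_solution S P T \<tau> W a wp) \<le> cost \<tau> ?N a w'"
    unfolding Q by auto
qed

section \<open>Error of a single truncated solve\<close>

definition noise :: "nat \<Rightarrow> 'xi list \<Rightarrow> real" where
  "noise t \<zeta> = (pnorm S (\<zeta> ! t))\<^sup>2"

lemma noise_eq: "noise t \<zeta> = (norm (source t \<zeta>))\<^sup>2 + (norm (dv S (\<zeta> ! t)))\<^sup>2"
  by (simp add: noise_def pnorm_def source_def norm_Pair)

lemma noise_nonneg: "0 \<le> noise t \<zeta>"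
  by (simp add: noise_def)

lemma cM_ge: "1 \<le> cM" "0 < cM"
proof -
  have "1 \<le> L^9 * cc\<^sup>2" using params cc_ge(1) mult_mono[of 1 "L^9" 1 "cc\<^sup>2"] by simp
  then show "1 \<le> cM" unfolding cM_def by linarith
  then show "0 < cM" by linarith
qed

text \<open>The weighted bound at \<open>\<theta> = 1\<close>, where forcing and load together are
  the noise.\<close>

lemma minimiser_energy_bound:
  assumes N: "\<tau> \<le> N" "N \<le> T" and w: "admissible \<tau> N a x w" "stationary \<tau> N a source w"
  shows "esum \<tau> a (\<lambda>\<zeta>. \<Sum>t\<in>{\<tau>..N}. (norm (at_prefix w t \<zeta>))\<^sup>2)
    \<le> cM * esum \<tau> a (\<lambda>\<zeta>. (norm x)\<^sup>2 + (\<Sum>t\<in>{\<tau>..N}. noise t \<zeta>))"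
proof -
  have "0 \<le> 1 / (40 * L^5 * cc)" using params cc_ge(1) by simp
  then have "esum \<tau> a (\<lambda>\<zeta>. \<Sum>t\<in>{\<tau>..N}. 1 ^ t * (norm (at_prefix w t \<zeta>))\<^sup>2)
    \<le> cM * esum \<tau> a (\<lambda>\<zeta>. 1 ^ \<tau> * (norm (fst (at_prefix w \<tau> \<zeta>)))\<^sup>2
        + (\<Sum>t\<in>{\<tau>..N}. 1 ^ t * ((norm (source t \<zeta>))\<^sup>2 + (norm (dv S (take (Suc t) \<zeta> ! t)))\<^sup>2)))"
    using w by (intro weighted_stationary_bound[OF N, of a "\<lambda>t b. dv S (b ! t)"]) (auto simp: admissible_def)
  also have "esum \<tau> a (\<lambda>\<zeta>. 1 ^ \<tau> * (norm (fst (at_prefix w \<tau> \<zeta>)))\<^sup>2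
        + (\<Sum>t\<in>{\<tau>..N}. 1 ^ t * ((norm (source t \<zeta>))\<^sup>2 + (norm (dv S (take (Suc t) \<zeta> ! t)))\<^sup>2)))
      = esum \<tau> a (\<lambda>\<zeta>. (norm x)\<^sup>2 + (\<Sum>t\<in>{\<tau>..N}. noise t \<zeta>))"
    using w by (intro esum_cong) (auto simp: noise_eq admissible_def dest: paths_D)
  finally show ?thesis by simp
qed

text \<open>Extended by zero, the truncated solution is stationary for the full problem with the data
  changed only after the truncation time \<open>N\<close>.\<close>

lemma truncation_error:
  assumes N: "\<tau> \<le> N" "N \<le> T"
    and y: "admissible \<tau> N a x y" "stationary \<tau> N a source y"
    and z: "admissible \<tau> T a x z" "stationary \<tau> T a source z"
    and \<theta>: "0 < \<theta>" "\<theta> \<le> 1" "1 - \<theta> \<le> 1 / (40 * L^5 * cc)"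
  shows "\<theta> ^ \<tau> * esum \<tau> a (\<lambda>\<zeta>. (norm (snd (y \<tau> a) - snd (z \<tau> a)))\<^sup>2)
    \<le> cM * (2 * esum \<tau> a (\<lambda>\<zeta>. \<Sum>t\<in>{Suc N..T}. \<theta> ^ t * noise t \<zeta>)
        + (if N < T then 4 * L\<^sup>2 * \<theta> ^ Suc N * esum \<tau> a (\<lambda>\<zeta>. (norm (at_prefix y N \<zeta>))\<^sup>2) else 0))"
proof -
  define ye where "ye t b = (if t \<le> N then y t b else 0)" for t b
  define de where "de t b = ye t b - z t b" for t b
  \<comment> \<open>Up to \<open>N\<close> both trajectories obey the same dynamics. At
    \<open>Suc N\<close> the extension drops to zero, so the missing step from \<open>y\<close>
    becomes a defect; later only the absent affine term \<open>dv\<close> does.\<close>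
  define d where "d t b = (if t \<le> N then 0 else
      (if t = Suc N then - step S (b ! t) (at_prefix y N b) else 0) - dv S (b ! t))" for t b
  define F where "F t \<zeta> = (if t \<le> N then 0 else - source t \<zeta>)" for t \<zeta>
  have yt: "traj \<tau> N a (\<lambda>t b. dv S (b ! t)) y" and zt: "traj \<tau> T a (\<lambda>t b. dv S (b ! t)) z"
    and x: "fst (y \<tau> a) = x" "fst (z \<tau> a) = x" using y z by (auto simp: admissible_def)
  have traj: "traj \<tau> T a d de"
    unfolding traj_def
  proof (intro ballI)
    fix \<zeta> t assume \<zeta>: "\<zeta> \<in> paths \<tau> a" and t: "t \<in> {\<tau>..<T}"
    have zs: "fst (at_prefix z (Suc t) \<zeta>) = step S (\<zeta> ! Suc t) (at_prefix z t \<zeta>) + dv S (\<zeta> ! Suc t)"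
      using trajD[OF zt \<zeta>] t by auto
    consider "t < N" | "t = N" | "N < t" by linarith
    then show "fst (at_prefix de (Suc t) \<zeta>) = step S (\<zeta> ! Suc t) (at_prefix de t \<zeta>) + at_prefix d (Suc t) \<zeta>"
    proof cases
      case 1
      then show ?thesis using trajD[OF yt \<zeta>, of t] t zs by (simp add: de_def ye_def d_def step_linear)
    next
      case 2
      then show ?thesis using zs by (simp add: de_def ye_def d_def step_linear min_def)
    next
      case 3
      then show ?thesis using zs step_linear(2)[of S _ 0] by (simp add: de_def ye_def d_def step_linear)
    qed
  qed
  have cut: "(\<Sum>t\<in>{\<tau>..T}. f t) = (\<Sum>t\<in>{\<tau>..N}. f t) + (\<Sum>t\<in>{Suc N..T}. f t)" for f :: "nat \<Rightarrow> real"
    using N sum.ub_add_nat[of \<tau> N f "T - N"] by simp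
  have stat: "stationary \<tau> T a F de"
    unfolding stationary_def
  proof (intro allI impI)
    fix v assume v: "traj \<tau> T a (\<lambda>_ _. 0) v \<and> fst (v \<tau> a) = 0"
    \<comment> \<open>A test direction on the full horizon restricts to one on the short horizon, so
      the two stationarity identities can be subtracted.\<close>
    have vN: "traj \<tau> N a (\<lambda>_ _. 0) v" using v N by (auto simp: traj_def)
    have ext: "(\<Sum>t\<in>{\<tau>..T}. hess S (\<zeta> ! t) (at_prefix ye t \<zeta>) (at_prefix v t \<zeta>))
        = (\<Sum>t\<in>{\<tau>..N}. hess S (\<zeta> ! t) (at_prefix y t \<zeta>) (at_prefix v t \<zeta>))" for \<zeta>
      by (simp add: cut ye_def hess_linear)
    have "energy \<tau> T a de v = energy \<tau> N a y v - energy \<tau> T a z v"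
      unfolding energy_def esum_linear(2)[symmetric]
      by (intro esum_cong) (simp add: ext[symmetric] de_def hess_linear sum_subtractf)
    also have "\<dots> = load \<tau> N a source v - load \<tau> T a source v"
      using y z v vN by (simp add: stationary_def)
    also have "\<dots> = load \<tau> T a F v"
      unfolding load_def esum_linear(2)[symmetric]
      by (intro esum_cong) (simp add: cut F_def sum_negf)
    finally show "energy \<tau> T a de v = load \<tau> T a F v" .
  qed
  \<comment> \<open>Only the input part of the term at \<open>\<tau>\<close> is kept. The difference
    starts with state zero, hence all data on the right lie beyond \<open>N\<close>; the contrast
    with the weight \<open>\<theta> ^ \<tau>\<close> is the exponential gain.\<close>
  have "\<theta> ^ \<tau> * esum \<tau> a (\<lambda>\<zeta>. (norm (snd (y \<tau> a) - snd (z \<tau> a)))\<^sup>2)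
    \<le> esum \<tau> a (\<lambda>\<zeta>. \<Sum>t\<in>{\<tau>..T}. \<theta> ^ t * (norm (at_prefix de t \<zeta>))\<^sup>2)"
    unfolding esum_linear(3)[symmetric]
  proof (rule esum_mono)
    fix \<zeta> assume \<zeta>: "\<zeta> \<in> paths \<tau> a"
    have "\<theta> ^ \<tau> * (norm (snd (y \<tau> a) - snd (z \<tau> a)))\<^sup>2 \<le> \<theta> ^ \<tau> * (norm (at_prefix de \<tau> \<zeta>))\<^sup>2"
      using N \<theta> paths_D(2)[OF \<zeta>] by (simp add: de_def ye_def norm_pair_sq)
    also have "\<dots> \<le> (\<Sum>t\<in>{\<tau>..T}. \<theta> ^ t * (norm (at_prefix de t \<zeta>))\<^sup>2)"
      using N \<theta> by (intro member_le_sum) auto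
    finally show "\<theta> ^ \<tau> * (norm (snd (y \<tau> a) - snd (z \<tau> a)))\<^sup>2
      \<le> (\<Sum>t\<in>{\<tau>..T}. \<theta> ^ t * (norm (at_prefix de t \<zeta>))\<^sup>2)" .
  qed
  also have "\<dots> \<le> cM * esum \<tau> a (\<lambda>\<zeta>. \<theta> ^ \<tau> * (norm (fst (at_prefix de \<tau> \<zeta>)))\<^sup>2
        + (\<Sum>t\<in>{\<tau>..T}. \<theta> ^ t * ((norm (F t \<zeta>))\<^sup>2 + (norm (at_prefix d t \<zeta>))\<^sup>2)))"
    using N by (intro weighted_stationary_bound traj stat \<theta>) auto
  also have "\<dots> \<le> cM * esum \<tau> a (\<lambda>\<zeta>. 2 * (\<Sum>t\<in>{Suc N..T}. \<theta> ^ t * noise t \<zeta>)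
      + (if N < T then 4 * L\<^sup>2 * \<theta> ^ Suc N else 0) * (norm (at_prefix y N \<zeta>))\<^sup>2)"
  proof (intro mult_left_mono esum_mono)
    fix \<zeta> assume \<zeta>: "\<zeta> \<in> paths \<tau> a"
    let ?Y = "4 * L\<^sup>2 * \<theta> ^ Suc N * (norm (at_prefix y N \<zeta>))\<^sup>2"
    have "fst (at_prefix de \<tau> \<zeta>) = 0"
      using N x paths_D(2)[OF \<zeta>] by (simp add: de_def ye_def)
    moreover have "(\<Sum>t\<in>{\<tau>..T}. \<theta> ^ t * ((norm (F t \<zeta>))\<^sup>2 + (norm (at_prefix d t \<zeta>))\<^sup>2))
        = (\<Sum>t\<in>{Suc N..T}. \<theta> ^ t * ((norm (F t \<zeta>))\<^sup>2 + (norm (at_prefix d t \<zeta>))\<^sup>2))"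
      by (simp add: cut F_def d_def)
    moreover have "(\<Sum>t\<in>{Suc N..T}. \<theta> ^ t * ((norm (F t \<zeta>))\<^sup>2 + (norm (at_prefix d t \<zeta>))\<^sup>2))
        \<le> (\<Sum>t\<in>{Suc N..T}. 2 * (\<theta> ^ t * noise t \<zeta>) + (if t = Suc N then ?Y else 0))"
    proof (rule sum_mono)
      fix t assume t: "t \<in> {Suc N..T}"
      have F: "(norm (F t \<zeta>))\<^sup>2 \<le> 2 * (norm (source t \<zeta>))\<^sup>2" using t by (simp add: F_def)
      show "\<theta> ^ t * ((norm (F t \<zeta>))\<^sup>2 + (norm (at_prefix d t \<zeta>))\<^sup>2)
        \<le> 2 * (\<theta> ^ t * noise t \<zeta>) + (if t = Suc N then ?Y else 0)"
      proof (cases "t = Suc N")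
        case True
        have "at_prefix d t \<zeta> = - step S (\<zeta> ! t) (at_prefix y N \<zeta>) - dv S (\<zeta> ! t)"
          using True by (simp add: d_def min_def)
        then have "(norm (at_prefix d t \<zeta>))\<^sup>2 \<le> 2 * (norm (step S (\<zeta> ! t) (at_prefix y N \<zeta>)))\<^sup>2 + 2 * (norm (dv S (\<zeta> ! t)))\<^sup>2"
          using norm_diff_sq_le[of "- step S (\<zeta> ! t) (at_prefix y N \<zeta>)" "dv S (\<zeta> ! t)"] by simp
        also have "\<dots> \<le> 2 * (2 * L\<^sup>2 * (norm (at_prefix y N \<zeta>))\<^sup>2) + 2 * (norm (dv S (\<zeta> ! t)))\<^sup>2"
          using t paths_D(1)[OF \<zeta>] by (intro add_right_mono mult_left_mono step_norm_le) auto
        finally have "(norm (F t \<zeta>))\<^sup>2 + (norm (at_prefix d t \<zeta>))\<^sup>2 \<le> 2 * noise t \<zeta> + 4 * L\<^sup>2 * (norm (at_prefix y N \<zeta>))\<^sup>2"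
          using F by (simp add: noise_eq)
        then have "\<theta> ^ t * ((norm (F t \<zeta>))\<^sup>2 + (norm (at_prefix d t \<zeta>))\<^sup>2)
            \<le> \<theta> ^ t * (2 * noise t \<zeta> + 4 * L\<^sup>2 * (norm (at_prefix y N \<zeta>))\<^sup>2)"
          using \<theta> by (intro mult_left_mono) auto
        then show ?thesis using True by (simp add: algebra_simps)
      next
        case False
        then have "(norm (F t \<zeta>))\<^sup>2 + (norm (at_prefix d t \<zeta>))\<^sup>2 \<le> 2 * noise t \<zeta>"
          using t add_mono[OF F zero_le_power2[of "norm (dv S (\<zeta> ! t))"]] by (simp add: noise_eq d_def)
        then have "\<theta> ^ t * ((norm (F t \<zeta>))\<^sup>2 + (norm (at_prefix d t \<zeta>))\<^sup>2) \<le> \<theta> ^ t * (2 * noise t \<zeta>)"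
          using \<theta> by (intro mult_left_mono) auto
        then show ?thesis using False by simp
      qed
    qed
    moreover have "\<dots> = 2 * (\<Sum>t\<in>{Suc N..T}. \<theta> ^ t * noise t \<zeta>) + (if N < T then ?Y else 0)"
      by (simp add: sum.distrib sum_distrib_left less_eq_Suc_le)
    ultimately show "\<theta> ^ \<tau> * (norm (fst (at_prefix de \<tau> \<zeta>)))\<^sup>2
        + (\<Sum>t\<in>{\<tau>..T}. \<theta> ^ t * ((norm (F t \<zeta>))\<^sup>2 + (norm (at_prefix d t \<zeta>))\<^sup>2))
      \<le> 2 * (\<Sum>t\<in>{Suc N..T}. \<theta> ^ t * noise t \<zeta>)
      + (if N < T then 4 * L\<^sup>2 * \<theta> ^ Suc N else 0) * (norm (at_prefix y N \<zeta>))\<^sup>2"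
      by (cases "N < T") simp_all
  qed (use cM_ge in simp)
  also have "\<dots> = cM * (2 * esum \<tau> a (\<lambda>\<zeta>. \<Sum>t\<in>{Suc N..T}. \<theta> ^ t * noise t \<zeta>)
        + (if N < T then 4 * L\<^sup>2 * \<theta> ^ Suc N * esum \<tau> a (\<lambda>\<zeta>. (norm (at_prefix y N \<zeta>))\<^sup>2) else 0))"
    by (simp add: esum_linear)
  finally show ?thesis .
qed

text \<open>The tower property: unnormalised sums add up over the longer prefixes that extend
  \<open>a\<close>, with no conditional probabilities in between. It transfers an estimate made at
  each node, where the past is frozen, to the average over the tree.\<close>

lemma esum_mono_by_prefix:
  assumes "\<sigma> \<le> \<tau>" and "\<And>b. paths \<tau> b \<noteq> {} \<Longrightarrow> paths \<tau> b \<subseteq> paths \<sigma> a \<Longrightarrow> esum \<tau> b f \<le> esum \<tau> b g"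
  shows "esum \<sigma> a f \<le> esum \<sigma> a g"
proof -
  have tk: "take (Suc \<sigma>) \<zeta> = take (Suc \<sigma>) \<zeta>'" if "take (Suc \<tau>) \<zeta> = take (Suc \<tau>) \<zeta>'" for \<zeta> \<zeta>' :: "'xi list"
    using assms(1) that by (metis Suc_le_mono min_absorb1 take_take)
  have split: "esum \<sigma> a h = (\<Sum>b\<in>take (Suc \<tau>) ` paths \<sigma> a. esum \<tau> b h)" for h
  proof -
    have "{\<zeta> \<in> paths \<sigma> a. take (Suc \<tau>) \<zeta> = b} = paths \<tau> b" if "b \<in> take (Suc \<tau>) ` paths \<sigma> a" for b
      using that by (auto simp: paths_def intro: tk)
    then show ?thesis
      unfolding esum_def by (subst sum.image_gen[of _ _ "take (Suc \<tau>)"]) simp_all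
  qed
  show ?thesis
    unfolding split
  proof (rule sum_mono)
    fix b assume b: "b \<in> take (Suc \<tau>) ` paths \<sigma> a"
    have "paths \<tau> b \<subseteq> paths \<sigma> a" using b by (auto simp: paths_def intro: tk)
    moreover have "paths \<tau> b \<noteq> {}" using b by (force simp: paths_def)
    ultimately show "esum \<tau> b f \<le> esum \<tau> b g" using assms(2) by blast
  qed
qed

text \<open>Acting optimally after time \<open>\<tau>\<close> costs at most as much as correcting the optimal trajectory
  \<open>z\<close> by a stabilised response to the deviating input.\<close>

lemma one_step_cost:
  assumes \<tau>: "\<tau> \<le> T" and ne: "paths \<tau> a \<noteq> {}"
    and z: "admissible \<tau> T a x z" "stationary \<tau> T a source z" and y: "fst y = x"
    and u: "\<And>b. \<tau> < T \<Longrightarrow> paths (Suc \<tau>) b \<noteq> {} \<Longrightarrow> paths (Suc \<tau>) b \<subseteq> paths \<tau> a \<Longrightarrow>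
       (\<And>w'. admissible (Suc \<tau>) T b (dyn S y (last b)) w' \<Longrightarrow> cost (Suc \<tau>) T b (u b) \<le> cost (Suc \<tau>) T b w')"
  shows "esum \<tau> a (\<lambda>\<zeta>. stage S y (\<zeta> ! \<tau>) + (\<Sum>t\<in>{Suc \<tau>..T}. stage S (at_prefix (u (take (Suc (Suc \<tau>)) \<zeta>)) t \<zeta>) (\<zeta> ! t)))
    \<le> cost \<tau> T a z + 2 * L^7 * cc * esum \<tau> a (\<lambda>_. (norm (snd y - snd (z \<tau> a)))\<^sup>2)"
proof -
  define e where "e = snd y - snd (z \<tau> a)"
  \<comment> \<open>The input deviation \<open>e\<close> reaches the state one step later as the
    impulse \<open>B e\<close>; from then on the stabilising feedback damps it.\<close>
  define g where "g t b = (if t = Suc \<tau> then Bm S (b ! t) *v e else 0)" for t b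
  obtain v where v: "\<And>\<zeta>. fst (at_prefix v \<tau> \<zeta>) = at_prefix g \<tau> \<zeta>"
    "\<And>\<zeta> t. \<tau> \<le> t \<Longrightarrow>
       fst (at_prefix v (Suc t) \<zeta>) = step S (\<zeta> ! Suc t) (at_prefix v t \<zeta>) + at_prefix g (Suc t) \<zeta>"
    "\<And>\<zeta> t. \<zeta> \<in> set_pmf P \<Longrightarrow> t \<le> T \<Longrightarrow>
       norm (snd (at_prefix v t \<zeta>)) \<le> L * norm (fst (at_prefix v t \<zeta>))"
    "\<And>\<zeta> \<omega> N. \<zeta> \<in> set_pmf P \<Longrightarrow> 0 < \<omega> \<Longrightarrow> \<alpha> * \<omega> < 1 \<Longrightarrow> N \<le> T \<Longrightarrow>
       (\<Sum>t\<in>{\<tau>..N}. \<omega> ^ t * (norm (fst (at_prefix v t \<zeta>)))\<^sup>2)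
         \<le> (L\<^sup>2 / ((1 - \<alpha>) * (1 - \<alpha> * \<omega>))) * (\<Sum>t\<in>{\<tau>..N}. \<omega> ^ t * (norm (at_prefix g t \<zeta>))\<^sup>2)"
    by (rule stabilised_response[of \<tau> g]) (rule that)
  \<comment> \<open>On \<open>paths \<tau> a\<close> the response vanishes at \<open>\<tau>\<close>;
    overwriting it by \<open>(0, e)\<close> inserts the deviation without touching the
    state.\<close>
  define de where "de t b = (if t = \<tau> then (0, e) else v t b)" for t b
  have v\<tau>: "at_prefix v \<tau> \<zeta> = 0" if "\<zeta> \<in> paths \<tau> a" for \<zeta>
    using v(1)[of \<zeta>] v(3)[OF paths_D(1)[OF that] \<tau>] by (simp add: g_def prod_eq_iff)
  have det: "traj \<tau> T a (\<lambda>_ _. 0) de"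
    unfolding traj_def
  proof (intro ballI)
    fix \<zeta> t assume \<zeta>: "\<zeta> \<in> paths \<tau> a" and t: "t \<in> {\<tau>..<T}"
    show "fst (at_prefix de (Suc t) \<zeta>) = step S (\<zeta> ! Suc t) (at_prefix de t \<zeta>) + 0"
      using t v(2)[of t \<zeta>] v\<tau>[OF \<zeta>] by (auto simp: de_def g_def step_linear) (simp add: step_def)
  qed
  define w where "w t b = z t b + de t b" for t b
  have w\<tau>: "w \<tau> a = y" using y z by (simp add: w_def de_def e_def admissible_def prod_eq_iff)
  have wt: "traj \<tau> T a (\<lambda>t b. dv S (b ! t)) w"
    using admissible_add[OF z(1) det, of 1] by (simp add: w_def[abs_def] de_def admissible_def)
  have "esum \<tau> a (\<lambda>\<zeta>. stage S y (\<zeta> ! \<tau>) + (\<Sum>t\<in>{Suc \<tau>..T}. stage S (at_prefix (u (take (Suc (Suc \<tau>)) \<zeta>)) t \<zeta>) (\<zeta> ! t)))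
      \<le> esum \<tau> a (\<lambda>\<zeta>. stage S y (\<zeta> ! \<tau>) + (\<Sum>t\<in>{Suc \<tau>..T}. stage S (at_prefix w t \<zeta>) (\<zeta> ! t)))"
  proof (cases "\<tau> < T")
    case True
    \<comment> \<open>From \<open>Suc \<tau>\<close> on, \<open>w\<close> is a competitor in the
      problem at every successor node, whose initial state is dictated by \<open>y\<close>; the
      minimiser \<open>u b\<close> there is no more expensive.\<close>
    have "esum \<tau> a (\<lambda>\<zeta>. \<Sum>t\<in>{Suc \<tau>..T}. stage S (at_prefix (u (take (Suc (Suc \<tau>)) \<zeta>)) t \<zeta>) (\<zeta> ! t))
      \<le> esum \<tau> a (\<lambda>\<zeta>. \<Sum>t\<in>{Suc \<tau>..T}. stage S (at_prefix w t \<zeta>) (\<zeta> ! t))"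
    proof (rule esum_mono_by_prefix[of _ "Suc \<tau>"])
      fix b assume b: "paths (Suc \<tau>) b \<noteq> {}" "paths (Suc \<tau>) b \<subseteq> paths \<tau> a"
      obtain \<zeta> where \<zeta>: "\<zeta> \<in> paths (Suc \<tau>) b" using b by auto
      have \<zeta>a: "\<zeta> \<in> paths \<tau> a" using \<zeta> b by auto
      have bz: "b = take (Suc (Suc \<tau>)) \<zeta>" using \<zeta> by (simp add: paths_def)
      have len: "length \<zeta> = Suc T" using \<zeta> length_path by (simp add: paths_def)
      have lb: "last b = \<zeta> ! Suc \<tau>"
      proof -
        have "length b = Suc (Suc \<tau>)" using True len by (simp add: bz)
        then show ?thesis by (cases b rule: rev_cases) (use bz in \<open>auto simp: nth_append dest: arg_cong[of _ _ "\<lambda>l. l ! Suc \<tau>"]\<close>)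
      qed
      have "fst (w (Suc \<tau>) b) = dyn S y (last b)"
        using trajD[OF wt \<zeta>a, of \<tau>] True w\<tau> paths_D(2)[OF \<zeta>a] by (simp add: bz[symmetric] lb dyn_eq_step) (simp add: bz)
      moreover have "traj (Suc \<tau>) T b (\<lambda>t b. dv S (b ! t)) w"
        using wt b unfolding traj_def by (meson atLeastLessThan_iff Suc_leD subset_iff)
      ultimately have "admissible (Suc \<tau>) T b (dyn S y (last b)) w" by (simp add: admissible_def)
      then have "cost (Suc \<tau>) T b (u b) \<le> cost (Suc \<tau>) T b w" using u[OF True b] by blast
      moreover have "esum (Suc \<tau>) b (\<lambda>\<zeta>. \<Sum>t\<in>{Suc \<tau>..T}. stage S (at_prefix (u (take (Suc (Suc \<tau>)) \<zeta>)) t \<zeta>) (\<zeta> ! t))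
        = cost (Suc \<tau>) T b (u b)"
        unfolding cost_def by (intro esum_cong) (auto simp: paths_def)
      ultimately show "esum (Suc \<tau>) b (\<lambda>\<zeta>. \<Sum>t\<in>{Suc \<tau>..T}. stage S (at_prefix (u (take (Suc (Suc \<tau>)) \<zeta>)) t \<zeta>) (\<zeta> ! t))
        \<le> esum (Suc \<tau>) b (\<lambda>\<zeta>. \<Sum>t\<in>{Suc \<tau>..T}. stage S (at_prefix w t \<zeta>) (\<zeta> ! t))"
        by (simp add: cost_def)
    qed simp
    then show ?thesis by (simp add: esum_linear)
  next
    case False
    then show ?thesis by simp
  qed
  also have "\<dots> = cost \<tau> T a w"
    unfolding cost_def
  proof (rule esum_cong)
    fix \<zeta> assume \<zeta>: "\<zeta> \<in> paths \<tau> a"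
    show "stage S y (\<zeta> ! \<tau>) + (\<Sum>t\<in>{Suc \<tau>..T}. stage S (at_prefix w t \<zeta>) (\<zeta> ! t))
        = (\<Sum>t\<in>{\<tau>..T}. stage S (at_prefix w t \<zeta>) (\<zeta> ! t))"
      using \<tau> w\<tau> paths_D(2)[OF \<zeta>] by (subst sum.atLeast_Suc_atMost[of \<tau>]) auto
  qed
  also have "\<dots> = cost \<tau> T a z + energy \<tau> T a de de / 2"
    unfolding w_def[abs_def] by (rule cost_stationary_add[OF z(2) det]) (simp add: de_def)
  also have "energy \<tau> T a de de \<le> 4 * L^7 * cc * esum \<tau> a (\<lambda>_. (norm e)\<^sup>2)"
    unfolding energy_def esum_linear(3)[symmetric]
  proof (rule esum_mono)
    fix \<zeta> assume \<zeta>: "\<zeta> \<in> paths \<tau> a"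
    note \<zeta>P = paths_D(1)[OF \<zeta>]
    have L: "1 \<le> L" using params by simp
    have "hess S (\<zeta> ! t) (at_prefix de t \<zeta>) (at_prefix de t \<zeta>)
      \<le> (if t = \<tau> then L * (norm e)\<^sup>2 else 0) + 2 * L^3 * (1 ^ t * (norm (fst (at_prefix v t \<zeta>)))\<^sup>2)"
      if t: "t \<in> {\<tau>..T}" for t
    proof (cases "t = \<tau>")
      case True
      then show ?thesis using hess_le[OF \<zeta>P, of \<tau> "(0, e)"] \<tau> L by (auto simp: de_def norm_Pair intro: add_increasing2)
    next
      case False
      have "(norm (snd (at_prefix v t \<zeta>)))\<^sup>2 \<le> (L * norm (fst (at_prefix v t \<zeta>)))\<^sup>2"
        using v(3)[OF \<zeta>P] t by (intro power_mono) auto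
      moreover have "1 * (norm (fst (at_prefix v t \<zeta>)))\<^sup>2 \<le> L\<^sup>2 * (norm (fst (at_prefix v t \<zeta>)))\<^sup>2"
        using L by (intro mult_right_mono) auto
      ultimately have "(norm (at_prefix v t \<zeta>))\<^sup>2 \<le> 2 * L\<^sup>2 * (norm (fst (at_prefix v t \<zeta>)))\<^sup>2"
        by (simp add: norm_pair_sq power_mult_distrib)
      then have "L * (norm (at_prefix v t \<zeta>))\<^sup>2 \<le> L * (2 * L\<^sup>2 * (norm (fst (at_prefix v t \<zeta>)))\<^sup>2)"
        using L by (intro mult_left_mono) auto
      then show ?thesis using False hess_le[OF \<zeta>P, of t "at_prefix v t \<zeta>"] t
        by (simp add: de_def power2_eq_square power3_eq_cube)
    qed
    then have "(\<Sum>t\<in>{\<tau>..T}. hess S (\<zeta> ! t) (at_prefix de t \<zeta>) (at_prefix de t \<zeta>))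
      \<le> (\<Sum>t\<in>{\<tau>..T}. (if t = \<tau> then L * (norm e)\<^sup>2 else 0) + 2 * L^3 * (1 ^ t * (norm (fst (at_prefix v t \<zeta>)))\<^sup>2))"
      by (rule sum_mono)
    also have "\<dots> = L * (norm e)\<^sup>2 + 2 * L^3 * (\<Sum>t\<in>{\<tau>..T}. 1 ^ t * (norm (fst (at_prefix v t \<zeta>)))\<^sup>2)"
      using \<tau> by (simp add: sum.distrib sum_distrib_left)
    \<comment> \<open>The response costs \<open>2 * L^3\<close> per squared state, stability
      contributes \<open>L\<^sup>2 / (1 - \<alpha>)\<^sup>2\<close> and the impulse
      \<open>L\<^sup>2\<close>, which makes \<open>L^7\<close> in total.\<close>
    also have "\<dots> \<le> L * (norm e)\<^sup>2 + 2 * L^3 * ((L\<^sup>2 / ((1 - \<alpha>) * (1 - \<alpha> * 1))) * (L\<^sup>2 * (norm e)\<^sup>2))"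
    proof (intro add_left_mono mult_left_mono)
      have "(\<Sum>t\<in>{\<tau>..T}. 1 ^ t * (norm (fst (at_prefix v t \<zeta>)))\<^sup>2)
         \<le> (L\<^sup>2 / ((1 - \<alpha>) * (1 - \<alpha> * 1))) * (\<Sum>t\<in>{\<tau>..T}. 1 ^ t * (norm (at_prefix g t \<zeta>))\<^sup>2)"
        using params by (intro v(4) \<zeta>P) auto
      also have "\<dots> \<le> (L\<^sup>2 / ((1 - \<alpha>) * (1 - \<alpha> * 1))) * (L\<^sup>2 * (norm e)\<^sup>2)"
      proof (rule mult_left_mono)
        have "(\<Sum>t\<in>{\<tau>..T}. 1 ^ t * (norm (at_prefix g t \<zeta>))\<^sup>2) \<le> (\<Sum>t\<in>{\<tau>..T}. if t = Suc \<tau> then L\<^sup>2 * (norm e)\<^sup>2 else 0)"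
        proof (rule sum_mono)
          fix t assume t: "t \<in> {\<tau>..T}"
          have "(norm (Bm S (\<zeta> ! t) *v e))\<^sup>2 \<le> (L * norm e)\<^sup>2"
            using path_bounds(2)[OF \<zeta>P] t by (intro power_mono) auto
          then show "1 ^ t * (norm (at_prefix g t \<zeta>))\<^sup>2 \<le> (if t = Suc \<tau> then L\<^sup>2 * (norm e)\<^sup>2 else 0)"
            by (cases "t = Suc \<tau>") (simp_all add: g_def power_mult_distrib)
        qed
        also have "\<dots> \<le> L\<^sup>2 * (norm e)\<^sup>2" by simp
        finally show "(\<Sum>t\<in>{\<tau>..T}. 1 ^ t * (norm (at_prefix g t \<zeta>))\<^sup>2) \<le> L\<^sup>2 * (norm e)\<^sup>2" .
      qed (use params in auto)
      finally show "(\<Sum>t\<in>{\<tau>..T}. 1 ^ t * (norm (fst (at_prefix v t \<zeta>)))\<^sup>2)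
        \<le> (L\<^sup>2 / ((1 - \<alpha>) * (1 - \<alpha> * 1))) * (L\<^sup>2 * (norm e)\<^sup>2)" .
    qed (use L in auto)
    also have "\<dots> = L * (norm e)\<^sup>2 + 2 * (L^7 * (1 / (1 - \<alpha>)\<^sup>2)) * (norm e)\<^sup>2"
      by (simp add: power2_eq_square eval_nat_numeral)
    also have "\<dots> \<le> 2 * (L^7 * cc) * (norm e)\<^sup>2 + 2 * (L^7 * cc) * (norm e)\<^sup>2"
    proof (intro add_mono mult_right_mono mult_left_mono cc_ge(4))
      have "L ^ 1 * 1 \<le> L^7 * cc" using L cc_ge(1) by (intro mult_mono power_increasing) auto
      then show "L \<le> 2 * (L^7 * cc)" using L by simp
    qed (use L in auto)
    finally show "(\<Sum>t\<in>{\<tau>..T}. hess S (\<zeta> ! t) (at_prefix de t \<zeta>) (at_prefix de t \<zeta>)) \<le> 4 * L^7 * cc * (norm e)\<^sup>2"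
      by (simp add: ac_simps)
  qed
  finally show ?thesis by (simp add: e_def ac_simps)
qed

section \<open>The closed loop and the switching times\<close>

definition prev :: "nat \<Rightarrow> (real^'nx) \<times> (real^'nu) \<Rightarrow> nat \<Rightarrow> 'xi list \<Rightarrow> (real^'nx) \<times> (real^'nu)" where
  "prev W wb \<tau> \<zeta> = (case \<tau> of 0 \<Rightarrow> wb | Suc t \<Rightarrow> spc S P T W wb t \<zeta>)"

text \<open>The optimal continuation after SPC inputs have been applied before time
  \<open>\<tau>\<close>. The window \<open>T\<close> means the whole remaining horizon, since
  \<open>min (\<tau> + T) T = T\<close>.\<close>

definition full :: "nat \<Rightarrow> (real^'nx) \<times> (real^'nu) \<Rightarrow> nat \<Rightarrow> 'xi list \<Rightarrow> nat \<Rightarrow> 'xi list \<Rightarrow> (real^'nx) \<times> (real^'nu)" where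
  "full W wb \<tau> \<zeta> = tr_solution S P T \<tau> T (take (Suc \<tau>) \<zeta>) (prev W wb \<tau> \<zeta>)"

lemma spc_eq_tr_solution:
  "spc S P T W wb \<tau> \<zeta> = tr_solution S P T \<tau> W (take (Suc \<tau>) \<zeta>) (prev W wb \<tau> \<zeta>) \<tau> (take (Suc \<tau>) \<zeta>)"
  by (cases \<tau>) (simp_all add: prev_def)

lemma spc_take: "t < m \<Longrightarrow> spc S P T W wb t (take m \<zeta>) = spc S P T W wb t \<zeta>"
  by (induction t) (simp_all add: min_def)

lemma prev_take: "\<tau> \<le> m \<Longrightarrow> prev W wb \<tau> (take m \<zeta>) = prev W wb \<tau> \<zeta>"
  by (cases \<tau>) (simp_all add: prev_def spc_take)

lemma full_take: "\<tau> < m \<Longrightarrow> full W wb \<tau> (take m \<zeta>) = full W wb \<tau> \<zeta>"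
  by (simp add: full_def prev_take min_def)

lemma last_prefix:
  assumes "\<zeta> \<in> set_pmf P" "\<tau> \<le> T" shows "last (take (Suc \<tau>) \<zeta>) = \<zeta> ! \<tau>"
  using assms length_path[OF assms(1)] by (simp add: take_Suc_conv_app_nth)

lemma full_minimal:
  assumes "\<tau> \<le> T" "paths \<tau> b \<noteq> {}"
  shows "admissible \<tau> T b (dyn S (prev W wb \<tau> b) (last b)) (full W wb \<tau> b)"
    and "admissible \<tau> T b (dyn S (prev W wb \<tau> b) (last b)) w' \<Longrightarrow> cost \<tau> T b (full W wb \<tau> b) \<le> cost \<tau> T b w'"
    and "stationary \<tau> T b source (full W wb \<tau> b)"
proof -
  obtain \<zeta> where "\<zeta> \<in> paths \<tau> b" using assms by auto
  then have b: "take (Suc \<tau>) b = b" by (auto simp: paths_def)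
  have m: "min (\<tau> + T) T = T" by simp
  note * = tr_solution_minimal[OF assms, of T "prev W wb \<tau> b", unfolded m]
  show 1: "admissible \<tau> T b (dyn S (prev W wb \<tau> b) (last b)) (full W wb \<tau> b)"
    using *(1) by (simp add: full_def b)
  show 2: "cost \<tau> T b (full W wb \<tau> b) \<le> cost \<tau> T b w'"
    if "admissible \<tau> T b (dyn S (prev W wb \<tau> b) (last b)) w'" for w'
    using *(2)[OF that] by (simp add: full_def b)
  show "stationary \<tau> T b source (full W wb \<tau> b)"
    using minimiser_stationary[OF 1 2] by blast
qed

lemma spc_state:
  assumes "\<zeta> \<in> set_pmf P" "\<tau> \<le> T"
  shows "fst (spc S P T W wb \<tau> \<zeta>) = dyn S (prev W wb \<tau> \<zeta>) (\<zeta> ! \<tau>)"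
proof -
  have "paths \<tau> (take (Suc \<tau>) \<zeta>) \<noteq> {}" using assms by (auto simp: paths_def)
  from tr_solution_minimal(1)[OF assms(2) this, of W "prev W wb \<tau> \<zeta>"]
  show ?thesis by (simp add: admissible_def spc_eq_tr_solution last_prefix[OF assms])
qed

lemma spc_admissible:
  assumes "paths 0 a \<noteq> {}"
  shows "admissible 0 T a (dyn S wb (last a)) (spc S P T W wb)"
  unfolding admissible_def traj_def
proof (intro conjI ballI)
  obtain \<zeta> where \<zeta>: "\<zeta> \<in> paths 0 a" using assms by auto
  then show "fst (spc S P T W wb 0 a) = dyn S wb (last a)"
    using spc_state[OF paths_D(1)[OF \<zeta>], of 0 W wb] spc_take[of 0 1 W wb \<zeta>]
      last_prefix[OF paths_D(1)[OF \<zeta>], of 0] paths_D(2)[OF \<zeta>]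
    by (simp add: prev_def del: spc.simps)
next
  fix \<zeta> t assume \<zeta>: "\<zeta> \<in> paths 0 a" and t: "t \<in> {0..<T}"
  have s: "spc S P T W wb t (take (Suc t) \<zeta>) = spc S P T W wb t \<zeta>" for t by (simp add: spc_take)
  show "fst (at_prefix (spc S P T W wb) (Suc t) \<zeta>)
    = step S (\<zeta> ! Suc t) (at_prefix (spc S P T W wb) t \<zeta>) + dv S (take (Suc (Suc t)) \<zeta> ! Suc t)"
    unfolding s using spc_state[OF paths_D(1)[OF \<zeta>], of "Suc t" W wb] t
    by (simp add: prev_def dyn_eq_step del: spc.simps)
qed

text \<open>Comparing inputs is enough: both states at \<open>\<tau>\<close> are prescribed by the
  same predecessor \<open>prev W wb \<tau> \<zeta>\<close>.\<close>

definition input_error :: "nat \<Rightarrow> (real^'nx) \<times> (real^'nu) \<Rightarrow> nat \<Rightarrow> 'xi list \<Rightarrow> real" where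
  "input_error W wb \<tau> \<zeta> = (norm (snd (spc S P T W wb \<tau> \<zeta>) - snd (at_prefix (full W wb \<tau> \<zeta>) \<tau> \<zeta>)))\<^sup>2"

lemma esum_sum: "esum \<tau> a (\<lambda>\<zeta>. \<Sum>t\<in>A. f t \<zeta>) = (\<Sum>t\<in>A. esum \<tau> a (f t))"
  unfolding esum_def sum_distrib_left by (rule sum.swap)

text \<open>The hybrid policies that follow SPC before time \<open>\<tau>\<close> and are optimal
  afterwards interpolate between the optimum at \<open>\<tau> = 0\<close> and SPC at
  \<open>\<tau> = Suc T\<close>. Postponing the switch by one step is priced node by node with
  \<open>one_step_cost\<close>.\<close>

lemma cost_gap_telescope:
  assumes ne: "paths 0 a \<noteq> {}"
  shows "cost 0 T a (spc S P T W wb) \<le> cost 0 T a (full W wb 0 a)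
    + 2 * L^7 * cc * (\<Sum>\<tau>\<in>{0..T}. esum 0 a (input_error W wb \<tau>))"
proof -
  define C where "C = 2 * L^7 * cc"
  define past where "past \<tau> \<zeta> = (\<Sum>t<\<tau>. stage S (spc S P T W wb t \<zeta>) (\<zeta> ! t))" for \<tau> \<zeta>
  \<comment> \<open>At \<open>\<tau> = Suc T\<close> this sum is empty, so the telescope ends in the
    SPC cost.\<close>
  define rest where "rest \<tau> \<zeta> = (\<Sum>t\<in>{\<tau>..T}. stage S (at_prefix (full W wb \<tau> \<zeta>) t \<zeta>) (\<zeta> ! t))" for \<tau> \<zeta>
  have step: "esum 0 a (\<lambda>\<zeta>. past (Suc \<tau>) \<zeta> + rest (Suc \<tau>) \<zeta>)
      \<le> esum 0 a (\<lambda>\<zeta>. past \<tau> \<zeta> + (rest \<tau> \<zeta> + C * input_error W wb \<tau> \<zeta>))" if \<tau>: "\<tau> \<le> T" for \<tau>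
  proof (rule esum_mono_by_prefix[of 0 \<tau>])
    fix b assume b: "paths \<tau> b \<noteq> {}" "paths \<tau> b \<subseteq> paths 0 a"
    define y where "y = spc S P T W wb \<tau> b"
    let ?z = "full W wb \<tau> b"
    have on: "spc S P T W wb \<tau> \<zeta> = y" "full W wb \<tau> \<zeta> = ?z" "prev W wb \<tau> \<zeta> = prev W wb \<tau> b"
      if "\<zeta> \<in> paths \<tau> b" for \<zeta>
      using spc_take[of \<tau> "Suc \<tau>" W wb \<zeta>] full_take[of \<tau> "Suc \<tau>" W wb \<zeta>] prev_take[of \<tau> "Suc \<tau>" W wb \<zeta>]
        paths_D(2)[OF that] by (simp_all add: y_def del: spc.simps)
    obtain \<zeta>0 where \<zeta>0: "\<zeta>0 \<in> paths \<tau> b" using b by auto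
    have y: "fst y = dyn S (prev W wb \<tau> b) (last b)"
      using spc_state[OF paths_D(1)[OF \<zeta>0] \<tau>, of W wb] last_prefix[OF paths_D(1)[OF \<zeta>0] \<tau>]
        on[OF \<zeta>0] paths_D(2)[OF \<zeta>0] by simp
    have "esum \<tau> b (\<lambda>\<zeta>. past (Suc \<tau>) \<zeta> + rest (Suc \<tau>) \<zeta>) = esum \<tau> b (past \<tau>)
       + esum \<tau> b (\<lambda>\<zeta>. stage S y (\<zeta> ! \<tau>) + (\<Sum>t\<in>{Suc \<tau>..T}. stage S (at_prefix (full W wb (Suc \<tau>) (take (Suc (Suc \<tau>)) \<zeta>)) t \<zeta>) (\<zeta> ! t)))"
      unfolding esum_linear(1)[symmetric]
      by (intro esum_cong) (simp add: past_def rest_def on(1) full_take)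
    also have "\<dots> \<le> esum \<tau> b (past \<tau>) + (cost \<tau> T b ?z + C * esum \<tau> b (\<lambda>_. (norm (snd y - snd (?z \<tau> b)))\<^sup>2))"
      unfolding C_def
    proof (intro add_left_mono one_step_cost[OF \<tau> b(1) full_minimal(1)[OF \<tau> b(1)] full_minimal(3)[OF \<tau> b(1)] y])
      fix b' w' assume b': "\<tau> < T" "paths (Suc \<tau>) b' \<noteq> {}" "paths (Suc \<tau>) b' \<subseteq> paths \<tau> b"
        and w': "admissible (Suc \<tau>) T b' (dyn S y (last b')) w'"
      obtain \<zeta> where \<zeta>: "\<zeta> \<in> paths (Suc \<tau>) b'" using b' by auto
      have "\<zeta> \<in> paths \<tau> b" using \<zeta> b' by auto
      then have "spc S P T W wb \<tau> b' = y"
        using on(1)[of \<zeta>] spc_take[of \<tau> "Suc (Suc \<tau>)" W wb \<zeta>] paths_D(2)[OF \<zeta>] by simp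
      then show "cost (Suc \<tau>) T b' (full W wb (Suc \<tau>) b') \<le> cost (Suc \<tau>) T b' w'"
        using b' w' by (intro full_minimal(2)) (auto simp: prev_def)
    qed
    also have "\<dots> = esum \<tau> b (\<lambda>\<zeta>. past \<tau> \<zeta> + (rest \<tau> \<zeta> + C * input_error W wb \<tau> \<zeta>))"
    proof -
      have "cost \<tau> T b ?z = esum \<tau> b (rest \<tau>)"
        unfolding cost_def by (intro esum_cong) (simp add: rest_def on(2))
      moreover have "esum \<tau> b (\<lambda>_. (norm (snd y - snd (?z \<tau> b)))\<^sup>2) = esum \<tau> b (input_error W wb \<tau>)"
        by (intro esum_cong) (simp add: input_error_def on paths_D(2))
      ultimately show ?thesis by (simp add: esum_linear)
    qed
    finally show "esum \<tau> b (\<lambda>\<zeta>. past (Suc \<tau>) \<zeta> + rest (Suc \<tau>) \<zeta>)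
      \<le> esum \<tau> b (\<lambda>\<zeta>. past \<tau> \<zeta> + (rest \<tau> \<zeta> + C * input_error W wb \<tau> \<zeta>))" .
  qed simp
  have tele: "esum 0 a (\<lambda>\<zeta>. past n \<zeta> + rest n \<zeta>)
      \<le> esum 0 a (\<lambda>\<zeta>. past 0 \<zeta> + rest 0 \<zeta>) + C * (\<Sum>\<tau><n. esum 0 a (input_error W wb \<tau>))" if "n \<le> Suc T" for n
    using that
  proof (induction n)
    case (Suc n)
    then show ?case using step[of n] by (simp add: esum_linear distrib_left)
  qed simp
  have "cost 0 T a (spc S P T W wb) = esum 0 a (\<lambda>\<zeta>. past (Suc T) \<zeta> + rest (Suc T) \<zeta>)"
    unfolding cost_def by (intro esum_cong) (simp add: past_def rest_def spc_take atLeast0AtMost lessThan_Suc_atMost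
        del: spc.simps sum.lessThan_Suc)
  moreover have "cost 0 T a (full W wb 0 a) = esum 0 a (\<lambda>\<zeta>. past 0 \<zeta> + rest 0 \<zeta>)"
    unfolding cost_def
  proof (rule esum_cong)
    fix \<zeta> assume "\<zeta> \<in> paths 0 a"
    then have "full W wb 0 a = full W wb 0 \<zeta>" using full_take[of 0 1 W wb \<zeta>] by (simp add: paths_def)
    then show "(\<Sum>t\<in>{0..T}. stage S (at_prefix (full W wb 0 a) t \<zeta>) (\<zeta> ! t)) = past 0 \<zeta> + rest 0 \<zeta>"
      by (simp add: past_def rest_def)
  qed
  ultimately show ?thesis using tele[of "Suc T"]
    by (simp add: C_def atLeast0AtMost lessThan_Suc_atMost del: sum.lessThan_Suc)
qed

section \<open>Geometric decay in the window and the closed-loop inequality\<close>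

lemma dyn_norm_le:
  assumes "\<zeta> \<in> set_pmf P" "t \<le> T"
  shows "(norm (dyn S w (\<zeta> ! t)))\<^sup>2 \<le> 4 * L\<^sup>2 * (norm w)\<^sup>2 + 2 * noise t \<zeta>"
proof -
  have "(norm (dyn S w (\<zeta> ! t)))\<^sup>2 \<le> 2 * (norm (step S (\<zeta> ! t) w))\<^sup>2 + 2 * (norm (dv S (\<zeta> ! t)))\<^sup>2"
    using norm_diff_sq_le[of "step S (\<zeta> ! t) w" "- dv S (\<zeta> ! t)"] by (simp add: dyn_eq_step)
  also have "\<dots> \<le> 2 * (2 * L\<^sup>2 * (norm w)\<^sup>2) + 2 * noise t \<zeta>"
    using assms by (intro add_mono mult_left_mono step_norm_le) (auto simp: noise_eq)
  finally show ?thesis by simp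
qed

text \<open>The fastest decay that the hypotheses of \<open>weighted_stationary_bound\<close>
  permit.\<close>

definition theta :: real where "theta = 1 - 1 / (40 * L^5 * cc)"

lemma theta_bounds: "1 / 2 \<le> theta" "theta < 1" "1 - theta = 1 / (40 * L^5 * cc)"
proof -
  define k where "k = 40 * L^5 * cc"
  have "40 \<le> k" using power_cc_ge_1(2)[of 5] by (simp add: k_def)
  then have "1 / k \<le> 1 / 2" "0 < 1 / k" by (auto simp: field_simps)
  then have "1 / (40 * L^5 * cc) \<le> 1 / 2" "0 < 1 / (40 * L^5 * cc)" by (simp_all only: k_def)
  then show "1 / 2 \<le> theta" "theta < 1" by (auto simp: theta_def)
qed (simp add: theta_def)

text \<open>The noise of a window enters with \<open>W + 1\<close> terms and that at time
  \<open>\<tau>\<close> with two more. One of the two factors \<open>s ^ W\<close> in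
  \<open>theta ^ W\<close> absorbs this growth, by comparing \<open>W + 1\<close> equal terms with a
  geometric series.\<close>

lemma linear_times_theta_power: "real (W + 3) * theta ^ Suc W \<le> 4 * (40 * L^5 * cc) * sqrt theta ^ W"
proof -
  define s where "s = sqrt theta"
  define \<kappa> where "\<kappa> = 40 * L^5 * cc"
  have \<kappa>: "1 \<le> \<kappa>" using power_cc_ge_1(2)[of 5] by (simp add: \<kappa>_def)
  have th: "theta = s * s" "0 < s" "s < 1" using theta_bounds by (auto simp: s_def)
  have s\<kappa>: "1 / (1 - s) \<le> 2 * \<kappa>"
  proof -
    have "1 / \<kappa> = (1 - s) * (1 + s)" using theta_bounds(3) th by (simp add: \<kappa>_def algebra_simps)
    also have "\<dots> \<le> (1 - s) * 2" using th by (intro mult_left_mono) auto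
    finally show ?thesis using th \<kappa> by (simp add: field_simps)
  qed
  have "real (W + 1) * s ^ W = (\<Sum>k\<in>{0..W}. s ^ W)" by simp
  also have "\<dots> \<le> (\<Sum>k\<in>{0..W}. s ^ (k - 0))" using th by (intro sum_mono power_decreasing) auto
  also have "\<dots> \<le> 1 / (1 - s)" using th by (intro sum_power_diff_le) auto
  finally have 1: "real (W + 1) * s ^ W \<le> 2 * \<kappa>" using s\<kappa> by linarith
  have sW: "s ^ W \<le> 1" using th by (simp add: power_le_one)
  have "real (W + 3) * s ^ W \<le> 4 * \<kappa>" using 1 sW \<kappa> by (simp add: algebra_simps)
  then have "real (W + 3) * s ^ W * s ^ W \<le> 4 * \<kappa> * s ^ W" using th by (intro mult_right_mono) auto
  moreover have "real (W + 3) * theta ^ Suc W \<le> real (W + 3) * theta ^ W"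
    using theta_bounds by (intro mult_left_mono power_decreasing) auto
  moreover have "real (W + 3) * theta ^ W = real (W + 3) * s ^ W * s ^ W"
    by (simp add: th power_mult_distrib)
  ultimately have "real (W + 3) * theta ^ Suc W \<le> 4 * \<kappa> * s ^ W" by linarith
  then show ?thesis by (simp only: \<kappa>_def s_def)
qed

lemma theta_power_le: "theta ^ Suc W \<le> sqrt theta ^ W"
proof -
  have "theta ^ Suc W \<le> theta ^ W" using theta_bounds by (intro power_decreasing) auto
  also have "\<dots> \<le> sqrt theta ^ W"
    using theta_bounds sqrt_le_D[of theta 1] by (intro power_mono) (auto intro!: real_le_rsqrt simp: power2_eq_square mult_left_le)
  finally show ?thesis .
qed

text \<open>At each node the truncation error is driven by later noise and by the last state of the
  truncated solution, which its own energy bound controls through the initial state and the noise in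
  the window. A factor \<open>theta ^ \<tau>\<close> appears on both sides and cancels, so the
  constant is uniform in time.\<close>

lemma input_error_bound:
  assumes \<tau>: "\<tau> \<le> T" and D: "0 \<le> D2" "\<And>t. t \<le> T \<Longrightarrow> esum 0 a (noise t) \<le> D2"
  shows "esum 0 a (input_error W wb \<tau>)
    \<le> 10^9 * L^27 * cc^5 * sqrt theta ^ W * (esum 0 a (\<lambda>\<zeta>. (norm (prev W wb \<tau> \<zeta>))\<^sup>2) + D2)"
proof -
  define N where "N = min (\<tau> + W) T"
  have N: "\<tau> \<le> N" "N \<le> T" using \<tau> by (auto simp: N_def)
  define \<kappa> where "\<kappa> = 40 * L^5 * cc"
  have \<kappa>: "1 \<le> \<kappa>" using power_cc_ge_1(2)[of 5] by (simp add: \<kappa>_def)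
  have L: "1 \<le> L" using params by simp
  note th = theta_bounds
  \<comment> \<open>A window that reaches the end of the horizon makes no jump and hence no error;
    only for \<open>N < T\<close>, where \<open>N = \<tau> + W\<close>, is the last state
    charged.\<close>
  define coef where "coef = (if N < T then 4 * L\<^sup>2 * theta ^ Suc N * cM else 0)"
  have coef: "0 \<le> coef" using th L cM_ge by (simp add: coef_def)
  define q where "q = esum 0 a (\<lambda>\<zeta>. (norm (prev W wb \<tau> \<zeta>))\<^sup>2)"
  have q: "0 \<le> q" unfolding q_def by (intro esum_nonneg) auto
  have "esum 0 a (\<lambda>\<zeta>. theta ^ \<tau> * input_error W wb \<tau> \<zeta>)
    \<le> esum 0 a (\<lambda>\<zeta>. cM * (2 * (\<Sum>t\<in>{Suc N..T}. theta ^ t * noise t \<zeta>)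
       + coef * (4 * L\<^sup>2 * (norm (prev W wb \<tau> \<zeta>))\<^sup>2 + 2 * noise \<tau> \<zeta> + (\<Sum>t\<in>{\<tau>..N}. noise t \<zeta>))))"
  proof (rule esum_mono_by_prefix[of 0 \<tau>])
    fix b assume b: "paths \<tau> b \<noteq> {}"
    let ?y = "tr_solution S P T \<tau> W b (prev W wb \<tau> b)"
    let ?z = "full W wb \<tau> b"
    let ?x = "dyn S (prev W wb \<tau> b) (last b)"
    have on: "spc S P T W wb \<tau> \<zeta> = ?y \<tau> b" "full W wb \<tau> \<zeta> = ?z" "prev W wb \<tau> \<zeta> = prev W wb \<tau> b"
      if "\<zeta> \<in> paths \<tau> b" for \<zeta>
      using spc_eq_tr_solution[of W wb \<tau> \<zeta>] full_take[of \<tau> "Suc \<tau>" W wb \<zeta>] prev_take[of \<tau> "Suc \<tau>" W wb \<zeta>]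
        paths_D(2)[OF that] by simp_all
    have y: "admissible \<tau> N b ?x ?y" "\<And>w'. admissible \<tau> N b ?x w' \<Longrightarrow> cost \<tau> N b ?y \<le> cost \<tau> N b w'"
      using tr_solution_minimal[OF \<tau> b] by (auto simp: N_def)
    have ys: "stationary \<tau> N b source ?y" using minimiser_stationary[OF y] .
    have "esum \<tau> b (\<lambda>\<zeta>. theta ^ \<tau> * input_error W wb \<tau> \<zeta>)
      = theta ^ \<tau> * esum \<tau> b (\<lambda>\<zeta>. (norm (snd (?y \<tau> b) - snd (?z \<tau> b)))\<^sup>2)"
      unfolding esum_linear(3)[symmetric]
      by (intro esum_cong) (simp add: input_error_def on paths_D(2))
    also have "\<dots> \<le> cM * (2 * esum \<tau> b (\<lambda>\<zeta>. \<Sum>t\<in>{Suc N..T}. theta ^ t * noise t \<zeta>)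
        + (if N < T then 4 * L\<^sup>2 * theta ^ Suc N * esum \<tau> b (\<lambda>\<zeta>. (norm (at_prefix ?y N \<zeta>))\<^sup>2) else 0))"
      using th by (intro truncation_error[OF N y(1) ys full_minimal(1)[OF \<tau> b] full_minimal(3)[OF \<tau> b]]) auto
    also have "\<dots> \<le> cM * (2 * esum \<tau> b (\<lambda>\<zeta>. \<Sum>t\<in>{Suc N..T}. theta ^ t * noise t \<zeta>)
        + coef * esum \<tau> b (\<lambda>\<zeta>. 4 * L\<^sup>2 * (norm (prev W wb \<tau> \<zeta>))\<^sup>2 + 2 * noise \<tau> \<zeta> + (\<Sum>t\<in>{\<tau>..N}. noise t \<zeta>)))"
    proof (intro mult_left_mono add_left_mono)
      have "esum \<tau> b (\<lambda>\<zeta>. (norm (at_prefix ?y N \<zeta>))\<^sup>2) \<le> esum \<tau> b (\<lambda>\<zeta>. \<Sum>t\<in>{\<tau>..N}. (norm (at_prefix ?y t \<zeta>))\<^sup>2)"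
        using N by (intro esum_mono member_le_sum) auto
      also have "\<dots> \<le> cM * esum \<tau> b (\<lambda>\<zeta>. (norm ?x)\<^sup>2 + (\<Sum>t\<in>{\<tau>..N}. noise t \<zeta>))"
        by (rule minimiser_energy_bound[OF N y(1) ys])
      also have "\<dots> \<le> cM * esum \<tau> b (\<lambda>\<zeta>. 4 * L\<^sup>2 * (norm (prev W wb \<tau> \<zeta>))\<^sup>2 + 2 * noise \<tau> \<zeta> + (\<Sum>t\<in>{\<tau>..N}. noise t \<zeta>))"
      proof (intro mult_left_mono esum_mono add_right_mono)
        fix \<zeta> assume \<zeta>: "\<zeta> \<in> paths \<tau> b"
        have "last b = \<zeta> ! \<tau>" using last_prefix[OF paths_D(1)[OF \<zeta>] \<tau>] paths_D(2)[OF \<zeta>] by simp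
        then show "(norm ?x)\<^sup>2 \<le> 4 * L\<^sup>2 * (norm (prev W wb \<tau> \<zeta>))\<^sup>2 + 2 * noise \<tau> \<zeta>"
          using dyn_norm_le[OF paths_D(1)[OF \<zeta>] \<tau>] on(3)[OF \<zeta>] by simp
      qed (use cM_ge in simp)
      finally have "4 * L\<^sup>2 * theta ^ Suc N * esum \<tau> b (\<lambda>\<zeta>. (norm (at_prefix ?y N \<zeta>))\<^sup>2)
        \<le> 4 * L\<^sup>2 * theta ^ Suc N * (cM * esum \<tau> b (\<lambda>\<zeta>. 4 * L\<^sup>2 * (norm (prev W wb \<tau> \<zeta>))\<^sup>2 + 2 * noise \<tau> \<zeta> + (\<Sum>t\<in>{\<tau>..N}. noise t \<zeta>)))"
        using th L by (intro mult_left_mono) auto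
      then show "(if N < T then 4 * L\<^sup>2 * theta ^ Suc N * esum \<tau> b (\<lambda>\<zeta>. (norm (at_prefix ?y N \<zeta>))\<^sup>2) else 0)
        \<le> coef * esum \<tau> b (\<lambda>\<zeta>. 4 * L\<^sup>2 * (norm (prev W wb \<tau> \<zeta>))\<^sup>2 + 2 * noise \<tau> \<zeta> + (\<Sum>t\<in>{\<tau>..N}. noise t \<zeta>))"
        by (simp add: coef_def mult.assoc)
    qed (use cM_ge in simp)
    also have "\<dots> = esum \<tau> b (\<lambda>\<zeta>. cM * (2 * (\<Sum>t\<in>{Suc N..T}. theta ^ t * noise t \<zeta>)
       + coef * (4 * L\<^sup>2 * (norm (prev W wb \<tau> \<zeta>))\<^sup>2 + 2 * noise \<tau> \<zeta> + (\<Sum>t\<in>{\<tau>..N}. noise t \<zeta>))))"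
      by (simp only: esum_linear)
    finally show "esum \<tau> b (\<lambda>\<zeta>. theta ^ \<tau> * input_error W wb \<tau> \<zeta>)
      \<le> esum \<tau> b (\<lambda>\<zeta>. cM * (2 * (\<Sum>t\<in>{Suc N..T}. theta ^ t * noise t \<zeta>)
       + coef * (4 * L\<^sup>2 * (norm (prev W wb \<tau> \<zeta>))\<^sup>2 + 2 * noise \<tau> \<zeta> + (\<Sum>t\<in>{\<tau>..N}. noise t \<zeta>))))" .
  qed simp
  also have "\<dots> = cM * (2 * (\<Sum>t\<in>{Suc N..T}. theta ^ t * esum 0 a (noise t))
       + coef * (4 * L\<^sup>2 * q + 2 * esum 0 a (noise \<tau>) + (\<Sum>t\<in>{\<tau>..N}. esum 0 a (noise t))))"
    by (simp only: esum_linear esum_sum q_def)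
  also have "\<dots> \<le> cM * (2 * (\<Sum>t\<in>{Suc N..T}. theta ^ t * D2)
       + coef * (4 * L\<^sup>2 * q + 2 * D2 + (\<Sum>t\<in>{\<tau>..N}. D2)))"
    using D N \<tau> th coef cM_ge by (intro mult_left_mono add_mono sum_mono add_left_mono) auto
  also have "\<dots> \<le> theta ^ \<tau> * (cM * (2 * (\<kappa> * sqrt theta ^ W * D2)
       + 4 * L\<^sup>2 * cM * (4 * L\<^sup>2 * q * sqrt theta ^ W + 4 * \<kappa> * sqrt theta ^ W * D2)))"
  proof (cases "N < T")
    case False
    then have "N = T" using N by simp
    then show ?thesis using th L D q \<kappa> cM_ge by (simp add: coef_def)
  next
    case True
    then have N\<tau>: "N = \<tau> + W" by (simp add: N_def)
    have a: "(\<Sum>t\<in>{Suc N..T}. theta ^ t * D2) \<le> theta ^ \<tau> * (\<kappa> * sqrt theta ^ W * D2)"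
    proof -
      have "(\<Sum>t\<in>{Suc N..T}. theta ^ t * D2) = (\<Sum>t\<in>{Suc N..T}. (theta ^ \<tau> * theta ^ Suc W * D2) * theta ^ (t - Suc N))"
      proof (rule sum.cong)
        fix t assume "t \<in> {Suc N..T}"
        then have "t = \<tau> + Suc W + (t - Suc N)" using N\<tau> by auto
        then have "theta ^ t = theta ^ \<tau> * theta ^ Suc W * theta ^ (t - Suc N)"
          by (metis power_add)
        then show "theta ^ t * D2 = (theta ^ \<tau> * theta ^ Suc W * D2) * theta ^ (t - Suc N)" by simp
      qed simp
      also have "\<dots> = (theta ^ \<tau> * theta ^ Suc W * D2) * (\<Sum>t\<in>{Suc N..T}. theta ^ (t - Suc N))"
        by (simp add: sum_distrib_left)
      also have "\<dots> \<le> (theta ^ \<tau> * sqrt theta ^ W * D2) * (1 / (1 - theta))"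
        using th D by (intro mult_mono mult_left_mono mult_right_mono theta_power_le sum_power_diff_le sum_nonneg) auto
      also have "\<dots> = theta ^ \<tau> * (\<kappa> * sqrt theta ^ W * D2)"
        using th(3) by (simp add: \<kappa>_def)
      finally show ?thesis .
    qed
    have b: "coef * (4 * L\<^sup>2 * q + 2 * D2 + (\<Sum>t\<in>{\<tau>..N}. D2))
       \<le> theta ^ \<tau> * (4 * L\<^sup>2 * cM * (4 * L\<^sup>2 * q * sqrt theta ^ W + 4 * \<kappa> * sqrt theta ^ W * D2))"
    proof -
      have "coef * (4 * L\<^sup>2 * q + 2 * D2 + (\<Sum>t\<in>{\<tau>..N}. D2))
        = theta ^ \<tau> * (4 * L\<^sup>2 * cM * (4 * L\<^sup>2 * q * theta ^ Suc W + (real (W + 3) * theta ^ Suc W) * D2))"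
        using True by (simp add: coef_def N\<tau> power_add algebra_simps)
      also have "\<dots> \<le> theta ^ \<tau> * (4 * L\<^sup>2 * cM * (4 * L\<^sup>2 * q * sqrt theta ^ W + 4 * \<kappa> * sqrt theta ^ W * D2))"
        using th L cM_ge q D linear_times_theta_power[of W] theta_power_le[of W]
        by (intro mult_left_mono add_mono mult_right_mono) (auto simp: \<kappa>_def)
      finally show ?thesis .
    qed
    have "cM * (2 * (\<Sum>t\<in>{Suc N..T}. theta ^ t * D2) + coef * (4 * L\<^sup>2 * q + 2 * D2 + (\<Sum>t\<in>{\<tau>..N}. D2)))
      \<le> cM * (2 * (theta ^ \<tau> * (\<kappa> * sqrt theta ^ W * D2))
         + theta ^ \<tau> * (4 * L\<^sup>2 * cM * (4 * L\<^sup>2 * q * sqrt theta ^ W + 4 * \<kappa> * sqrt theta ^ W * D2)))"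
      using a b cM_ge by (intro mult_left_mono add_mono) auto
    then show ?thesis by (simp only: distrib_left ac_simps)
  qed
  finally have "theta ^ \<tau> * esum 0 a (input_error W wb \<tau>) \<le> theta ^ \<tau> * (cM * (2 * (\<kappa> * sqrt theta ^ W * D2)
       + 4 * L\<^sup>2 * cM * (4 * L\<^sup>2 * q * sqrt theta ^ W + 4 * \<kappa> * sqrt theta ^ W * D2)))"
    by (simp only: esum_linear)
  then have "esum 0 a (input_error W wb \<tau>) \<le> cM * (2 * (\<kappa> * sqrt theta ^ W * D2)
       + 4 * L\<^sup>2 * cM * (4 * L\<^sup>2 * q * sqrt theta ^ W + 4 * \<kappa> * sqrt theta ^ W * D2))"
    using th by (simp only: mult_le_cancel_left_pos zero_less_power)
  also have "\<dots> = ((2 * (cM * \<kappa>) + 16 * (L\<^sup>2 * cM\<^sup>2 * \<kappa>)) * D2 + 16 * (L^4 * cM\<^sup>2) * q) * sqrt theta ^ W"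
    by (simp add: power2_eq_square power4_eq_xxxx algebra_simps)
  also have "\<dots> \<le> (18 * (L^4 * cM\<^sup>2 * \<kappa>) * D2 + 18 * (L^4 * cM\<^sup>2 * \<kappa>) * q) * sqrt theta ^ W"
  proof (intro mult_right_mono add_mono)
    have L4: "L\<^sup>2 \<le> L^4" "1 \<le> L^4" using L by (auto intro: power_increasing)
    have c: "0 \<le> cM\<^sup>2 * \<kappa>" using \<kappa> by simp
    have 1: "cM * \<kappa> \<le> cM\<^sup>2 * \<kappa>"
      using cM_ge \<kappa> by (intro mult_right_mono) (auto simp: power2_eq_square)
    have 2: "1 * (cM\<^sup>2 * \<kappa>) \<le> L^4 * (cM\<^sup>2 * \<kappa>)" using L4 c by (intro mult_right_mono)
    have 3: "L\<^sup>2 * (cM\<^sup>2 * \<kappa>) \<le> L^4 * (cM\<^sup>2 * \<kappa>)" using L4 c by (intro mult_right_mono)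
    show "2 * (cM * \<kappa>) + 16 * (L\<^sup>2 * cM\<^sup>2 * \<kappa>) \<le> 18 * (L^4 * cM\<^sup>2 * \<kappa>)"
      using 1 2 3 by (simp add: mult.assoc)
    have "(L^4 * cM\<^sup>2) * 1 \<le> (L^4 * cM\<^sup>2) * \<kappa>" using \<kappa> L by (intro mult_left_mono) auto
    moreover have "0 \<le> L^4 * cM\<^sup>2 * \<kappa>" using \<kappa> L by simp
    ultimately show "16 * (L^4 * cM\<^sup>2) \<le> 18 * (L^4 * cM\<^sup>2 * \<kappa>)" by linarith
  qed (use D q th in auto)
  \<comment> \<open>This number is \<open>18 * 1100\<^sup>2 * 40\<close>, with 1100 from
    \<open>cM\<close> and 40 from \<open>\<kappa>\<close>.\<close>
  also have "\<dots> = 871200000 * (L^27 * cc^5 * sqrt theta ^ W * (q + D2))"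
    by (simp add: \<kappa>_def cM_def power_mult_distrib eval_nat_numeral algebra_simps)
  also have "\<dots> \<le> 10^9 * (L^27 * cc^5 * sqrt theta ^ W * (q + D2))"
    using L cc_ge(1) th q D by (intro mult_right_mono) auto
  finally show ?thesis by (simp add: q_def mult.assoc)
qed

text \<open>The input errors depend on the size of the SPC trajectory, and that size on the gap
  \<open>G\<close>: the trajectory is the optimal one plus a difference of energy
  \<open>2 * G\<close>. The result is a bound for \<open>G\<close> containing \<open>G\<close>
  itself, with a factor that the smallness hypothesis keeps at most \<open>1 / 2\<close>.\<close>

lemma closed_loop_gap:
  assumes ne: "paths 0 a \<noteq> {}" and D: "0 \<le> D2" "\<And>t. t \<le> T \<Longrightarrow> esum 0 a (noise t) \<le> esum 0 a (\<lambda>_. 1) * D2"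
    and small: "10^11 * L^38 * cc^7 * sqrt theta ^ W \<le> 1 / 2"
  shows "cost 0 T a (spc S P T W wb) - cost 0 T a (full W wb 0 a)
    \<le> 10^14 * L^45 * cc^8 * sqrt theta ^ W * (esum 0 a (\<lambda>_. 1) * ((norm wb)\<^sup>2 + real (Suc T) * D2))"
proof -
  let ?w = "spc S P T W wb"
  let ?z = "full W wb 0 a"
  define G where "G = cost 0 T a ?w - cost 0 T a ?z"
  define p where "p = esum 0 a (\<lambda>_. 1)"
  have p: "0 < p" unfolding p_def by (rule expectation_prefix(2)[OF ne])
  define s where "s = sqrt theta ^ W"
  have s: "0 \<le> s" using theta_bounds by (simp add: s_def)
  have L: "1 \<le> L" using params by simp
  define b where "b = (norm wb)\<^sup>2"
  define n where "n = real (Suc T) * D2"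
  have bn: "0 \<le> b" "0 \<le> n" "D2 \<le> n" using D by (auto simp: b_def n_def algebra_simps)
  define C where "C = 2 * L^7 * cc"
  define K where "K = 10^9 * L^27 * cc^5 * s"
  have C: "0 \<le> C" and K: "0 \<le> K" using L cc_ge(1) s by (auto simp: C_def K_def)
  define q where "q \<tau> = esum 0 a (\<lambda>\<zeta>. (norm (prev W wb \<tau> \<zeta>))\<^sup>2)" for \<tau>
  define Q where "Q = (\<Sum>\<tau>\<in>{0..T}. q \<tau>)"
  have wadm: "admissible 0 T a (dyn S wb (last a)) ?w" by (rule spc_admissible[OF ne])
  have zadm: "admissible 0 T a (dyn S wb (last a)) ?z"
    using full_minimal(1)[OF _ ne, of W wb] by (simp add: prev_def)
  have zst: "stationary 0 T a source ?z" by (rule full_minimal(3)[OF _ ne]) simp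
  let ?d = "\<lambda>t b. ?w t b - ?z t b"
  note d = admissible_diff[OF wadm zadm]
  have GE: "energy 0 T a ?d ?d = 2 * G"
    using cost_stationary_add[OF zst d] by (simp add: G_def)
  have G0: "0 \<le> G" using energy_nonneg[of T 0 a ?d] GE by simp
  have Gsum: "G \<le> C * K * (Q + p * n)"
  proof -
    have "G \<le> C * (\<Sum>\<tau>\<in>{0..T}. esum 0 a (input_error W wb \<tau>))"
      using cost_gap_telescope[OF ne, of W wb] by (simp add: G_def C_def)
    also have "\<dots> \<le> C * (\<Sum>\<tau>\<in>{0..T}. K * (q \<tau> + p * D2))"
    proof (intro mult_left_mono sum_mono C)
      fix \<tau> assume "\<tau> \<in> {0..T}"
      then show "esum 0 a (input_error W wb \<tau>) \<le> K * (q \<tau> + p * D2)"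
        unfolding K_def s_def q_def p_def using D p by (intro input_error_bound) (auto simp: p_def)
    qed
    also have "(\<Sum>\<tau>\<in>{0..T}. K * (q \<tau> + p * D2)) = K * (Q + p * n)"
      by (simp add: Q_def n_def sum_distrib_left[symmetric] sum.distrib algebra_simps)
    finally show ?thesis by simp
  qed
  have zsum: "esum 0 a (\<lambda>\<zeta>. \<Sum>t\<in>{0..T}. (norm (at_prefix ?z t \<zeta>))\<^sup>2) \<le> cM * (p * (4 * L\<^sup>2 * b + 3 * n))"
  proof -
    have "esum 0 a (\<lambda>\<zeta>. \<Sum>t\<in>{0..T}. (norm (at_prefix ?z t \<zeta>))\<^sup>2)
      \<le> cM * esum 0 a (\<lambda>\<zeta>. (norm (dyn S wb (last a)))\<^sup>2 + (\<Sum>t\<in>{0..T}. noise t \<zeta>))"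
      by (rule minimiser_energy_bound[OF _ _ zadm zst]) auto
    also have "\<dots> \<le> cM * esum 0 a (\<lambda>\<zeta>. 4 * L\<^sup>2 * b * 1 + 2 * noise 0 \<zeta> + (\<Sum>t\<in>{0..T}. noise t \<zeta>))"
    proof (intro mult_left_mono esum_mono add_right_mono)
      fix \<zeta> assume \<zeta>: "\<zeta> \<in> paths 0 a"
      show "(norm (dyn S wb (last a)))\<^sup>2 \<le> 4 * L\<^sup>2 * b * 1 + 2 * noise 0 \<zeta>"
        using dyn_norm_le[OF paths_D(1)[OF \<zeta>], of 0 wb] last_prefix[OF paths_D(1)[OF \<zeta>], of 0] paths_D(2)[OF \<zeta>]
        by (simp add: b_def)
    qed (use cM_ge in simp)
    also have "\<dots> = cM * (4 * L\<^sup>2 * b * p + 2 * esum 0 a (noise 0) + (\<Sum>t\<in>{0..T}. esum 0 a (noise t)))"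
      unfolding p_def by (simp only: esum_linear esum_sum)
    also have "\<dots> \<le> cM * (4 * L\<^sup>2 * b * p + 2 * (p * D2) + (\<Sum>t\<in>{0..T}. p * D2))"
      using D bn cM_ge by (intro mult_left_mono add_mono sum_mono) (auto simp: p_def)
    also have "\<dots> \<le> cM * (4 * L\<^sup>2 * b * p + 2 * (p * n) + p * n)"
      using bn p cM_ge by (intro mult_left_mono add_mono) (auto simp: n_def algebra_simps)
    finally show ?thesis by (simp add: algebra_simps)
  qed
  have wsum: "esum 0 a (\<lambda>\<zeta>. \<Sum>t\<in>{0..T}. (norm (?w t \<zeta>))\<^sup>2) \<le> 2 * (cM * (p * (4 * L\<^sup>2 * b + 3 * n))) + 24 * L^4 * cc * G"
  proof -
    have "esum 0 a (\<lambda>\<zeta>. \<Sum>t\<in>{0..T}. (norm (?w t \<zeta>))\<^sup>2)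
      \<le> esum 0 a (\<lambda>\<zeta>. 2 * (\<Sum>t\<in>{0..T}. (norm (at_prefix ?z t \<zeta>))\<^sup>2) + 2 * (\<Sum>t\<in>{0..T}. (norm (at_prefix ?d t \<zeta>))\<^sup>2))"
    proof (intro esum_mono)
      fix \<zeta> assume \<zeta>: "\<zeta> \<in> paths 0 a"
      have "(norm (?w t \<zeta>))\<^sup>2 \<le> 2 * (norm (at_prefix ?z t \<zeta>))\<^sup>2 + 2 * (norm (at_prefix ?d t \<zeta>))\<^sup>2" for t
        using norm_diff_sq_le[of "at_prefix ?z t \<zeta>" "- at_prefix ?d t \<zeta>"] spc_take[of t "Suc t" W wb \<zeta>]
        by (simp add: norm_minus_commute del: spc.simps)
      then have "(\<Sum>t\<in>{0..T}. (norm (?w t \<zeta>))\<^sup>2)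
        \<le> (\<Sum>t\<in>{0..T}. 2 * (norm (at_prefix ?z t \<zeta>))\<^sup>2 + 2 * (norm (at_prefix ?d t \<zeta>))\<^sup>2)"
        by (rule sum_mono)
      then show "(\<Sum>t\<in>{0..T}. (norm (?w t \<zeta>))\<^sup>2) \<le> 2 * (\<Sum>t\<in>{0..T}. (norm (at_prefix ?z t \<zeta>))\<^sup>2) + 2 * (\<Sum>t\<in>{0..T}. (norm (at_prefix ?d t \<zeta>))\<^sup>2)"
        by (simp only: sum.distrib sum_distrib_left[symmetric])
    qed
    also have "\<dots> = 2 * esum 0 a (\<lambda>\<zeta>. \<Sum>t\<in>{0..T}. (norm (at_prefix ?z t \<zeta>))\<^sup>2)
        + 2 * esum 0 a (\<lambda>\<zeta>. \<Sum>t\<in>{0..T}. (norm (at_prefix ?d t \<zeta>))\<^sup>2)"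
      by (simp only: esum_linear)
    also have "\<dots> \<le> 2 * (cM * (p * (4 * L\<^sup>2 * b + 3 * n))) + 2 * (6 * L^4 * cc * (2 * G))"
      using coercive[OF _ _ d] zsum unfolding GE by (intro add_mono mult_left_mono) auto
    finally show ?thesis by simp
  qed
  \<comment> \<open>The predecessors lag one step: \<open>wb\<close> at time 0, afterwards the SPC
    values at times 0 to \<open>T - 1\<close>.\<close>
  have Qle: "Q \<le> p * b + esum 0 a (\<lambda>\<zeta>. \<Sum>t\<in>{0..T}. (norm (?w t \<zeta>))\<^sup>2)"
  proof -
    have "Q = q 0 + (\<Sum>\<tau>\<in>{Suc 0..T}. q \<tau>)"
      unfolding Q_def by (subst sum.atLeast_Suc_atMost) auto
    also have "q 0 = p * b"
      by (simp add: q_def prev_def p_def b_def esum_def sum_distrib_right)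
    also have "(\<Sum>\<tau>\<in>{Suc 0..T}. q \<tau>) = (\<Sum>t\<in>(\<lambda>t. t - 1) ` {Suc 0..T}. esum 0 a (\<lambda>\<zeta>. (norm (?w t \<zeta>))\<^sup>2))"
    proof (subst sum.reindex)
      show "inj_on (\<lambda>t. t - 1) {Suc 0..T}" by (auto simp: inj_on_def)
      have "q t = esum 0 a (\<lambda>\<zeta>. (norm (?w (t - 1) \<zeta>))\<^sup>2)" if "t \<in> {Suc 0..T}" for t
        using that by (cases t) (simp_all add: q_def prev_def)
      then show "sum q {Suc 0..T} = sum ((\<lambda>t. esum 0 a (\<lambda>\<zeta>. (norm (?w t \<zeta>))\<^sup>2)) \<circ> (\<lambda>t. t - 1)) {Suc 0..T}"
        by (intro sum.cong) auto
    qed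
    also have "\<dots> \<le> (\<Sum>t\<in>{0..T}. esum 0 a (\<lambda>\<zeta>. (norm (?w t \<zeta>))\<^sup>2))"
      by (intro sum_mono2) (auto intro!: esum_nonneg)
    finally show ?thesis by (simp add: esum_sum)
  qed
  have Qb: "Q + p * n \<le> 10 * (L\<^sup>2 * cM) * (p * (b + n)) + 24 * L^4 * cc * G"
  proof -
    have "1 * cM \<le> L\<^sup>2 * cM" using L cM_ge by (intro mult_right_mono) auto
    then have c: "cM \<le> L\<^sup>2 * cM" "1 \<le> L\<^sup>2 * cM" using cM_ge(1) by linarith+
    have c': "1 + 8 * (L\<^sup>2 * cM) \<le> 10 * (L\<^sup>2 * cM)" "1 + 6 * cM \<le> 10 * (L\<^sup>2 * cM)"
      using c by linarith+
    have "p * b + 2 * (cM * (p * (4 * L\<^sup>2 * b + 3 * n))) + p * n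
      = (1 + 8 * (L\<^sup>2 * cM)) * (p * b) + (1 + 6 * cM) * (p * n)"
      by (simp add: algebra_simps)
    also have "\<dots> \<le> (10 * (L\<^sup>2 * cM)) * (p * b) + (10 * (L\<^sup>2 * cM)) * (p * n)"
      using bn p by (intro add_mono mult_right_mono c') auto
    finally show ?thesis using Qle wsum by (simp add: algebra_simps)
  qed
  have "G \<le> C * K * (10 * (L\<^sup>2 * cM) * (p * (b + n)) + 24 * L^4 * cc * G)"
    using Gsum Qb C K mult_left_mono[OF Qb, of "C * K"] by auto
  \<comment> \<open>The factor in front of \<open>G\<close> is the switching constant
    \<open>2 * L^7 * cc\<close>, times the input error constant with \<open>10^9\<close>, times
    \<open>24 * L^4 * cc\<close> from coercivity.\<close>
  also have "\<dots> = 10 * C * K * (L\<^sup>2 * cM) * (p * (b + n)) + (48000000000 * L^38 * cc^7 * s) * G"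
    by (simp add: C_def K_def eval_nat_numeral algebra_simps)
  also have "(48000000000 * L^38 * cc^7 * s) * G \<le> (1 / 2) * G"
  proof (rule mult_right_mono[OF _ G0])
    have "0 \<le> L^38 * cc^7 * s" using L cc_ge(1) s by simp
    then have "48000000000 * (L^38 * cc^7 * s) \<le> 10^11 * (L^38 * cc^7 * s)" by (intro mult_right_mono) auto
    then show "48000000000 * L^38 * cc^7 * s \<le> 1 / 2" using small by (simp add: s_def mult.assoc)
  qed
  finally have "G \<le> 20 * C * K * (L\<^sup>2 * cM) * (p * (b + n))" by simp
  also have "\<dots> = 44000000000000 * (L^45 * cc^8 * s * (p * (b + n)))"
    by (simp add: C_def K_def cM_def eval_nat_numeral algebra_simps)
  also have "\<dots> \<le> 10^14 * (L^45 * cc^8 * s * (p * (b + n)))"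
    using L cc_ge(1) s p bn by (intro mult_right_mono) auto
  finally show ?thesis by (simp add: G_def p_def b_def n_def s_def mult.assoc)
qed

section \<open>Comparison with the stated constants\<close>

text \<open>Only the reciprocal must be bounded from below, so each sum of nonnegative terms is
  reduced to a dominant one; the outcome \<open>L^16 * cc^3\<close> is then weakened to the monomial
  used later.\<close>

lemma gam_H_bounds: "0 < gam_H L \<alpha> \<gamma>" "10000 * (L^12 * cc\<^sup>2) \<le> 1 / gam_H L \<alpha> \<gamma>"
proof -
  have L: "1 \<le> L" using params by simp
  have b: "0 < (1 - \<alpha>)\<^sup>2" "(1 - \<alpha>)\<^sup>2 \<le> 1" using params by (auto simp: power_le_one)
  define F where "F = gam_F L \<alpha>"
  define G where "G = gam_G L \<alpha> \<gamma>"
  define H where "H = L_H L"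
  define m where "m = mu_bar L \<alpha> \<gamma>"
  have F: "0 < F" and G: "0 < G" using params by (auto simp: F_def G_def gam_F_def gam_G_def)
  have H: "3 \<le> H" using L by (simp add: H_def L_H_def)
  have L4: "4 \<le> (1 + L)\<^sup>2" using L power_mono[of 2 "1 + L" 2] by simp
  have iF: "4 * L\<^sup>2 \<le> 1 / F"
  proof -
    have "4 * L\<^sup>2 * 1 \<le> (1 + L)\<^sup>2 * L\<^sup>2 * (1 / (1 - \<alpha>)\<^sup>2)"
      using L4 b L by (intro mult_mono) auto
    then show ?thesis by (simp add: F_def gam_F_def)
  qed
  have iG: "8 * L^4 * cc \<le> 1 / G"
  proof -
    have "2 * 4 * L^4 * cc \<le> 2 * (1 + L)\<^sup>2 * L^4 * cc"
      using L4 cc_ge(1) L by (intro mult_mono) auto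
    then show ?thesis by (simp add: G_def gam_G_def cc_def)
  qed
  have m: "576 * L^6 * cc \<le> m"
  proof -
    have "2 * 3\<^sup>2 * (8 * L^4 * cc) * (4 * L\<^sup>2) \<le> 2 * H\<^sup>2 * (1 / G) * (1 / F)"
      using H iF iG F G L cc_ge(1) by (intro mult_mono power_mono) auto
    also have "\<dots> = (2 * H\<^sup>2 / G) / F" by simp
    also have "\<dots> \<le> (2 * H\<^sup>2 / G + G + H) / F"
      using F G H by (intro divide_right_mono) auto
    finally show ?thesis by (simp add: m_def mu_bar_def F_def G_def H_def eval_nat_numeral algebra_simps)
  qed
  have m0: "0 \<le> m" using m L cc_ge(1) by (rule_tac order_trans[OF _ m]) auto
  define X where "X = 2 / G + (1 + 4 * H / G + 4 * H\<^sup>2 / G\<^sup>2) * (H * (1 + m * H) / F) + m"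
  have "10000 * (L^12 * cc\<^sup>2) \<le> 10000 * (L^16 * cc^3)"
    using L cc_ge(1) mult_mono[of "L^12" "L^16" "cc\<^sup>2" "cc^3"] power_increasing[of 12 16 L] power_increasing[of 2 3 cc]
    by simp
  also have "\<dots> \<le> 47775744 * (L^16 * cc^3)"
    using L cc_ge(1) by (intro mult_right_mono) auto
  also have "\<dots> = (4 * 3\<^sup>2 * (8 * L^4 * cc)\<^sup>2) * (3 * ((576 * L^6 * cc) * 3) * (4 * L\<^sup>2))"
    by (simp add: power_mult_distrib eval_nat_numeral algebra_simps)
  also have "\<dots> \<le> (4 * H\<^sup>2 * (1 / G)\<^sup>2) * (H * (m * H) * (1 / F))"
    using H iF iG F G L cc_ge(1) m m0 by (intro mult_mono power_mono) auto
  also have "\<dots> = (4 * H\<^sup>2 / G\<^sup>2) * (H * (m * H) / F)" by (simp add: power_divide)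
  also have "\<dots> \<le> (1 + 4 * H / G + 4 * H\<^sup>2 / G\<^sup>2) * (H * (1 + m * H) / F)"
    using H F G m0 by (intro mult_mono divide_right_mono mult_left_mono) auto
  also have "\<dots> \<le> X" using G m0 by (simp add: X_def)
  finally have X: "10000 * (L^12 * cc\<^sup>2) \<le> X" .
  have eq: "gam_H L \<alpha> \<gamma> = inverse X"
    by (simp only: gam_H_def X_def F_def G_def H_def m_def)
  have "0 < 10000 * (L^12 * cc\<^sup>2)" using L cc_ge(1) by simp
  then have "0 < X" using X by linarith
  then show "0 < gam_H L \<alpha> \<gamma>" "10000 * (L^12 * cc\<^sup>2) \<le> 1 / gam_H L \<alpha> \<gamma>"
    using X by (simp_all add: eq inverse_eq_divide)
qed

text \<open>The square of \<open>rho\<close> is \<open>1 - v\<close> with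
  \<open>2 * v \<le> gam_H\<close>, whereas \<open>1 - theta\<close> is at least
  \<open>gam_H\<close>. Hence \<open>theta \<le> 1 - 2 * v \<le> (1 - v)\<^sup>2\<close>, and a
  square root gives the comparison. The smallness of \<open>gam_H\<close>, which makes
  \<open>rho\<close> slow, also makes \<open>c1\<close> large.\<close>

lemma rho_bounds:
  "0 < rho L \<alpha> \<gamma>" "rho L \<alpha> \<gamma> < 1" "sqrt theta \<le> (rho L \<alpha> \<gamma>)\<^sup>2" "200000000 * (L^24 * cc^4) \<le> c1 L \<alpha> \<gamma>"
proof -
  define g where "g = gam_H L \<alpha> \<gamma>"
  define H where "H = L_H L"
  define r where "r = rho L \<alpha> \<gamma>"
  have L: "1 \<le> L" using params by simp
  have g: "0 < g" "10000 * (L^12 * cc\<^sup>2) \<le> 1 / g" using gam_H_bounds by (auto simp: g_def)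
  have H: "3 \<le> H" using L by (simp add: H_def L_H_def)
  have "1 \<le> L^12 * cc\<^sup>2" using L cc_ge(1) mult_mono[of 1 "L^12" 1 "cc\<^sup>2"] by simp
  then have "2 \<le> 1 / g" using g by linarith
  then have g1: "g \<le> 1 / 2" using g by (simp add: field_simps)
  have H2: "9 \<le> H\<^sup>2" using power_mono[OF H, of 2] by simp
  have g2: "0 < g\<^sup>2" "g\<^sup>2 \<le> g / 2" using g g1 by (auto simp: power2_eq_square)
  define v where "v = 2 * g\<^sup>2 / (H\<^sup>2 + g\<^sup>2)"
  have r2: "(H\<^sup>2 - g\<^sup>2) / (H\<^sup>2 + g\<^sup>2) = 1 - v" using H2 g2 by (simp add: v_def field_simps)
  have v: "0 < v" "2 * v \<le> g"
  proof -
    have "0 < H\<^sup>2 + g\<^sup>2" using H2 g2 by linarith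
    then show "0 < v" using g2 by (simp add: v_def)
    have "2 \<le> H\<^sup>2 + g\<^sup>2" using H2 g2 by linarith
    then have "v \<le> 2 * g\<^sup>2 / 2" unfolding v_def by (intro divide_left_mono mult_pos_pos) auto
    then show "2 * v \<le> g" using g2 by linarith
  qed
  have v1: "v < 1" using v g1 by linarith
  have r: "r = sqrt (1 - v)" by (simp only: r_def rho_def r2[symmetric] g_def H_def)
  then show "0 < rho L \<alpha> \<gamma>" "rho L \<alpha> \<gamma> < 1" using v v1 by (auto simp: r_def)
  have "r\<^sup>2 = 1 - v" using v1 by (simp add: r)
  have "g \<le> 1 / (40 * L^5 * cc)"
  proof -
    have "L^5 * cc \<le> L^12 * cc\<^sup>2"
      using L cc_ge(1) by (intro mult_mono power_increasing) (auto simp: power2_eq_square)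
    then have "40 * L^5 * cc \<le> 10000 * (L^12 * cc\<^sup>2)" using power_cc_ge_1(2)[of 5] by linarith
    then have "40 * L^5 * cc \<le> 1 / g" using g by linarith
    moreover have "0 < 40 * L^5 * cc" using power_cc_ge_1(2)[of 5] by linarith
    ultimately show ?thesis using g by (simp add: field_simps)
  qed
  then have "theta \<le> 1 - 2 * v" using v by (simp add: theta_def)
  also have "\<dots> \<le> (1 - v)\<^sup>2" by (simp add: power2_eq_square algebra_simps)
  finally have "sqrt theta \<le> sqrt ((1 - v)\<^sup>2)" by (rule real_sqrt_le_mono)
  then show "sqrt theta \<le> (rho L \<alpha> \<gamma>)\<^sup>2" using v1 by (simp add: r_def[symmetric] \<open>r\<^sup>2 = 1 - v\<close>)
  have "200000000 * (L^24 * cc^4) \<le> 3 * (10000 * (L^12 * cc\<^sup>2))\<^sup>2"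
    using L cc_ge(1) by (simp add: power_mult_distrib flip: power_mult)
  also have "\<dots> \<le> H * (1 / g)\<^sup>2"
    using H g L cc_ge(1) by (intro mult_mono power_mono) auto
  also have "\<dots> = H / (g\<^sup>2 * 1)" by (simp add: power_divide)
  also have "\<dots> \<le> H / (g\<^sup>2 * r)"
    using H g2 v v1 by (intro divide_left_mono mult_left_mono mult_pos_pos) (auto simp: r)
  finally show "200000000 * (L^24 * cc^4) \<le> c1 L \<alpha> \<gamma>"
    by (simp add: c1_def H_def g_def r_def)
qed

lemma c1_ge: "1 \<le> c1 L \<alpha> \<gamma>" "40000000000000000 * (L^48 * cc^8) \<le> (c1 L \<alpha> \<gamma>)\<^sup>2"
proof -
  have L: "1 \<le> L" using params by simp
  have "1 \<le> L^24 * cc^4" using L cc_ge(1) mult_mono[of 1 "L^24" 1 "cc^4"] by simp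
  then show "1 \<le> c1 L \<alpha> \<gamma>" using rho_bounds(4) by linarith
  have "(200000000 * (L^24 * cc^4))\<^sup>2 \<le> (c1 L \<alpha> \<gamma>)\<^sup>2"
    using rho_bounds(4) L cc_ge(1) by (intro power_mono) auto
  then show "40000000000000000 * (L^48 * cc^8) \<le> (c1 L \<alpha> \<gamma>)\<^sup>2"
    by (simp add: power_mult_distrib flip: power_mult)
qed

text \<open>Since \<open>ln rho\<close> is negative, unwinding the threshold bounds
  \<open>(rho ^ W)\<^sup>2\<close> by the argument of the logarithm in \<open>Wbar\<close>; there
  the numerator is at most 1 and the denominator at least the square of \<open>c1\<close>.\<close>

lemma rho_power_le:
  assumes "Wbar L \<alpha> \<gamma> \<le> real W"
  shows "rho L \<alpha> \<gamma> ^ W \<le> 1 / c1 L \<alpha> \<gamma>"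
proof -
  let ?r = "rho L \<alpha> \<gamma>"
  define X where "X = (sqrt \<alpha> - \<alpha>) / (4 * (c1 L \<alpha> \<gamma>)\<^sup>2 * L^3)"
  have L: "1 \<le> L^3" using params by simp
  have c: "1 \<le> (c1 L \<alpha> \<gamma>)\<^sup>2" using c1_ge by simp
  have "\<alpha> < sqrt \<alpha>" "sqrt \<alpha> \<le> 1"
    using params real_less_rsqrt[of \<alpha> \<alpha>] by (auto simp: power2_eq_square)
  then have a: "0 < sqrt \<alpha> - \<alpha>" "sqrt \<alpha> - \<alpha> \<le> 1" using params by linarith+
  have X: "0 < X" unfolding X_def using a c1_ge(1) params by (intro divide_pos_pos mult_pos_pos) auto
  have "(1::real) * (c1 L \<alpha> \<gamma>)\<^sup>2 * 1 \<le> 4 * (c1 L \<alpha> \<gamma>)\<^sup>2 * L^3"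
    using L c by (intro mult_mono) auto
  then have "X \<le> 1 / (c1 L \<alpha> \<gamma>)\<^sup>2" unfolding X_def using a c L by (intro frac_le) auto
  have lr: "ln ?r < 0" using rho_bounds by simp
  have "ln X / (2 * ln ?r) \<le> real W" using assms by (simp add: Wbar_def X_def)
  then have "real W * (2 * ln ?r) \<le> ln X" using lr by (simp add: field_simps)
  then have "ln ((?r ^ W)\<^sup>2) \<le> ln X" using rho_bounds by (simp add: ln_realpow)
  then have "(?r ^ W)\<^sup>2 \<le> X" using X rho_bounds by simp
  also have "\<dots> \<le> (1 / c1 L \<alpha> \<gamma>)\<^sup>2" using \<open>X \<le> 1 / (c1 L \<alpha> \<gamma>)\<^sup>2\<close> by (simp add: power_divide)
  finally show ?thesis using c1_ge(1) by (intro power2_le_imp_le[of "?r ^ W"]) auto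
qed

text \<open>Already \<open>c3\<close> and \<open>c4\<close> dominate \<open>c1\<close>, so a single
  product inside \<open>c5\<close> and inside \<open>c7\<close> suffices. The negative summands in
  \<open>c5\<close> and \<open>c6\<close> are outweighed by the neighbouring terms with
  \<open>4 / (1 - rho)\<close>.\<close>

lemma final_constants_ge: "c1 L \<alpha> \<gamma> \<le> c5 L \<alpha> \<gamma>" "0 \<le> c6 L \<alpha> \<gamma>" "c1 L \<alpha> \<gamma> \<le> c7 L \<alpha> \<gamma>"
proof -
  define r where "r = rho L \<alpha> \<gamma>"
  define k1 where "k1 = c1 L \<alpha> \<gamma>"
  define k2 where "k2 = c2 L \<alpha> \<gamma>"
  define k3 where "k3 = c3 L \<alpha> \<gamma>"
  define k4 where "k4 = c4 L \<alpha> \<gamma>"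
  have L: "1 \<le> L" using params by simp
  have r: "0 < r" "r < 1" using rho_bounds by (auto simp: r_def)
  have k1: "1 \<le> k1" using c1_ge by (simp add: k1_def)
  have k1s: "k1 \<le> k1\<^sup>2" using k1 by (simp add: power2_eq_square)
  define s where "s = 1 - sqrt r"
  have s: "0 < s" "s \<le> 1" using r by (auto simp: s_def)
  have r1: "1 \<le> 1 / (1 - r)" "0 < 1 - r\<^sup>2" using r by (auto simp: power_less_one_iff)
  have kL: "1 \<le> k1\<^sup>2 * L" using k1 L mult_mono[of 1 "k1\<^sup>2" 1 L] by simp
  have k2: "1 \<le> k2"
  proof -
    have "0 < r powr (3/2)" "r powr (3/2) < 1" using r powr_less_mono2[of "3/2" r 1] by auto
    then have "0 < r * (1 - r powr (3/2))" "r * (1 - r powr (3/2)) \<le> 1"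
      using r by (auto intro!: mult_le_one)
    moreover have "1 \<le> 2 * k1\<^sup>2 * L" using kL by linarith
    ultimately show ?thesis by (simp add: k2_def c2_def k1_def r_def)
  qed
  have "0 \<le> 2 * k2 * L / s" using k2 L s by simp
  then have e: "1 \<le> 2 * k2 * L / s + 1 / (1 - r)" using r1 by linarith
  have k3: "k1 \<le> k3"
  proof -
    have "k1 * 1 * 1 \<le> (4 * k1\<^sup>2) * L * (2 * k2 * L / s + 1 / (1 - r))"
      using e k1 k1s L by (intro mult_mono) auto
    then show ?thesis by (simp add: k3_def c3_def k1_def k2_def r_def s_def)
  qed
  have k4: "k1 \<le> k4"
  proof -
    have "k1 * 1 * 1 \<le> (8 * k1\<^sup>2) * k2 * L^3"
      using k1 k1s k2 L by (intro mult_mono) auto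
    then show ?thesis by (simp add: k4_def c4_def k1_def k2_def)
  qed
  have k34: "1 \<le> k3" "1 \<le> k4" using k1 k3 k4 by auto
  have a: "1 \<le> 4 / (1 - r)" using r by simp
  have b: "1 \<le> 2 * k2 * L / s + k3 * L / 2 + 1" using k2 k34 L s by (simp add: add_nonneg_nonneg)
  have c: "0 \<le> - 1 + 2 * k3 * L + 4 / (1 - r) + 8 * k2 * L / s"
  proof -
    have "0 \<le> 2 * k3 * L" "0 \<le> 8 * k2 * L / s" using k2 k34 L s by auto
    then show ?thesis using a by linarith
  qed
  have "k1 \<le> k3 * (2 * k2 * L / s + k3 * L / 2 + 1)"
    using k3 k34 mult_left_mono[OF b, of k3] by linarith
  also have "\<dots> \<le> k3 * (2 * k2 * L / s + k3 * L / 2 + 1)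
    + 2 * k1\<^sup>2 * k3 * L\<^sup>2 / (1 - r\<^sup>2) * (- 1 + 2 * k3 * L + 4 / (1 - r) + 8 * k2 * L / s)"
  proof -
    have "0 \<le> 2 * k1\<^sup>2 * k3 * L\<^sup>2 / (1 - r\<^sup>2)" using k34 r1(2) by simp
    from mult_nonneg_nonneg[OF this c] show ?thesis by linarith
  qed
  also have "\<dots> = c5 L \<alpha> \<gamma>"
    by (simp add: c5_def Let_def k1_def k2_def k3_def r_def s_def)
  finally show "c1 L \<alpha> \<gamma> \<le> c5 L \<alpha> \<gamma>" by (simp add: k1_def)
  have "k4 * 1 \<le> k4 * (4 / (1 - r))" using a k34 by (intro mult_left_mono) auto
  \<comment> \<open>This groups the one negative summand of \<open>c6\<close> with a term that
    dominates it; everything else is visibly nonnegative.\<close>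
  define e where "e = - k4 + 4 * k4 / (1 - r)"
  have d: "0 \<le> e" using \<open>k4 * 1 \<le> k4 * (4 / (1 - r))\<close> by (simp add: e_def mult.commute)
  have "0 \<le> 1 / s * (2 * k2 * k4 * L / s + k3 * k4 * L + k4 + 2 * k2 * k3 * L\<^sup>2
     + 2 * k1\<^sup>2 * L\<^sup>2 / (1 - r\<^sup>2)
       * (e + 2 * k3 * k4 * L + 8 * k2 * k4 * L / s + 2 * k3 * L * (4 * k2 * L + k4)))"
    using d k2 k34 L s r1 by (intro mult_nonneg_nonneg add_nonneg_nonneg divide_nonneg_nonneg) auto
  also have "\<dots> = c6 L \<alpha> \<gamma>"
    by (simp add: c6_def Let_def k1_def k2_def k3_def k4_def r_def s_def e_def algebra_simps)
  finally show "0 \<le> c6 L \<alpha> \<gamma>" .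
  have "k1 \<le> 1 * (k4 * (1 + 0) + 0)" using k4 by simp
  also have "\<dots> \<le> 1 / (1 - r) * (k4 * (2 * k2 * L\<^sup>2 + k4 * L / 2) + 4 * k1\<^sup>2 * k4 * L^3 * (4 * k2 * L + k4) / (1 - r\<^sup>2))"
  proof (intro mult_mono add_mono mult_left_mono r1)
    have "1 * 1 \<le> k2 * L\<^sup>2" using k2 L by (intro mult_mono) auto
    then show "1 \<le> 2 * k2 * L\<^sup>2" by simp
  qed (use k2 k34 L r r1 in \<open>auto intro!: add_nonneg_nonneg divide_nonneg_nonneg mult_nonneg_nonneg\<close>)
  also have "\<dots> = c7 L \<alpha> \<gamma>"
    by (simp add: c7_def Let_def k1_def k2_def k4_def r_def)
  finally show "c1 L \<alpha> \<gamma> \<le> c7 L \<alpha> \<gamma>" by (simp add: k1_def)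
qed

section \<open>Return to conditional expectations and the final estimate\<close>

lemma noise_le_Dconst:
  assumes ne: "paths 0 [xi0] \<noteq> {}" and t: "t \<le> T"
  shows "esum 0 [xi0] (noise t) \<le> esum 0 [xi0] (\<lambda>_. 1) * (Dconst S P T xi0)\<^sup>2"
proof -
  define e where "e t = measure_pmf.expectation (cond_pmf P {\<zeta>. take 1 \<zeta> = [xi0]}) (\<lambda>\<zeta>. (pnorm S (\<zeta> ! t))\<^sup>2)" for t
  define p where "p = esum 0 [xi0] (\<lambda>_. 1)"
  have p: "0 < p" unfolding p_def by (rule expectation_prefix(2)[OF ne])
  have e: "e t = esum 0 [xi0] (noise t) / p" for t
    using expectation_prefix(1)[OF ne, of "noise t"] by (simp add: e_def p_def noise_def[abs_def])
  have "0 \<le> e t" unfolding e using p by (intro divide_nonneg_pos esum_nonneg noise_nonneg)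
  have "sqrt (e t) \<le> Dconst S P T xi0"
    unfolding Dconst_def e_def using t by (intro Max_ge) auto
  then have "(sqrt (e t))\<^sup>2 \<le> (Dconst S P T xi0)\<^sup>2" using \<open>0 \<le> e t\<close> by (intro power_mono) auto
  then have "e t \<le> (Dconst S P T xi0)\<^sup>2" using \<open>0 \<le> e t\<close> by simp
  then show ?thesis using p by (simp add: e p_def[symmetric] field_simps)
qed

text \<open>As \<open>J_star\<close> is an infimum, a lower bound is required: minimality of the
  full solution at time 0 bounds every member of the set.\<close>

lemma J_gap_le:
  assumes ne: "paths 0 [xi0] \<noteq> {}"
  shows "J_spc S P T W xi0 wb - J_star S P T xi0 wb
    \<le> (cost 0 T [xi0] (spc S P T W wb) - cost 0 T [xi0] (full W wb 0 [xi0])) / esum 0 [xi0] (\<lambda>_. 1)"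
proof -
  define p where "p = esum 0 [xi0] (\<lambda>_. 1)"
  have p: "0 < p" unfolding p_def by (rule expectation_prefix(2)[OF ne])
  have "J_spc S P T W xi0 wb = esum 0 [xi0] (\<lambda>\<zeta>. \<Sum>t\<in>{0..T}. stage S (spc S P T W wb t \<zeta>) (\<zeta> ! t)) / p"
    using expectation_prefix(1)[OF ne, of "\<lambda>\<zeta>. \<Sum>t\<in>{0..T}. stage S (spc S P T W wb t \<zeta>) (\<zeta> ! t)"]
    by (simp add: J_spc_def p_def)
  also have "esum 0 [xi0] (\<lambda>\<zeta>. \<Sum>t\<in>{0..T}. stage S (spc S P T W wb t \<zeta>) (\<zeta> ! t)) = cost 0 T [xi0] (spc S P T W wb)"
    unfolding cost_def by (intro esum_cong) (simp add: spc_take)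
  finally have 1: "J_spc S P T W xi0 wb = cost 0 T [xi0] (spc S P T W wb) / p" .
  have "cost 0 T [xi0] (full W wb 0 [xi0]) / p \<le> J_star S P T xi0 wb"
    unfolding J_star_def
  proof (rule cInf_greatest)
    show "{tr_cost S P T 0 T [xi0] w |w. tr_feasible S P T 0 T [xi0] wb w} \<noteq> {}"
      using full_minimal(1)[OF _ ne, of W wb] tr_feasible_iff[of 0 T "[xi0]" wb "full W wb 0 [xi0]"]
      by (auto simp: prev_def)
    fix c assume "c \<in> {tr_cost S P T 0 T [xi0] w |w. tr_feasible S P T 0 T [xi0] wb w}"
    then obtain w where w: "c = tr_cost S P T 0 T [xi0] w" "tr_feasible S P T 0 T [xi0] wb w" by auto
    then have "cost 0 T [xi0] (full W wb 0 [xi0]) \<le> cost 0 T [xi0] w"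
      using full_minimal(2)[OF _ ne, of W wb w] by (simp add: prev_def tr_feasible_iff)
    then show "cost 0 T [xi0] (full W wb 0 [xi0]) / p \<le> c"
      using p by (simp add: w(1) tr_cost_eq[OF ne] p_def[symmetric] divide_right_mono)
  qed
  then show ?thesis by (simp add: 1 p_def[symmetric] diff_divide_distrib)
qed

text \<open>Of the two factors in \<open>sqrt theta ^ W \<le> rho ^ W * rho ^ W\<close> one is kept
  as the rate and the other is at most \<open>1 / c1\<close>. The square of \<open>c1\<close>
  exceeds the accumulated constant, so what remains is one \<open>c1\<close>, which
  \<open>c5\<close> and \<open>c7\<close> dominate.\<close>

lemma spc_performance:
  assumes T: "0 < T" and ne: "paths 0 [xi0] \<noteq> {}" and W: "Wbar L \<alpha> \<gamma> \<le> real W"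
  shows "J_spc S P T W xi0 wb - J_star S P T xi0 wb
           \<le> (c5 L \<alpha> \<gamma> * (Dconst S P T xi0)^2 * real T
              + c6 L \<alpha> \<gamma> * Dconst S P T xi0 * norm wb
              + c7 L \<alpha> \<gamma> * (norm wb)^2) * (rho L \<alpha> \<gamma>) ^ W"
proof -
  define r where "r = rho L \<alpha> \<gamma>"
  define k where "k = c1 L \<alpha> \<gamma>"
  define D where "D = Dconst S P T xi0"
  define s where "s = sqrt theta ^ W"
  define p where "p = esum 0 [xi0] (\<lambda>_. 1)"
  define Y where "Y = L^48 * cc^8"
  have L: "1 \<le> L" using params by simp
  have p: "0 < p" unfolding p_def by (rule expectation_prefix(2)[OF ne])
  have r: "0 < r" using rho_bounds by (simp add: r_def)
  have k: "1 \<le> k" "40000000000000000 * Y \<le> k\<^sup>2" using c1_ge by (auto simp: k_def Y_def)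
  have Y: "1 \<le> Y" unfolding Y_def using L cc_ge(1) mult_mono[of 1 "L^48" 1 "cc^8"] by simp
  have rW: "r ^ W \<le> 1 / k" using rho_power_le[OF W] by (simp add: r_def k_def)
  have "s \<le> (r\<^sup>2) ^ W"
    unfolding s_def r_def using rho_bounds(3) theta_bounds by (intro power_mono) auto
  also have "\<dots> = r ^ W * r ^ W" by (metis power2_eq_square power_mult_distrib)
  finally have s: "s \<le> r ^ W * r ^ W" "0 \<le> s" using theta_bounds by (auto simp: s_def)
  have s1: "s \<le> (1 / k) * r ^ W" using rW r by (intro order_trans[OF s(1)] mult_right_mono) auto
  also have "\<dots> \<le> (1 / k) * (1 / k)" using rW k by (intro mult_left_mono) auto
  finally have s2: "s \<le> (1 / k) * (1 / k)" .
  have sk: "s * k\<^sup>2 \<le> 1" using s2 k by (simp add: power2_eq_square field_simps)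
  \<comment> \<open>Here both factors are spent: \<open>s\<close> times the square of
    \<open>c1\<close> is at most 1, which meets the absorption condition.\<close>
  have small: "10^11 * L^38 * cc^7 * s \<le> 1 / 2"
  proof -
    have "L^38 * cc^7 \<le> Y" unfolding Y_def using L cc_ge(1) by (intro mult_mono power_increasing) auto
    then have "100000000000 * (L^38 * cc^7) * 2 \<le> k\<^sup>2" using k(2) Y by linarith
    then have "(100000000000 * (L^38 * cc^7) * 2) * s \<le> k\<^sup>2 * s" using s by (intro mult_right_mono) auto
    then show ?thesis using sk by (simp add: ac_simps)
  qed
  have D0: "0 \<le> D"
  proof -
    have "sqrt (measure_pmf.expectation (cond_pmf P {\<zeta>. take 1 \<zeta> = [xi0]}) (\<lambda>\<zeta>. (pnorm S (\<zeta> ! 0))\<^sup>2)) \<le> D"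
      unfolding D_def Dconst_def by (intro Max_ge) auto
    moreover have "0 \<le> sqrt (measure_pmf.expectation (cond_pmf P {\<zeta>. take 1 \<zeta> = [xi0]}) (\<lambda>\<zeta>. (pnorm S (\<zeta> ! 0))\<^sup>2))"
      by (simp add: integral_nonneg_AE)
    ultimately show ?thesis by linarith
  qed
  define b where "b = (norm wb)\<^sup>2 + real T * D\<^sup>2"
  have b: "0 \<le> b" by (simp add: b_def)
  have "J_spc S P T W xi0 wb - J_star S P T xi0 wb
    \<le> (cost 0 T [xi0] (spc S P T W wb) - cost 0 T [xi0] (full W wb 0 [xi0])) / p"
    using J_gap_le[OF ne] by (simp add: p_def)
  also have "\<dots> \<le> (10^14 * L^45 * cc^8 * s * (p * ((norm wb)\<^sup>2 + real (Suc T) * D\<^sup>2))) / p"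
    unfolding s_def p_def using p small noise_le_Dconst[OF ne]
    by (intro divide_right_mono closed_loop_gap[OF ne]) (auto simp: p_def D_def s_def)
  also have "\<dots> = 10^14 * (L^45 * cc^8) * s * ((norm wb)\<^sup>2 + real (Suc T) * D\<^sup>2)"
    using p by simp
  also have "\<dots> \<le> 10^14 * Y * s * (2 * b)"
  proof (intro mult_mono)
    show "L^45 * cc^8 \<le> Y" unfolding Y_def using L cc_ge(1) by (intro mult_right_mono power_increasing) auto
    \<comment> \<open>Because \<open>0 < T\<close>, the additional stage in
      \<open>real (Suc T)\<close> costs no more than doubling.\<close>
    define E where "E = real T * D\<^sup>2"
    have "1 * D\<^sup>2 \<le> E" unfolding E_def using T by (intro mult_right_mono) auto
    then have "D\<^sup>2 \<le> (norm wb)\<^sup>2 + E" by (intro add_increasing) auto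
    moreover have "(norm wb)\<^sup>2 + real (Suc T) * D\<^sup>2 = (norm wb)\<^sup>2 + E + D\<^sup>2"
      by (simp add: E_def distrib_right)
    moreover have "2 * b = (norm wb)\<^sup>2 + E + ((norm wb)\<^sup>2 + E)" by (simp add: b_def E_def)
    ultimately show "(norm wb)\<^sup>2 + real (Suc T) * D\<^sup>2 \<le> 2 * b" by (simp only: add_left_mono)
  qed (use L s Y cc_ge(1) b in auto)
  also have "\<dots> = (2 * 10^14 * Y) * b * s" by simp
  also have "\<dots> \<le> k\<^sup>2 * b * ((1 / k) * r ^ W)"
    using k(2) Y b s s1 by (intro mult_mono) auto
  also have "\<dots> = (k * b) * r ^ W" using k by (simp add: power2_eq_square)
  also have "\<dots> \<le> (c5 L \<alpha> \<gamma> * D\<^sup>2 * real T + c6 L \<alpha> \<gamma> * D * norm wb + c7 L \<alpha> \<gamma> * (norm wb)\<^sup>2) * r ^ W"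
  proof (rule mult_right_mono)
    have "k * (D\<^sup>2 * real T) \<le> c5 L \<alpha> \<gamma> * (D\<^sup>2 * real T)"
      using final_constants_ge(1) by (intro mult_right_mono) (auto simp: k_def)
    moreover have "k * (norm wb)\<^sup>2 \<le> c7 L \<alpha> \<gamma> * (norm wb)\<^sup>2"
      using final_constants_ge(3) by (intro mult_right_mono) (auto simp: k_def)
    moreover have "0 \<le> c6 L \<alpha> \<gamma> * D * norm wb" using final_constants_ge(2) D0 by simp
    ultimately show "k * b \<le> c5 L \<alpha> \<gamma> * D\<^sup>2 * real T + c6 L \<alpha> \<gamma> * D * norm wb + c7 L \<alpha> \<gamma> * (norm wb)\<^sup>2"
      by (simp add: b_def algebra_simps)
  qed (use r in simp)
  finally show ?thesis by (simp only: D_def r_def)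
qed

end

theorem theorem3:
  fixes S :: "('xi, 'nx::finite, 'nu::finite) lqdata"
    and P :: "'xi list pmf" and T :: nat and L \<alpha> \<gamma> :: real
    and xi0 :: 'xi and wb :: "(real^'nx) \<times> (real^'nu)" and W :: nat
  assumes "0 < T"
    and "\<forall>\<zeta>\<in>set_pmf P. length \<zeta> = Suc T"
    and "finite (set_pmf P)"
    and "\<forall>\<xi>. transpose (Qm S \<xi>) = Qm S \<xi>"
    and "\<forall>\<xi>. transpose (Rm S \<xi>) = Rm S \<xi>"
    and "assumption2 S P T L \<alpha> \<gamma>"
    and "xi0 \<in> (\<lambda>\<zeta>. \<zeta> ! 0) ` set_pmf P"
    and "Wbar L \<alpha> \<gamma> \<le> real W"
  shows "J_spc S P T W xi0 wb - J_star S P T xi0 wb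
           \<le> (c5 L \<alpha> \<gamma> * (Dconst S P T xi0)^2 * real T
              + c6 L \<alpha> \<gamma> * Dconst S P T xi0 * norm wb
              + c7 L \<alpha> \<gamma> * (norm wb)^2) * (rho L \<alpha> \<gamma>) ^ W"
proof -
  interpret lq_tree S P T L \<alpha> \<gamma>
    by unfold_locales (use assms in auto)
  obtain \<zeta> where \<zeta>: "\<zeta> \<in> set_pmf P" "\<zeta> ! 0 = xi0" using assms(7) by auto
  then have "take (Suc 0) \<zeta> = [xi0]" using assms(2) by (cases \<zeta>) auto
  then have "paths 0 [xi0] \<noteq> {}" using \<zeta> by (auto simp: paths_def)
  then show ?thesis using assms(1,8) by (intro spc_performance)
qed

end
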